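(* Let $0<\sigma<1$, $\alpha\ge-1/2$, $\beta>-1/2$ and $0\le a,b<\infty$. Define $$u_j(\theta)=(\sin\tfrac\theta2)^{aj}(\cos\tfrac\theta2)^{bj},\quad\theta\in(0,\pi),\ j=0,1,\ldots.$$ Then there exists a constant $C$ depending only on $\sigma$, $\alpha$ and $\beta$, such that $$\left\|\left(\sum_{j=0}^\infty\left|u_j(\mathcal{J}^{\alpha+aj,\beta+bj})^{-\sigma/2}(u_j^{-1}f_j)\right|^2\right)^{1/2}\right\|_{L^q((0,\pi),d\mu_{\alpha,\beta})}\le C\left\|\left(\sum_{j=0}^\infty|f_j|^2\right)^{1/2}\right\|_{L^p((0,\pi),d\mu_{\alpha,\beta})},$$ for all $f_j\in L^p((0,\pi),d\mu_{\alpha,\beta})$, provided that the exponents $p,q$ satisfy $$1\le\max\left\{\frac{2\alpha+2}{\alpha+3/2},\frac{2\beta+2}{\beta+3/2}\right\}<p\le q<\min\left\{\frac{2\alpha+2}{\alpha+1/2},\frac{2\beta+2}{\beta+1/2}\right\}\le\infty$$ and $$\frac1q\ge\frac1p-\min\left\{\frac{\sigma}{2\alpha+2},\frac{\sigma}{2\beta+2}\right\}.$$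
   Context: A quotient $\frac{2\alpha+2}{\alpha+1/2}$ with $\alpha=-1/2$ is read as $+\infty$. For $\alpha,\beta>-1$ let $d\mu_{\alpha,\beta}(\theta)=(\sin\frac\theta2)^{2\alpha+1}(\cos\frac\theta2)^{2\beta+1}\,d\theta$ on $(0,\pi)$. Let $P_n^{(\alpha,\beta)}$ be the standard Jacobi polynomials, $$P_n^{(\alpha,\beta)}(x)=(1-x)^{-\alpha}(1+x)^{-\beta}\frac{(-1)^n}{2^nn!}\left(\frac{d}{dx}\right)^n\left\{(1-x)^{n+\alpha}(1+x)^{n+\beta}\right\},$$ and $\mathcal{P}_n^{(\alpha,\beta)}(\theta)=d_n^{\alpha,\beta}P_n^{(\alpha,\beta)}(\cos\theta)$, where $$d_n^{\alpha,\beta}=\left(\frac{(2n+\alpha+\beta+1)\Gamma(n+1)\Gamma(n+\alpha+\beta+1)}{\Gamma(n+\alpha+1)\Gamma(n+\beta+1)}\right)^{1/2};$$ these form a complete orthonormal basis of $L^2((0,\pi),d\mu_{\alpha,\beta})$ and are eigenfunctions, with eigenvalues $\left(n+\frac{\alpha+\beta+1}{2}\right)^2$, of $$\mathcal{J}^{\alpha,\beta}=-\frac{d^2}{d\theta^2}-\frac{\alpha-\beta+(\alpha+\beta+1)\cos\theta}{\sin\theta}\frac{d}{d\theta}+\left(\frac{\alpha+\beta+1}{2}\right)^2.$$ For $0<\sigma<1$ the Jacobi fractional integral is defined on $L^2((0,\pi),d\mu_{\alpha,\beta})$ by $$(\mathcal{J}^{\alpha,\beta})^{-\sigma/2}f=\sum_{n=0}^\infty\frac{1}{\left(n+\frac{\alpha+\beta+1}{2}\right)^\sigma}\left(\int_0^\pi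 f\,\mathcal{P}_n^{(\alpha,\beta)}\,d\mu_{\alpha,\beta}\right)\mathcal{P}_n^{(\alpha,\beta)},$$ or, equivalently, by the integral formula $$(\mathcal{J}^{\alpha,\beta})^{-\sigma/2}f(\theta)=\int_0^\pi\mathcal{K}^{\alpha,\beta}_\sigma(\theta,\varphi)f(\varphi)\,d\mu_{\alpha,\beta}(\varphi),\qquad \mathcal{K}^{\alpha,\beta}_\sigma(\theta,\varphi)=\frac{1}{\Gamma(\sigma)}\int_0^\infty\sum_{n=0}^\infty e^{-t\left|n+\frac{\alpha+\beta+1}{2}\right|}\mathcal{P}_n^{(\alpha,\beta)}(\theta)\mathcal{P}_n^{(\alpha,\beta)}(\varphi)\,\frac{dt}{t^{1-\sigma}}.$$ *)

theory Defs
  imports "HOL-Analysis.Analysis"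
begin

definition jacobi_measure :: "real \<Rightarrow> real \<Rightarrow> real measure" where
  "jacobi_measure \<alpha> \<beta> = density (restrict_space lborel {0<..<pi})
     (\<lambda>\<theta>. ennreal (sin (\<theta>/2) powr (2*\<alpha>+1) * cos (\<theta>/2) powr (2*\<beta>+1)))"

(* Rodrigues' formula; it is the Jacobi polynomial for -1 < x < 1 only, because of the
   real powers.  All uses below are at x = cos \<theta> with 0 < \<theta> < pi. *)
definition jacobi_P :: "nat \<Rightarrow> real \<Rightarrow> real \<Rightarrow> real \<Rightarrow> real" where
  "jacobi_P n \<alpha> \<beta> x =
     (1 - x) powr (-\<alpha>) * (1 + x) powr (-\<beta>) * ((-1)^n / (2^n * fact n)) *
     (deriv ^^ n) (\<lambda>y. (1 - y) powr (real n + \<alpha>) * (1 + y) powr (real n + \<beta>)) x"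

(* For \<alpha> + \<beta> = -1 and n = 0 the formula has to be read as a limit, which this
   definition does not do; elsewhere in the range \<alpha>, \<beta> > -1 it is unproblematic. *)
definition jacobi_d :: "nat \<Rightarrow> real \<Rightarrow> real \<Rightarrow> real" where
  "jacobi_d n \<alpha> \<beta> = sqrt
     ((2 * real n + \<alpha> + \<beta> + 1) * Gamma (real n + 1) * Gamma (real n + \<alpha> + \<beta> + 1) /
      (Gamma (real n + \<alpha> + 1) * Gamma (real n + \<beta> + 1)))"

definition jacobi_fun :: "nat \<Rightarrow> real \<Rightarrow> real \<Rightarrow> real \<Rightarrow> real" where
  "jacobi_fun n \<alpha> \<beta> \<theta> = jacobi_d n \<alpha> \<beta> * jacobi_P n \<alpha> \<beta> (cos \<theta>)"

definition jacobi_kernel :: "real \<Rightarrow> real \<Rightarrow> real \<Rightarrow> real \<Rightarrow> real \<Rightarrow> real" where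
  "jacobi_kernel \<sigma> \<alpha> \<beta> \<theta> \<phi> = 1 / Gamma \<sigma> *
     (LINT t:{0<..}|lborel.
        (\<Sum>n. exp (- t * \<bar>real n + (\<alpha> + \<beta> + 1) / 2\<bar>) *
              jacobi_fun n \<alpha> \<beta> \<theta> * jacobi_fun n \<alpha> \<beta> \<phi>) / t powr (1 - \<sigma>))"

(* The Bochner integral of a non-integrable function is 0, so jacobi_frac is the fractional
   integral of f at \<theta> only where jacobi_frac_defined holds. *)
definition jacobi_frac_defined ::
    "real \<Rightarrow> real \<Rightarrow> real \<Rightarrow> (real \<Rightarrow> complex) \<Rightarrow> real \<Rightarrow> bool" where
  "jacobi_frac_defined \<sigma> \<alpha> \<beta> f \<theta> \<longleftrightarrow>
     integrable (jacobi_measure \<alpha> \<beta>) (\<lambda>\<phi>. jacobi_kernel \<sigma> \<alpha> \<beta> \<theta> \<phi> *\<^sub>R f \<phi>)"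

definition jacobi_frac ::
    "real \<Rightarrow> real \<Rightarrow> real \<Rightarrow> (real \<Rightarrow> complex) \<Rightarrow> real \<Rightarrow> complex" where
  "jacobi_frac \<sigma> \<alpha> \<beta> f \<theta> =
     (LINT \<phi>|jacobi_measure \<alpha> \<beta>. jacobi_kernel \<sigma> \<alpha> \<beta> \<theta> \<phi> *\<^sub>R f \<phi>)"

definition jacobi_u :: "real \<Rightarrow> real \<Rightarrow> nat \<Rightarrow> real \<Rightarrow> real" where
  "jacobi_u a b j \<theta> = sin (\<theta>/2) powr (a * real j) * cos (\<theta>/2) powr (b * real j)"

text \<open>Powers with exponent \<open>r > 0\<close> of extended nonnegative reals.\<close>
definition epowr :: "ennreal \<Rightarrow> real \<Rightarrow> ennreal" where
  "epowr x r = (if x = \<infinity> then \<infinity> else ennreal (enn2real x powr r))"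

definition eLp_norm :: "real \<Rightarrow> 'a measure \<Rightarrow> ('a \<Rightarrow> ennreal) \<Rightarrow> ennreal" where
  "eLp_norm p M F = epowr (\<integral>\<^sup>+ x. epowr (F x) p \<partial>M) (1 / p)"

definition in_Lp :: "real \<Rightarrow> 'a measure \<Rightarrow> ('a \<Rightarrow> complex) \<Rightarrow> bool" where
  "in_Lp p M f \<longleftrightarrow> f \<in> borel_measurable M \<and> eLp_norm p M (\<lambda>x. ennreal (norm (f x))) < \<infinity>"

definition l2_seq_norm :: "(nat \<Rightarrow> complex) \<Rightarrow> ennreal" where
  "l2_seq_norm z = epowr (\<Sum>j. ennreal ((norm (z j))\<^sup>2)) (1 / 2)"

definition upper_exponent :: "real \<Rightarrow> ereal" where
  "upper_exponent \<alpha> = (if \<alpha> = -1/2 then \<infinity> else ereal ((2*\<alpha>+2) / (\<alpha>+1/2)))"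

end

theory Submission
  imports Defs "HOL-Complex_Analysis.Complex_Analysis" "HOL-Real_Asymp.Real_Asymp"
begin

text \<open>
  With \<open>x = (sin (\<theta>/2))\<^sup>2\<close> and \<open>y = (sin (\<phi>/2))\<^sup>2\<close>, the product of two Jacobi polynomials is a signed
  sum of the polynomials \<open>bailey N x y\<close> (Bailey's formula, proved by comparing eigenfunctions of the
  Jacobi operator).  Summation over the degree turns the Poisson kernel into a positive series, which
  is \<open>sinh (t/2) / 2\<close> times the Laplace transform, at \<open>cosh (t/2)\<close>, of a product of two functions
  \<open>sqrt z * I\<^sub>\<nu> z\<close>.  These are at most \<open>18 * exp z * (min 1 z) powr m\<close> for all
  \<open>\<nu> \<ge> m - 1/2\<close>, with a constant independent of \<open>\<nu>\<close>; hence all transplanted kernels are dominated by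
  one kernel of Riesz type that depends on \<open>\<sigma>, \<alpha>, \<beta>\<close> only.

  The dominating operator is bounded from \<open>L\<^sup>p\<close> to \<open>L\<^sup>q\<close> by a weighted Schur test.  Its constants
  are uniform in \<open>p\<close> and \<open>q\<close> because \<open>\<beta> > -1/2\<close> keeps \<open>q\<close> and the exponent conjugate to \<open>p\<close> bounded, and the
  critical relation between \<open>p\<close> and \<open>q\<close> is admissible because the singularity at \<open>\<theta> = \<phi>\<close> is weaker
  than the homogeneous singularity at the end point of larger dimension.
  Minkowski's inequality gives the \<open>\<ell>\<^sup>2\<close>-valued extension.
\<close>

section \<open>Jacobi polynomials and the product formula of Bailey\<close>

text \<open>The obstacle is uniformity in j. The parameters \<alpha> + a j and \<beta> + b j are
  unbounded, so estimates of Jacobi functions whose constants depend on the parameters are useless.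
  In the Laplace representation the parameters occur in two places: in the Bessel orders, where the
  bounds do not see them, and in powers of p = sin (\<theta>/2) sin (\<phi>/2) and q = cos
  (\<theta>/2) cos (\<phi>/2). Up to fixed powers of p and q, the latter form exactly the product of
  u_j at \<theta> and at \<phi> which the transplantation supplies. The signs in Bailey's formula
  permit summation over the degree by absolute convergence only when exp (-t) is small; the other
  times are reached by analytic continuation in exp (-t). Uniformity in p and q rests on using one
  power weight for all exponents: its powers q and p/(p - 1) remain in a range where the Schur
  integrals have a common bound C, and the Schur test then costs no more than C itself.\<close>

text \<open>Pascal's rule in the shape that the Leibniz rule needs; \<open>A\<close> and
  \<open>B\<close> stand for the successive derivatives of two factors at one point.\<close>

lemma sum_product_rule_shift:
  fixes A B :: "nat \<Rightarrow> real"
  shows "(\<Sum>k\<le>n. of_nat (n choose k) * (A (Suc k) * B (n - k) + A k * B (Suc (n - k)))) =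
         (\<Sum>k\<le>Suc n. of_nat (Suc n choose k) * (A k * B (Suc n - k)))"
proof -
  have "(\<Sum>k\<le>Suc n. of_nat (Suc n choose k) * (A k * B (Suc n - k))) =
        A 0 * B (Suc n) + (\<Sum>k\<le>n. of_nat (Suc n choose Suc k) * (A (Suc k) * B (n - k)))"
    by (subst sum.atMost_Suc_shift) simp
  also have "(\<Sum>k\<le>n. of_nat (Suc n choose Suc k) * (A (Suc k) * B (n - k))) =
     (\<Sum>k\<le>n. of_nat (n choose k) * (A (Suc k) * B (n - k))) +
     (\<Sum>k\<le>n. of_nat (n choose Suc k) * (A (Suc k) * B (n - k)))"
    by (simp add: sum.distrib algebra_simps)
  also have "A 0 * B (Suc n) + (\<dots>) = (\<Sum>k\<le>n. of_nat (n choose k) * (A (Suc k) * B (n - k))) +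
     (A 0 * B (Suc n) + (\<Sum>k\<le>n. of_nat (n choose Suc k) * (A (Suc k) * B (n - k))))"
    by simp
  also have "A 0 * B (Suc n) + (\<Sum>k\<le>n. of_nat (n choose Suc k) * (A (Suc k) * B (n - k))) =
     (\<Sum>k\<le>Suc n. of_nat (n choose k) * (A k * B (Suc n - k)))"
    by (subst sum.atMost_Suc_shift) simp
  also have "\<dots> = (\<Sum>k\<le>n. of_nat (n choose k) * (A k * B (Suc (n - k))))"
    by (simp add: Suc_diff_le binomial_eq_0)
  finally show ?thesis by (simp add: sum.distrib algebra_simps)
qed

text \<open>The derivatives of the factors are supplied as sequences, so no iterated
  \<open>deriv\<close> of a single factor has to be evaluated. The induction differentiates an
  identity known on \<open>S\<close> only, which is why \<open>S\<close> is open.\<close>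

lemma higher_deriv_mult_real:
  fixes A B :: "nat \<Rightarrow> real \<Rightarrow> real"
  assumes "open S"
    and A: "\<And>k x. x \<in> S \<Longrightarrow> (A k has_real_derivative A (Suc k) x) (at x)"
    and B: "\<And>k x. x \<in> S \<Longrightarrow> (B k has_real_derivative B (Suc k) x) (at x)"
    and "x \<in> S"
  shows "(deriv ^^ n) (\<lambda>y. A 0 y * B 0 y) x =
         (\<Sum>k\<le>n. of_nat (n choose k) * (A k x * B (n - k) x))"
  using \<open>x \<in> S\<close>
proof (induction n arbitrary: x)
  case (Suc n)
  let ?T = "\<lambda>n y. \<Sum>k\<le>n. of_nat (n choose k) * (A k y * B (n - k) y)"
  have "(?T n has_real_derivative
      (\<Sum>k\<le>n. of_nat (n choose k) * (A (Suc k) x * B (n - k) x + A k x * B (Suc (n - k)) x))) (at x)"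
    using Suc.prems by (auto intro!: derivative_eq_intros A B simp: algebra_simps sum.distrib)
  then have "(?T n has_real_derivative ?T (Suc n) x) (at x)"
    using sum_product_rule_shift[of n "\<lambda>k. A k x" "\<lambda>k. B k x"] by simp
  then have "((deriv ^^ n) (\<lambda>y. A 0 y * B 0 y) has_real_derivative ?T (Suc n) x) (at x)"
    by (rule has_field_derivative_transform_within_open[OF _ \<open>open S\<close> Suc.prems])
       (simp add: Suc.IH)
  then show ?case by (simp add: DERIV_imp_deriv)
qed simp

text \<open>Rodrigues' formula after the Leibniz rule, in the variable (1 - y)/2, which for y = cos
  \<theta> is the square of sin (\<theta>/2).\<close>

definition jacobi_poly :: "nat \<Rightarrow> real \<Rightarrow> real \<Rightarrow> real poly" where
  "jacobi_poly n \<alpha> \<beta> = (\<Sum>k\<le>n. smult ((-1) ^ (n - k) *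
     ((real n + \<alpha>) gchoose k) * ((real n + \<beta>) gchoose (n - k))) ([:0, 1:] ^ (n - k) * [:1, -1:] ^ k))"

lemma poly_jacobi_poly:
  "poly (jacobi_poly n \<alpha> \<beta>) x = (\<Sum>k\<le>n. ((-1) ^ (n - k) *
     ((real n + \<alpha>) gchoose k) * ((real n + \<beta>) gchoose (n - k))) * (x ^ (n - k) * (1 - x) ^ k))"
  by (simp add: jacobi_poly_def poly_sum)

text \<open>Differentiation turns real powers of 1 - y and 1 + y into shifted ones, and the
  prefactors with exponents -\<alpha> and -\<beta> complete these to natural powers. The n factors
  1/2 are spread over the n linear factors.\<close>

lemma jacobi_P_eq_poly:
  assumes y: "-1 < y" "y < 1"
  shows "jacobi_P n \<alpha> \<beta> y = poly (jacobi_poly n \<alpha> \<beta>) ((1 - y) / 2)"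
proof -
  define A where "A k y = (-1) ^ k * (\<Prod>i = 0..<k. (real n + \<alpha> - real i)) * (1 - y) powr (real n + \<alpha> - real k)"
    for k y
  define B where "B k y = (\<Prod>i = 0..<k. (real n + \<beta> - real i)) * (1 + y) powr (real n + \<beta> - real k)"
    for k y
  have dA: "(A k has_real_derivative A (Suc k) x) (at x)" if "x \<in> {-1<..<1}" for k x
    unfolding A_def using that
    by (auto intro!: derivative_eq_intros simp: algebra_simps)
  have dB: "(B k has_real_derivative B (Suc k) x) (at x)" if "x \<in> {-1<..<1}" for k x
    unfolding B_def using that
    by (auto intro!: derivative_eq_intros simp: algebra_simps)
  have "(deriv ^^ n) (\<lambda>y. (1 - y) powr (real n + \<alpha>) * (1 + y) powr (real n + \<beta>)) y =
        (deriv ^^ n) (\<lambda>y. A 0 y * B 0 y) y"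
    by (simp add: A_def B_def)
  also have "\<dots> = (\<Sum>k\<le>n. of_nat (n choose k) * (A k y * B (n - k) y))"
    by (rule higher_deriv_mult_real[of "{-1<..<1}"]) (use dA dB y in auto)
  finally have D: "jacobi_P n \<alpha> \<beta> y = (\<Sum>k\<le>n. (1 - y) powr (-\<alpha>) * (1 + y) powr (-\<beta>) *
      ((-1)^n / (2^n * fact n)) * (of_nat (n choose k) * (A k y * B (n - k) y)))"
    by (simp add: jacobi_P_def sum_distrib_left)
  show ?thesis unfolding D poly_jacobi_poly
  proof (rule sum.cong[OF refl])
    fix k assume "k \<in> {..n}"
    then have k: "k \<le> n" by simp
    have 1: "(1 - y) powr (-\<alpha>) * (1 - y) powr (real n + \<alpha> - real k) = (1 - y) ^ (n - k)"
      using y k by (simp add: powr_add[symmetric] powr_realpow[symmetric] of_nat_diff)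
    have 2: "(1 + y) powr (-\<beta>) * (1 + y) powr (real n + \<beta> - real (n - k)) = (1 + y) ^ k"
      using y k by (simp add: powr_add[symmetric] powr_realpow[symmetric] of_nat_diff)
    have 3: "(\<Prod>i = 0..<k. (real n + \<alpha> - real i)) = fact k * ((real n + \<alpha>) gchoose k)"
      by (simp add: gbinomial_prod_rev)
    have 4: "(\<Prod>i = 0..<n-k. (real n + \<beta> - real i)) = fact (n-k) * ((real n + \<beta>) gchoose (n-k))"
      by (simp add: gbinomial_prod_rev)
    have 5: "of_nat (n choose k) * fact k * fact (n - k) = (fact n :: real)"
      using binomial_fact[OF k, where 'a=real] by (simp add: field_simps)
    have 6: "(-1::real) ^ n * (-1) ^ k = (-1) ^ (n - k)"
    proof -
      obtain m where "n = k + m" using k le_Suc_ex by blast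
      then show ?thesis by (simp add: power_add mult.assoc[symmetric] mult.commute[of _ "(-1) ^ m"])
    qed
    have 7: "((1 - y) / 2) ^ (n - k) * (1 - (1 - y) / 2) ^ k = (1 - y) ^ (n - k) * (1 + y) ^ k / 2 ^ n"
    proof -
      have "1 - (1 - y) / 2 = (1 + y) / 2" by (simp add: field_simps)
      moreover have "(2::real) ^ (n - k) * 2 ^ k = 2 ^ n" using k by (simp add: power_add[symmetric])
      ultimately show ?thesis by (simp only: power_divide times_divide_times_eq)
    qed
    have "(1 - y) powr (-\<alpha>) * (1 + y) powr (-\<beta>) *
      ((-1)^n / (2^n * fact n)) * (of_nat (n choose k) * (A k y * B (n - k) y)) =
      ((-1) ^ n * (-1) ^ k) * (of_nat (n choose k) * fact k * fact (n - k)) / fact n *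
      ((real n + \<alpha>) gchoose k) * ((real n + \<beta>) gchoose (n-k)) *
      ((1 - y) powr (-\<alpha>) * (1 - y) powr (real n + \<alpha> - real k)) *
      ((1 + y) powr (-\<beta>) * (1 + y) powr (real n + \<beta> - real (n - k))) / 2 ^ n"
      unfolding A_def B_def 3 4 by (simp add: field_simps)
    also have "\<dots> = ((-1) ^ (n - k) *
     ((real n + \<alpha>) gchoose k) * ((real n + \<beta>) gchoose (n - k))) *
       (((1 - y) / 2) ^ (n - k) * (1 - (1 - y) / 2) ^ k)"
      unfolding 1 2 5 6 7 by simp
    finally show "(1 - y) powr (-\<alpha>) * (1 + y) powr (-\<beta>) *
      ((-1)^n / (2^n * fact n)) * (of_nat (n choose k) * (A k y * B (n - k) y)) = \<dots>" .
  qed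
qed

lemma poly_jacobi_poly_0: "poly (jacobi_poly n \<alpha> \<beta>) 0 = (real n + \<alpha>) gchoose n"
proof -
  have "poly (jacobi_poly n \<alpha> \<beta>) 0 = (\<Sum>k\<le>n. if k = n then (real n + \<alpha>) gchoose n else 0)"
    unfolding poly_jacobi_poly by (intro sum.cong refl) auto
  then show ?thesis by simp
qed

lemma poly_jacobi_poly_1: "poly (jacobi_poly n \<alpha> \<beta>) 1 = (-1) ^ n * ((real n + \<beta>) gchoose n)"
proof -
  have "poly (jacobi_poly n \<alpha> \<beta>) 1 =
      (\<Sum>k\<le>n. if k = 0 then (-1) ^ n * ((real n + \<beta>) gchoose n) else 0)"
    unfolding poly_jacobi_poly by (intro sum.cong refl) auto
  then show ?thesis by simp
qed

section \<open>The Jacobi operator on polynomials\<close>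

text \<open>In the variable x = (1 - cos \<theta>)/2 this is the operator whose fractional powers
  are studied, up to sign and an additive constant.\<close>

definition jacobi_op :: "real \<Rightarrow> real \<Rightarrow> real poly \<Rightarrow> real poly" where
  "jacobi_op \<alpha> \<beta> p = [:0, 1:] * [:1, -1:] * pderiv (pderiv p) + [:\<alpha> + 1, -(\<alpha> + \<beta> + 2):] * pderiv p"

lemma jacobi_op_add: "jacobi_op \<alpha> \<beta> (p + q) = jacobi_op \<alpha> \<beta> p + jacobi_op \<alpha> \<beta> q"
  unfolding jacobi_op_def pderiv_add distrib_left by (simp only: add_ac)

lemma jacobi_op_smult: "jacobi_op \<alpha> \<beta> (smult c p) = smult c (jacobi_op \<alpha> \<beta> p)"
  unfolding jacobi_op_def pderiv_smult by (simp only: mult_smult_right smult_add_right)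

lemma jacobi_op_0 [simp]: "jacobi_op \<alpha> \<beta> 0 = 0"
  by (simp add: jacobi_op_def)

lemma jacobi_op_sum: "jacobi_op \<alpha> \<beta> (\<Sum>i\<in>I. f i) = (\<Sum>i\<in>I. jacobi_op \<alpha> \<beta> (f i))"
  by (induction I rule: infinite_finite_induct) (simp_all add: jacobi_op_add)

text \<open>In the basis x^i (1 - x)^k the operator has a diagonal part, depending on i + k only,
  and two parts that lower one exponent. This reduces eigenvalue problems to two-term recursions. At
  i = 0 or k = 0 the truncated exponents carry the factor 0.\<close>

lemma poly_jacobi_op_monom:
  "poly (jacobi_op \<alpha> \<beta> ([:0, 1:] ^ i * [:1, -1:] ^ k)) x =
     real i * (real i + \<alpha>) * (x ^ (i - 1) * (1 - x) ^ k) +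
     real k * (real k + \<beta>) * (x ^ i * (1 - x) ^ (k - 1)) -
     real (i + k) * (real (i + k) + (\<alpha> + \<beta> + 1)) * (x ^ i * (1 - x) ^ k)"
proof -
  have dX: "pderiv ([:0, 1:] ^ i) = smult (real i) ([:0, 1:] ^ (i - 1))" for i
    by (cases i) (simp_all add: pderiv_power_Suc pderiv_pCons del: power_Suc)
  have dV: "pderiv ([:1, -1:] ^ i) = smult (- real i) ([:1, -1:] ^ (i - 1))" for i
    by (cases i) (simp_all add: pderiv_power_Suc pderiv_pCons del: power_Suc)
  have x1: "real i * x ^ i = real i * (x * x ^ (i - 1))" by (cases i) auto
  have x2: "real i * (real (i - 1) * x ^ (i - 1)) = real i * (real i - 1) * (x * x ^ (i - 2))"
    by (cases i; cases "i - 1") (auto simp: algebra_simps)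
  have v1: "real k * (1 - x) ^ k = real k * ((1 - x) * (1 - x) ^ (k - 1))" by (cases k) auto
  have v2: "real k * (real (k - 1) * (1 - x) ^ (k - 1)) = real k * (real k - 1) * ((1 - x) * (1 - x) ^ (k - 2))"
    by (cases k; cases "k - 1") (auto simp: algebra_simps)
  have i1: "real i * real (i - 1) = real i * (real i - 1)" by (cases i) auto
  have k1: "real k * real (k - 1) = real k * (real k - 1)" by (cases k) auto
  define P P1 P2 where "P = x ^ i" "P1 = x ^ (i - 1)" "P2 = x ^ (i - 2)"
  define Q Q1 Q2 where "Q = (1 - x) ^ k" "Q1 = (1 - x) ^ (k - 1)" "Q2 = (1 - x) ^ (k - 2)"
  have e1: "i - Suc 0 - Suc 0 = i - 2" "k - Suc 0 - Suc 0 = k - 2" by auto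
  have "poly (jacobi_op \<alpha> \<beta> ([:0, 1:] ^ i * [:1, -1:] ^ k)) x =
    x * (1 - x) * (real i * real (i - 1) * P2 * Q - 2 * real i * real k * P1 * Q1 + real k * real (k - 1) * P * Q2)
    + (\<alpha> + 1 - (\<alpha> + \<beta> + 2) * x) * (real i * P1 * Q - real k * P * Q1)"
    unfolding jacobi_op_def pderiv_mult dX dV pderiv_add pderiv_smult
    by (simp add: P_P1_P2_def Q_Q1_Q2_def e1 numeral_2_eq_2 algebra_simps)
  also have "\<dots> = real i * (real i + \<alpha>) * (P1 * Q) +
     real k * (real k + \<beta>) * (P * Q1) -
     real (i + k) * (real (i + k) + (\<alpha> + \<beta> + 1)) * (P * Q)"
  proof -
    \<comment> \<open>The powers have been abstracted to letters; these identities are what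
      \<open>algebra\<close> has to know about them. Each is multiplied by the factor that vanishes
      where the natural subtraction truncates.\<close>
    have h: "real i * P = real i * (x * P1)" "real i * (real i - 1) * P1 = real i * (real i - 1) * (x * P2)"
      "real k * Q = real k * ((1 - x) * Q1)" "real k * (real k - 1) * Q1 = real k * (real k - 1) * ((1 - x) * Q2)"
      using x1 x2 v1 v2 i1 k1 unfolding P_P1_P2_def Q_Q1_Q2_def by (auto simp: mult.assoc)
    show ?thesis unfolding i1 k1 of_nat_add using h by algebra
  qed
  finally show ?thesis by (simp add: P_P1_P2_def Q_Q1_Q2_def)
qed

text \<open>All basis elements have total degree n, so the diagonal part is already the eigenvalue;
  the two lowering parts cancel by the recursion \<open>rec\<close> for the coefficients.\<close>

lemma poly_jacobi_op_jacobi_poly: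
  "poly (jacobi_op \<alpha> \<beta> (jacobi_poly n \<alpha> \<beta>)) x =
     - (real n * (real n + (\<alpha> + \<beta> + 1))) * poly (jacobi_poly n \<alpha> \<beta>) x"
proof -
  define b where "b k = (-1) ^ (n - k) * ((real n + \<alpha>) gchoose k) * ((real n + \<beta>) gchoose (n - k))" for k
  have rec: "b (Suc k) * (real (Suc k) * (real (Suc k) + \<beta>)) +
      b k * (real (n - k) * (real (n - k) + \<alpha>)) = 0" if k: "k < n" for k
  proof -
    obtain m where m: "n - k = Suc m" using k by (cases "n - k") auto
    then have nm: "n - Suc k = m" "real n = real k + real m + 1" using k by (auto simp: of_nat_diff)
    have g1: "real (Suc k) * ((real n + \<alpha>) gchoose Suc k) = (real n + \<alpha> - real k) * ((real n + \<alpha>) gchoose k)"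
      using gbinomial_mult_1[of "real n + \<alpha>" k] by (simp add: algebra_simps)
    have g2: "real (Suc m) * ((real n + \<beta>) gchoose Suc m) = (real n + \<beta> - real m) * ((real n + \<beta>) gchoose m)"
      using gbinomial_mult_1[of "real n + \<beta>" m] by (simp add: algebra_simps)
    have "b (Suc k) * (real (Suc k) * (real (Suc k) + \<beta>)) =
      (-1) ^ m * (real (Suc k) * ((real n + \<alpha>) gchoose Suc k)) *
        ((real n + \<beta> - real m) * ((real n + \<beta>) gchoose m))"
      unfolding b_def nm(1) by (simp add: nm(2) algebra_simps)
    also have "\<dots> = - (b k * (real (n - k) * (real (n - k) + \<alpha>)))"
      unfolding g1 g2[symmetric] b_def m by (simp add: nm(2) algebra_simps)
    finally show ?thesis by simp
  qed
  define T where "T k = x ^ (n - k) * (1 - x) ^ k" for k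
  have "poly (jacobi_op \<alpha> \<beta> (jacobi_poly n \<alpha> \<beta>)) x =
    (\<Sum>k\<le>n. b k * (real (n - k) * (real (n - k) + \<alpha>) * (x ^ (n - k - 1) * (1 - x) ^ k) +
       real k * (real k + \<beta>) * (x ^ (n - k) * (1 - x) ^ (k - 1)) -
       real n * (real n + (\<alpha> + \<beta> + 1)) * T k))"
    unfolding jacobi_poly_def jacobi_op_sum poly_sum jacobi_op_smult poly_smult poly_jacobi_op_monom
    by (intro sum.cong refl) (simp add: b_def T_def)
  also have "\<dots> = (\<Sum>k\<le>n. b k * (real (n - k) * (real (n - k) + \<alpha>)) * (x ^ (n - k - 1) * (1 - x) ^ k)) +
     (\<Sum>k\<le>n. b k * (real k * (real k + \<beta>)) * (x ^ (n - k) * (1 - x) ^ (k - 1)))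
     - real n * (real n + (\<alpha> + \<beta> + 1)) * (\<Sum>k\<le>n. b k * T k)"
    by (simp add: sum_distrib_left sum.distrib sum_subtractf algebra_simps)
  also have "(\<Sum>k\<le>n. b k * (real (n - k) * (real (n - k) + \<alpha>)) * (x ^ (n - k - 1) * (1 - x) ^ k)) =
     (\<Sum>k<n. b k * (real (n - k) * (real (n - k) + \<alpha>)) * (x ^ (n - k - 1) * (1 - x) ^ k))"
    by (simp add: lessThan_Suc_atMost[symmetric])
  also have "(\<Sum>k\<le>n. b k * (real k * (real k + \<beta>)) * (x ^ (n - k) * (1 - x) ^ (k - 1))) =
     (\<Sum>k<n. b (Suc k) * (real (Suc k) * (real (Suc k) + \<beta>)) * (x ^ (n - k - 1) * (1 - x) ^ k))"
    by (simp add: lessThan_Suc_atMost[symmetric] sum.lessThan_Suc_shift del: sum.lessThan_Suc of_nat_Suc)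
  also have "(\<Sum>k<n. b k * (real (n - k) * (real (n - k) + \<alpha>)) * (x ^ (n - k - 1) * (1 - x) ^ k)) +
     (\<Sum>k<n. b (Suc k) * (real (Suc k) * (real (Suc k) + \<beta>)) * (x ^ (n - k - 1) * (1 - x) ^ k)) =
     (\<Sum>k<n. (b (Suc k) * (real (Suc k) * (real (Suc k) + \<beta>)) + b k * (real (n - k) * (real (n - k) + \<alpha>))) *
         (x ^ (n - k - 1) * (1 - x) ^ k))"
    by (simp add: sum.distrib[symmetric] algebra_simps)
  also have "\<dots> = 0" by (intro sum.neutral ballI) (simp only: lessThan_iff rec mult_zero_left)
  finally show ?thesis unfolding poly_jacobi_poly by (simp add: b_def T_def)
qed

lemma coeff_jacobi_op:
  "coeff (jacobi_op \<alpha> \<beta> p) m = real (Suc m) * (real m + \<alpha> + 1) * coeff p (Suc m) -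
     real m * (real m + (\<alpha> + \<beta> + 1)) * coeff p m"
  by (cases m; cases "m - 1") (simp_all add: jacobi_op_def coeff_pderiv coeff_pCons algebra_simps)

text \<open>The eigenvalue equation determines \<open>coeff p (Suc m)\<close> from
  \<open>coeff p m\<close>, because the factor (m + 1) (m + \<alpha> + 1) is positive for \<alpha> >
  -1. So the value at 0 fixes a polynomial eigenfunction.\<close>

lemma jacobi_op_eigen_unique:
  assumes al: "\<alpha> > -1"
    and eig: "\<And>x. poly (jacobi_op \<alpha> \<beta> p) x = c * poly p x"
    and z: "poly p 0 = 0"
  shows "p = 0"
proof -
  have eq: "jacobi_op \<alpha> \<beta> p = smult c p"
    using eig by (intro poly_eq_poly_eq_iff[THEN iffD1] ext) simp
  have "coeff p m = 0" for m
  proof (induction m)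
    case 0
    then show ?case using z by (simp add: poly_0_coeff_0)
  next
    case (Suc m)
    have "coeff (jacobi_op \<alpha> \<beta> p) m = 0" using Suc by (simp add: eq)
    then have "real (Suc m) * (real m + \<alpha> + 1) * coeff p (Suc m) = 0"
      using Suc by (simp add: coeff_jacobi_op del: of_nat_Suc)
    then show ?case using al by (auto simp del: of_nat_Suc)
  qed
  then show ?thesis by (intro poly_eqI) simp
qed

text \<open>Uniqueness applied to the combination of p and q that vanishes at 0; the
  cross-multiplied form avoids cases on the values there.\<close>

lemma jacobi_op_eigen_proportional:
  assumes al: "\<alpha> > -1"
    and p: "\<And>x. poly (jacobi_op \<alpha> \<beta> p) x = c * poly p x"
    and q: "\<And>x. poly (jacobi_op \<alpha> \<beta> q) x = c * poly q x"
  shows "poly q 0 * poly p x = poly p 0 * poly q x"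
proof -
  let ?r = "smult (poly q 0) p + smult (- poly p 0) q"
  have "?r = 0"
    by (rule jacobi_op_eigen_unique[OF al, of \<beta> _ c])
       (simp_all add: jacobi_op_add jacobi_op_smult p q algebra_simps del: smult_minus_left)
  then have "poly ?r x = 0" by (simp only: poly_0)
  then show ?thesis by (simp add: algebra_simps)
qed

section \<open>Bailey's polynomials and the product formula\<close>

text \<open>The coefficient of (z/2)^(2i + \<alpha>) in the modified Bessel function of order
  \<alpha>. This is the link from the product formula to Bessel functions.\<close>

definition bailey_coeff :: "real \<Rightarrow> nat \<Rightarrow> real" where
  "bailey_coeff \<alpha> i = 1 / (Gamma (\<alpha> + 1 + real i) * fact i)"

lemma Gamma_plus1_pos: "x > 0 \<Longrightarrow> Gamma (x + 1) = x * Gamma (x :: real)"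
  by (rule Gamma_plus1) (auto dest: nonpos_Ints_nonpos)

lemma bailey_coeff_Suc:
  assumes "\<alpha> > -1"
  shows "bailey_coeff \<alpha> (Suc i) * (real (Suc i) * (real (Suc i) + \<alpha>)) = bailey_coeff \<alpha> i"
proof -
  have pos: "\<alpha> + 1 + real i > 0" using assms by linarith
  then have "Gamma (\<alpha> + 1 + real (Suc i)) = (\<alpha> + 1 + real i) * Gamma (\<alpha> + 1 + real i)"
    using Gamma_plus1_pos[of "\<alpha> + 1 + real i"] by (simp add: add_ac)
  moreover have "Gamma (\<alpha> + 1 + real i) > 0" using pos by simp
  ultimately show ?thesis using pos
    by (simp add: bailey_coeff_def divide_simps del: of_nat_Suc)
qed

lemma bailey_coeff_pos: "\<alpha> > -1 \<Longrightarrow> bailey_coeff \<alpha> i > 0"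
  by (simp add: bailey_coeff_def)

text \<open>The part of total degree N in the product of two Bessel-type series, one in x y and one
  in (1 - x) (1 - y).\<close>

definition bailey :: "real \<Rightarrow> real \<Rightarrow> nat \<Rightarrow> real \<Rightarrow> real \<Rightarrow> real" where
  "bailey \<alpha> \<beta> N x y = (\<Sum>i\<le>N. bailey_coeff \<alpha> i * bailey_coeff \<beta> (N - i) *
      ((x * y) ^ i * ((1 - x) * (1 - y)) ^ (N - i)))"

definition bailey_poly :: "real \<Rightarrow> real \<Rightarrow> nat \<Rightarrow> real \<Rightarrow> real poly" where
  "bailey_poly \<alpha> \<beta> N y = (\<Sum>i\<le>N. smult (bailey_coeff \<alpha> i * bailey_coeff \<beta> (N - i) *
      (y ^ i * (1 - y) ^ (N - i))) ([:0, 1:] ^ i * [:1, -1:] ^ (N - i)))"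

lemma poly_bailey_poly: "poly (bailey_poly \<alpha> \<beta> N y) x = bailey \<alpha> \<beta> N x y"
  by (simp add: bailey_poly_def bailey_def poly_sum power_mult_distrib ac_simps)

lemma bailey_commute: "bailey \<alpha> \<beta> N x y = bailey \<alpha> \<beta> N y x"
  by (simp add: bailey_def mult.commute)

lemma poly_jacobi_op_bailey_0: "poly (jacobi_op \<alpha> \<beta> (bailey_poly \<alpha> \<beta> 0 y)) x = 0"
  by (simp add: bailey_poly_def jacobi_op_def)

text \<open>By \<open>bailey_coeff_Suc\<close>, lowering the exponent of x yields y times the
  polynomial of index N, and lowering that of 1 - x yields 1 - y times it. The two add up to that
  polynomial itself.\<close>

lemma poly_jacobi_op_bailey_Suc:
  assumes "\<alpha> > -1" "\<beta> > -1"
  shows "poly (jacobi_op \<alpha> \<beta> (bailey_poly \<alpha> \<beta> (Suc N) y)) x =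
    bailey \<alpha> \<beta> N x y - real (Suc N) * (real (Suc N) + (\<alpha> + \<beta> + 1)) * bailey \<alpha> \<beta> (Suc N) x y"
proof -
  let ?M = "Suc N"
  define g h where "g = bailey_coeff \<alpha>" "h = bailey_coeff \<beta>"
  define w where "w i = g i * h (?M - i) * (y ^ i * (1 - y) ^ (?M - i))" for i
  define T where "T i = x ^ i * (1 - x) ^ (?M - i)" for i
  have "poly (jacobi_op \<alpha> \<beta> (bailey_poly \<alpha> \<beta> ?M y)) x =
    (\<Sum>i\<le>?M. w i * (real i * (real i + \<alpha>) * (x ^ (i - 1) * (1 - x) ^ (?M - i)) +
       real (?M - i) * (real (?M - i) + \<beta>) * (x ^ i * (1 - x) ^ (?M - i - 1)) -
       real ?M * (real ?M + (\<alpha> + \<beta> + 1)) * T i))"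
    unfolding bailey_poly_def jacobi_op_sum poly_sum jacobi_op_smult poly_smult poly_jacobi_op_monom
    by (intro sum.cong refl) (simp add: w_def T_def g_h_def del: of_nat_Suc)
  also have "\<dots> = (\<Sum>i\<le>?M. w i * (real i * (real i + \<alpha>)) * (x ^ (i - 1) * (1 - x) ^ (?M - i))) +
     (\<Sum>i\<le>?M. w i * (real (?M - i) * (real (?M - i) + \<beta>)) * (x ^ i * (1 - x) ^ (?M - i - 1)))
     - real ?M * (real ?M + (\<alpha> + \<beta> + 1)) * (\<Sum>i\<le>?M. w i * T i)"
    by (simp add: sum_distrib_left sum.distrib sum_subtractf algebra_simps del: of_nat_Suc sum.atMost_Suc)
  also have "(\<Sum>i\<le>?M. w i * (real i * (real i + \<alpha>)) * (x ^ (i - 1) * (1 - x) ^ (?M - i))) =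
     (\<Sum>i\<le>N. y * (g i * h (N - i) * ((x * y) ^ i * ((1 - x) * (1 - y)) ^ (N - i))))"
    unfolding sum.atMost_Suc_shift
  proof (simp del: of_nat_Suc, intro sum.cong refl)
    fix i
    have "w (Suc i) * (real (Suc i) * (real (Suc i) + \<alpha>)) =
      (g (Suc i) * (real (Suc i) * (real (Suc i) + \<alpha>))) * h (N - i) * (y ^ Suc i * (1 - y) ^ (N - i))"
      by (simp add: w_def)
    also have "g (Suc i) * (real (Suc i) * (real (Suc i) + \<alpha>)) = g i"
      unfolding g_h_def by (rule bailey_coeff_Suc[OF assms(1)])
    finally show "w (Suc i) * (real (Suc i) * (real (Suc i) + \<alpha>)) * (x ^ i * (1 - x) ^ (N - i)) =
       y * (g i * h (N - i) * ((x * y) ^ i * ((1 - x) * (1 - y)) ^ (N - i)))"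
      by (simp add: power_mult_distrib ac_simps)
  qed
  also have "(\<Sum>i\<le>?M. w i * (real (?M - i) * (real (?M - i) + \<beta>)) * (x ^ i * (1 - x) ^ (?M - i - 1))) =
     (\<Sum>i\<le>N. (1 - y) * (g i * h (N - i) * ((x * y) ^ i * ((1 - x) * (1 - y)) ^ (N - i))))"
  proof -
    have "w i * (real (?M - i) * (real (?M - i) + \<beta>)) * (x ^ i * (1 - x) ^ (?M - i - 1)) =
       (1 - y) * (g i * h (N - i) * ((x * y) ^ i * ((1 - x) * (1 - y)) ^ (N - i)))" if "i \<le> N" for i
    proof -
      have s: "Suc N - i = Suc (N - i)" using that by simp
      have "w i * (real (?M - i) * (real (?M - i) + \<beta>)) =
        g i * (h (Suc (N - i)) * (real (Suc (N - i)) * (real (Suc (N - i)) + \<beta>))) * (y ^ i * (1 - y) ^ Suc (N - i))"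
        by (simp add: w_def s del: of_nat_Suc)
      also have "h (Suc (N - i)) * (real (Suc (N - i)) * (real (Suc (N - i)) + \<beta>)) = h (N - i)"
        unfolding g_h_def by (rule bailey_coeff_Suc[OF assms(2)])
      finally show ?thesis
        by (simp add: power_mult_distrib s ac_simps)
    qed
    then show ?thesis by (simp del: of_nat_Suc)
  qed
  also have "(\<Sum>i\<le>N. y * (g i * h (N - i) * ((x * y) ^ i * ((1 - x) * (1 - y)) ^ (N - i)))) +
     (\<Sum>i\<le>N. (1 - y) * (g i * h (N - i) * ((x * y) ^ i * ((1 - x) * (1 - y)) ^ (N - i)))) = bailey \<alpha> \<beta> N x y"
    unfolding sum_distrib_left[symmetric] bailey_def g_h_def by (simp only: distrib_right[symmetric]) simp
  also have "(\<Sum>i\<le>?M. w i * T i) = bailey \<alpha> \<beta> ?M x y"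
    unfolding bailey_def w_def T_def g_h_def
    by (intro sum.cong refl) (simp add: power_mult_distrib ac_simps)
  finally show ?thesis .
qed

text \<open>For fixed n a solution of the recursion in N stated in \<open>bailey_weight_Suc\<close>;
  l stands for \<alpha> + \<beta> + 1.\<close>

definition bailey_weight :: "real \<Rightarrow> nat \<Rightarrow> nat \<Rightarrow> real" where
  "bailey_weight l n N = (-1) ^ (n - N) * Gamma (l + real n + real N) / fact (n - N)"

text \<open>(n - N) (n + N + l) = n (n + l) - N (N + l) is the gap between the eigenvalues of
  degrees n and N. With this recursion the weighted sum of the \<open>bailey\<close> polynomials
  becomes an eigenfunction for the eigenvalue of degree n.\<close>

lemma bailey_weight_Suc:
  assumes "l > 0" "N < n"
  shows "bailey_weight l n (Suc N) + bailey_weight l n N * (real (n - N) * (real n + real N + l)) = 0"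
proof -
  obtain m where m: "n - N = Suc m" using assms by (cases "n - N") auto
  then have nm: "n - Suc N = m" by auto
  have "l + real n + real N > 0" using assms by linarith
  then have "Gamma (l + real n + real (Suc N)) = (l + real n + real N) * Gamma (l + real n + real N)"
    using Gamma_plus1_pos[of "l + real n + real N"] by (simp add: add_ac)
  then show ?thesis unfolding bailey_weight_def nm m
    by (simp add: divide_simps del: of_nat_Suc)
qed

lemma gchoose_shift_Gamma:
  fixes a :: real
  assumes "a > -1"
  shows "((real n + a) gchoose n) = Gamma (real n + a + 1) / (fact n * Gamma (a + 1))"
proof -
  have "real n + a + 1 \<notin> \<int>\<^sub>\<le>\<^sub>0" using assms by (auto dest: nonpos_Ints_nonpos)
  then show ?thesis by (simp add: gbinomial_Gamma add.commute)
qed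

text \<open>Both sides are symmetric and, in each variable, polynomial eigenfunctions of \<^const>\<open>jacobi_op\<close> for the same
  eigenvalue, so they are proportional; the factor is read off at \<open>x = 0\<close>, \<open>y = 1\<close>, where only the term
  \<open>N = 0\<close> survives.\<close>

lemma bailey_product_formula:
  assumes al: "\<alpha> > -1" and be: "\<beta> > -1" and l: "\<alpha> + \<beta> + 1 > 0"
  shows "(\<Sum>N\<le>n. bailey_weight (\<alpha> + \<beta> + 1) n N * bailey \<alpha> \<beta> N x y) =
    fact n * Gamma (real n + \<alpha> + \<beta> + 1) / (Gamma (real n + \<alpha> + 1) * Gamma (real n + \<beta> + 1)) *
    (poly (jacobi_poly n \<alpha> \<beta>) x * poly (jacobi_poly n \<alpha> \<beta>) y)"
proof -
  define l where "l = \<alpha> + \<beta> + 1"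
  define B where "B y = (\<Sum>N\<le>n. smult (bailey_weight l n N) (bailey_poly \<alpha> \<beta> N y))" for y
  define p where "p = jacobi_poly n \<alpha> \<beta>"
  have lpos: "l > 0" using l by (simp add: l_def)
  have eigB: "poly (jacobi_op \<alpha> \<beta> (B y)) x = - (real n * (real n + l)) * poly (B y) x" for x y
  proof -
    let ?w = "bailey_weight l n" and ?R = "\<lambda>N. bailey \<alpha> \<beta> N x y"
    have "poly (jacobi_op \<alpha> \<beta> (B y)) x = (\<Sum>N\<le>n. ?w N * poly (jacobi_op \<alpha> \<beta> (bailey_poly \<alpha> \<beta> N y)) x)"
      by (simp add: B_def jacobi_op_sum jacobi_op_smult poly_sum)
    also have "\<dots> = (\<Sum>N\<le>n. ?w N * ((if N = 0 then 0 else ?R (N - 1)) - real N * (real N + l) * ?R N))"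
    proof (intro sum.cong refl)
      fix N show "?w N * poly (jacobi_op \<alpha> \<beta> (bailey_poly \<alpha> \<beta> N y)) x =
         ?w N * ((if N = 0 then 0 else ?R (N - 1)) - real N * (real N + l) * ?R N)"
        by (cases N) (simp_all add: poly_jacobi_op_bailey_0 poly_jacobi_op_bailey_Suc[OF al be] l_def del: of_nat_Suc)
    qed
    also have "\<dots> = (\<Sum>N\<le>n. ?w N * (if N = 0 then 0 else ?R (N - 1))) - (\<Sum>N\<le>n. ?w N * (real N * (real N + l)) * ?R N)"
      by (simp add: sum_subtractf algebra_simps)
    also have "(\<Sum>N\<le>n. ?w N * (if N = 0 then 0 else ?R (N - 1))) = (\<Sum>N<n. ?w (Suc N) * ?R N)"
      by (simp add: lessThan_Suc_atMost[symmetric] sum.lessThan_Suc_shift del: sum.lessThan_Suc)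
    also have "\<dots> = (\<Sum>N<n. - (?w N * (real (n - N) * (real n + real N + l))) * ?R N)"
      by (intro sum.cong refl arg_cong2[where f="(*)"])
         (use bailey_weight_Suc[OF lpos] in \<open>simp add: eq_neg_iff_add_eq_0\<close>)
    also have "\<dots> = (\<Sum>N\<le>n. - (?w N * (real (n - N) * (real n + real N + l))) * ?R N)"
      by (simp add: lessThan_Suc_atMost[symmetric])
    also have "\<dots> - (\<Sum>N\<le>n. ?w N * (real N * (real N + l)) * ?R N) =
       (\<Sum>N\<le>n. - (real n * (real n + l)) * (?w N * ?R N))"
      unfolding sum_subtractf[symmetric]
      by (intro sum.cong refl) (simp add: of_nat_diff algebra_simps)
    also have "\<dots> = - (real n * (real n + l)) * poly (B y) x"
      by (simp add: B_def poly_sum poly_bailey_poly sum_distrib_left)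
    finally show ?thesis .
  qed
  have eigp: "poly (jacobi_op \<alpha> \<beta> p) x = - (real n * (real n + l)) * poly p x" for x
    by (simp add: p_def poly_jacobi_op_jacobi_poly l_def)
  have sym: "poly (B y) x = poly (B x) y" for x y
    by (simp add: B_def poly_sum poly_bailey_poly bailey_commute[of _ _ _ x y])
  have pr: "poly p 0 * poly (B y) x = poly (B y) 0 * poly p x" for x y
    by (rule jacobi_op_eigen_proportional[OF al eigB eigp])
  have p0: "poly p 0 = (real n + \<alpha>) gchoose n" and p1: "poly p 1 = (- 1) ^ n * ((real n + \<beta>) gchoose n)"
    by (simp_all add: p_def poly_jacobi_poly_0 poly_jacobi_poly_1)
  have p0pos: "poly p 0 > 0" unfolding p0 gchoose_shift_Gamma[OF al] using al by simp
  have p1nz: "poly p 1 \<noteq> 0" unfolding p1 gchoose_shift_Gamma[OF be] using be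
    by (simp add: less_imp_neq[OF Gamma_real_pos, symmetric])
  have B01: "poly (B 1) 0 = (-1) ^ n * Gamma (l + real n) / fact n * (bailey_coeff \<alpha> 0 * bailey_coeff \<beta> 0)"
  proof -
    have "bailey \<alpha> \<beta> N 0 1 = (if N = 0 then bailey_coeff \<alpha> 0 * bailey_coeff \<beta> 0 else 0)" for N
      unfolding bailey_def by (cases N) (auto intro!: sum.neutral simp: power_0_left)
    then have "poly (B 1) 0 = (\<Sum>N\<le>n. if N = 0 then (-1) ^ n * Gamma (l + real n) / fact n * (bailey_coeff \<alpha> 0 * bailey_coeff \<beta> 0) else 0)"
      unfolding B_def poly_sum poly_smult poly_bailey_poly by (intro sum.cong refl) (simp add: bailey_weight_def)
    then show ?thesis by simp
  qed
  \<comment> \<open>Proportionality in x leaves the factor \<open>poly (B y) 0\<close>. By symmetry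
    this is a polynomial in y, to which proportionality applies again; the third instance expresses
    the remaining constant by \<open>poly (B 1) 0\<close>.\<close>
  have "poly p 0 * poly (B y) x = poly (B y) 0 * poly p x" by (rule pr)
  moreover have "poly p 0 * poly (B 0) y = poly (B 0) 0 * poly p y" by (rule pr)
  moreover have "poly p 0 * poly (B 0) 1 = poly (B 0) 0 * poly p 1" by (rule pr)
  ultimately have "poly p 0 * (poly p 0 * poly p 1 * poly (B y) x) = poly p 0 * (poly (B 1) 0 * (poly p x * poly p y))"
    unfolding sym[of 0 y] sym[of 0 1] by algebra
  then have "poly p 0 * poly p 1 * poly (B y) x = poly (B 1) 0 * (poly p x * poly p y)"
    using p0pos by simp
  then have "poly (B y) x = poly (B 1) 0 / (poly p 0 * poly p 1) * (poly p x * poly p y)"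
    using p0pos p1nz by (simp add: field_simps)
  also have "poly (B 1) 0 / (poly p 0 * poly p 1) =
    fact n * Gamma (real n + \<alpha> + \<beta> + 1) / (Gamma (real n + \<alpha> + 1) * Gamma (real n + \<beta> + 1))"
  proof -
    have g: "Gamma (\<alpha> + 1) > 0" "Gamma (\<beta> + 1) > 0" "Gamma (real n + \<alpha> + 1) > 0" "Gamma (real n + \<beta> + 1) > 0"
      using al be by auto
    have e: "l + real n = real n + \<alpha> + \<beta> + 1" by (simp add: l_def)
    show ?thesis unfolding B01 p0 p1 gchoose_shift_Gamma[OF al] gchoose_shift_Gamma[OF be] bailey_coeff_def e using g
      by (simp add: field_simps)
  qed
  finally show ?thesis by (simp add: B_def poly_sum poly_bailey_poly p_def l_def)
qed

section \<open>The Poisson kernel as a positive series\<close>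

text \<open>Sonine's function \<open>F\<close> below dominates the square of the polynomial, agrees with it at the end points,
  and its derivative changes sign at most once, from negative to positive.\<close>

lemma abs_jacobi_poly_le:
  assumes l: "\<alpha> + \<beta> + 1 > 0" and x: "0 \<le> x" "x \<le> 1"
  shows "\<bar>poly (jacobi_poly n \<alpha> \<beta>) x\<bar> \<le>
    max \<bar>poly (jacobi_poly n \<alpha> \<beta>) 0\<bar> \<bar>poly (jacobi_poly n \<alpha> \<beta>) 1\<bar>"
proof (cases "n = 0")
  case True
  then show ?thesis by (simp add: jacobi_poly_def)
next
  case False
  define p where "p = jacobi_poly n \<alpha> \<beta>"
  define l where "l = \<alpha> + \<beta> + 1"
  define M where "M = real n * (real n + l)"
  have Mpos: "M > 0" using False l by (simp add: M_def l_def)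
  define F where "F x = (poly p x)\<^sup>2 + x * (1 - x) * (poly (pderiv p) x)\<^sup>2 / M" for x
  \<comment> \<open>The eigenvalue equation solved for the second-order term; inserting it cancels
    the product of p and its derivative in \<open>dF\<close>.\<close>
  have ode: "x * (1 - x) * poly (pderiv (pderiv p)) x =
      - (\<alpha> + 1 - (l + 1) * x) * poly (pderiv p) x - M * poly p x" for x
    using poly_jacobi_op_jacobi_poly[of \<alpha> \<beta> n x]
    by (simp add: jacobi_op_def p_def[symmetric] M_def l_def algebra_simps)
  have dF: "(F has_real_derivative (poly (pderiv p) x)\<^sup>2 * (2 * l * x - (2 * \<alpha> + 1)) / M) (at x)" for x
  proof -
    have "(F has_real_derivative (2 * poly p x * poly (pderiv p) x + ((1 - 2 * x) * (poly (pderiv p) x)\<^sup>2 +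
        2 * poly (pderiv p) x * (x * (1 - x) * poly (pderiv (pderiv p)) x)) / M)) (at x)"
      unfolding F_def using Mpos
      by (auto intro!: derivative_eq_intros simp: power2_eq_square field_simps)
    then show ?thesis unfolding ode using Mpos
      by (simp add: power2_eq_square field_simps)
  qed
  have F0: "F 0 = (poly p 0)\<^sup>2" and F1: "F 1 = (poly p 1)\<^sup>2" by (simp_all add: F_def)
  have "F x \<le> max (F 0) (F 1)"
  proof (cases "2 * l * x \<le> 2 * \<alpha> + 1")
    case True
    have "F x \<le> F 0"
    proof (rule DERIV_nonpos_imp_nonincreasing[of 0 x F])
      fix u assume u: "0 \<le> u" "u \<le> x"
      have "2 * l * u \<le> 2 * l * x" using u l by (simp add: l_def)
      then have "(poly (pderiv p) u)\<^sup>2 * (2 * l * u - (2 * \<alpha> + 1)) / M \<le> 0"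
        using True Mpos by (intro divide_nonpos_pos mult_nonneg_nonpos) auto
      then show "\<exists>y. (F has_real_derivative y) (at u) \<and> y \<le> 0" using dF by blast
    qed (use x in auto)
    then show ?thesis by simp
  next
    case False
    have "F x \<le> F 1"
    proof (rule DERIV_nonneg_imp_nondecreasing[of x 1 F])
      fix u assume u: "x \<le> u" "u \<le> 1"
      have "2 * l * x \<le> 2 * l * u" using u l by (simp add: l_def)
      then have "(poly (pderiv p) u)\<^sup>2 * (2 * l * u - (2 * \<alpha> + 1)) / M \<ge> 0"
        using False Mpos by (intro divide_nonneg_pos mult_nonneg_nonneg) auto
      then show "\<exists>y. (F has_real_derivative y) (at u) \<and> y \<ge> 0" using dF by blast
    qed (use x in auto)
    then show ?thesis by simp
  qed
  moreover have "(poly p x)\<^sup>2 \<le> F x" using x Mpos by (simp add: F_def)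
  ultimately have "(poly p x)\<^sup>2 \<le> (poly p 0)\<^sup>2 \<or> (poly p x)\<^sup>2 \<le> (poly p 1)\<^sup>2"
    unfolding F0 F1 by linarith
  then show ?thesis unfolding p_def[symmetric] by (auto simp: abs_le_square_iff[symmetric])
qed

section \<open>The Jacobi series: convergence and summation over the degree\<close>

text \<open>The square of the normalising factor \<open>jacobi_d\<close>; the kernel contains only
  products of two equally indexed Jacobi functions.\<close>

definition jacobi_coeff :: "nat \<Rightarrow> real \<Rightarrow> real \<Rightarrow> real" where
  "jacobi_coeff n \<alpha> \<beta> = (2 * real n + \<alpha> + \<beta> + 1) * fact n * Gamma (real n + \<alpha> + \<beta> + 1) /
      (Gamma (real n + \<alpha> + 1) * Gamma (real n + \<beta> + 1))"

lemma jacobi_coeff_nonneg: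
  assumes "\<alpha> > -1" "\<beta> > -1" "\<alpha> + \<beta> + 1 > 0"
  shows "jacobi_coeff n \<alpha> \<beta> \<ge> 0"
proof -
  have "Gamma (real n + \<alpha> + \<beta> + 1) > 0" "Gamma (real n + \<alpha> + 1) > 0" "Gamma (real n + \<beta> + 1) > 0"
    using assms by auto
  then show ?thesis using assms by (auto simp: jacobi_coeff_def intro!: divide_nonneg_pos mult_nonneg_nonneg)
qed

lemma summable_Gamma_quotient:
  fixes a b l r :: real
  assumes ab: "a > -1" "b > -1" and l: "l > 0" and r: "0 < r" "r < 1"
  shows "summable (\<lambda>n. (2 * real n + l) * Gamma (real n + l) * Gamma (real n + a + 1) /
     (Gamma (real n + b + 1) * fact n) * r ^ n)"
proof -
  define f where "f n = (2 * real n + l) * Gamma (real n + l) * Gamma (real n + a + 1) /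
     (Gamma (real n + b + 1) * fact n) * r ^ n" for n
  define g where "g n = r * ((2 * real n + 2 + l) / (2 * real n + l) * ((real n + l) / (real n + b + 1)) *
     ((real n + a + 1) / (real n + 1)))" for n
  have g1: "Gamma (real n + l) > 0" "Gamma (real n + a + 1) > 0" "Gamma (real n + b + 1) > 0" for n
    using ab l by auto
  have fS: "f (Suc n) = g n * f n" for n
  proof -
    have "Gamma (real (Suc n) + l) = (real n + l) * Gamma (real n + l)"
      "Gamma (real (Suc n) + a + 1) = (real n + a + 1) * Gamma (real n + a + 1)"
      "Gamma (real (Suc n) + b + 1) = (real n + b + 1) * Gamma (real n + b + 1)"
      using ab l Gamma_plus1_pos[of "real n + l"] Gamma_plus1_pos[of "real n + a + 1"]
        Gamma_plus1_pos[of "real n + b + 1"] by (simp_all add: add_ac)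
    then show ?thesis unfolding f_def g_def using g1[of n] ab l
      by (simp add: divide_simps) (simp add: algebra_simps)
  qed
  have glim: "g \<longlonglongrightarrow> r" unfolding g_def by real_asymp
  define c where "c = (r + 1) / 2"
  have c: "r < c" "c < 1" using r by (auto simp: c_def)
  obtain N where N: "\<And>n. n \<ge> N \<Longrightarrow> g n < c"
    using order_tendstoD(2)[OF glim c(1)] by (auto simp: eventually_sequentially)
  have fpos: "f n \<ge> 0" for n unfolding f_def using g1[of n] r l
    by (intro mult_nonneg_nonneg divide_nonneg_nonneg) auto
  have "summable f"
  proof (rule summable_ratio_test[OF c(2), of N])
    fix n assume "N \<le> n"
    then show "norm (f (Suc n)) \<le> c * norm (f n)"
      using N[of n] fpos[of n] fpos[of "Suc n"] unfolding real_norm_def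
      by (simp add: fS mult_right_mono)
  qed
  then show ?thesis unfolding f_def .
qed

text \<open>By \<open>abs_jacobi_poly_le\<close> the products are dominated by the squares of the
  two end point values, which are Gamma quotients. The two copies of \<open>?f\<close> belong to the
  end points 0 and 1.\<close>

lemma summable_jacobi_series:
  assumes al: "\<alpha> > -1" and be: "\<beta> > -1" and l: "\<alpha> + \<beta> + 1 > 0"
    and x: "0 \<le> x" "x \<le> 1" and y: "0 \<le> y" "y \<le> 1" and r: "0 \<le> r" "r < 1"
  shows "summable (\<lambda>n. \<bar>jacobi_coeff n \<alpha> \<beta> *
    (poly (jacobi_poly n \<alpha> \<beta>) x * poly (jacobi_poly n \<alpha> \<beta>) y)\<bar> * r ^ n)"
proof (cases "r = 0")
  case False
  then have r: "0 < r" "r < 1" using r by auto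
  let ?p = "\<lambda>n. poly (jacobi_poly n \<alpha> \<beta>)"
  let ?f = "\<lambda>a b n. (2 * real n + (\<alpha> + \<beta> + 1)) * Gamma (real n + (\<alpha> + \<beta> + 1)) * Gamma (real n + a + 1) /
     (Gamma (real n + b + 1) * fact n) * r ^ n / (Gamma (a + 1))\<^sup>2"
  have sm: "summable (\<lambda>n. ?f \<alpha> \<beta> n + ?f \<beta> \<alpha> n)"
    by (intro summable_add summable_divide summable_Gamma_quotient) (use al be l r in auto)
  show ?thesis
  proof (rule summable_comparison_test'[OF sm])
    fix n :: nat
    have g: "Gamma (real n + \<alpha> + 1) > 0" "Gamma (real n + \<beta> + 1) > 0" "Gamma (\<alpha> + 1) > 0" "Gamma (\<beta> + 1) > 0"
      using al be by auto
    have "\<bar>?p n x * ?p n y\<bar> \<le> (max \<bar>?p n 0\<bar> \<bar>?p n 1\<bar>) * (max \<bar>?p n 0\<bar> \<bar>?p n 1\<bar>)"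
      unfolding abs_mult
      by (intro mult_mono abs_jacobi_poly_le) (use assms in \<open>auto simp: max_def\<close>)
    also have "\<dots> \<le> (?p n 0)\<^sup>2 + (?p n 1)\<^sup>2"
      by (auto simp: max_def power2_eq_square)
    finally have b: "\<bar>?p n x * ?p n y\<bar> \<le> (?p n 0)\<^sup>2 + (?p n 1)\<^sup>2" .
    have "norm (\<bar>jacobi_coeff n \<alpha> \<beta> * (?p n x * ?p n y)\<bar> * r ^ n) =
      jacobi_coeff n \<alpha> \<beta> * \<bar>?p n x * ?p n y\<bar> * r ^ n"
      using jacobi_coeff_nonneg[OF al be l, of n] r by (simp add: abs_mult)
    also have "\<dots> \<le> jacobi_coeff n \<alpha> \<beta> * ((?p n 0)\<^sup>2 + (?p n 1)\<^sup>2) * r ^ n"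
      using jacobi_coeff_nonneg[OF al be l, of n] r b
      by (intro mult_right_mono mult_left_mono) auto
    also have "\<dots> = ?f \<alpha> \<beta> n + ?f \<beta> \<alpha> n"
    proof -
      have e: "(?p n 0)\<^sup>2 = (Gamma (real n + \<alpha> + 1) / (fact n * Gamma (\<alpha> + 1)))\<^sup>2"
        "(?p n 1)\<^sup>2 = (Gamma (real n + \<beta> + 1) / (fact n * Gamma (\<beta> + 1)))\<^sup>2"
        unfolding poly_jacobi_poly_0 poly_jacobi_poly_1 gchoose_shift_Gamma[OF al] gchoose_shift_Gamma[OF be]
        by (simp_all add: minus_one_power_iff)
      have e2: "2 * real n + (\<alpha> + \<beta> + 1) = 2 * real n + \<alpha> + \<beta> + 1" 
         "real n + (\<alpha> + \<beta> + 1) = real n + \<alpha> + \<beta> + 1" by simp_all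
      have d: "c * (u + v) * w = c * u * w + c * v * w" for c u v w :: real by (simp add: algebra_simps)
      show ?thesis unfolding d unfolding e jacobi_coeff_def e2 using g
        by (intro arg_cong2[where f="(+)"]) (simp_all add: power2_eq_square mult_ac)
    qed
    finally show "norm (\<bar>jacobi_coeff n \<alpha> \<beta> * (?p n x * ?p n y)\<bar> * r ^ n) \<le> ?f \<alpha> \<beta> n + ?f \<beta> \<alpha> n" .
  qed
next
  case True
  have "summable (\<lambda>n. if n = 0 then \<bar>jacobi_coeff 0 \<alpha> \<beta> *
    (poly (jacobi_poly 0 \<alpha> \<beta>) x * poly (jacobi_poly 0 \<alpha> \<beta>) y)\<bar> else 0)" by simp
  also have "(\<lambda>n. if n = 0 then \<bar>jacobi_coeff 0 \<alpha> \<beta> *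
    (poly (jacobi_poly 0 \<alpha> \<beta>) x * poly (jacobi_poly 0 \<alpha> \<beta>) y)\<bar> else 0) =
    (\<lambda>n. \<bar>jacobi_coeff n \<alpha> \<beta> *
    (poly (jacobi_poly n \<alpha> \<beta>) x * poly (jacobi_poly n \<alpha> \<beta>) y)\<bar> * r ^ n)"
    using True by (auto simp: fun_eq_iff)
  finally show ?thesis .
qed

text \<open>The coefficients are Gamma \<mu> times the sum of two consecutive coefficients of the
  binomial series for (1 + t)^(-\<mu>), hence the extra factor 1 - t. The case t = r gives the sum
  over n of the weights of one fixed N, the case t = -r the corresponding sum of absolute
  values.\<close>

lemma sums_shifted_binomial:
  fixes \<mu> t :: real
  assumes mu: "\<mu> > 1" and t: "\<bar>t\<bar> < 1"
  shows "(\<lambda>k. (2 * real k + \<mu> - 1) * Gamma (\<mu> - 1 + real k) / fact k * (-t) ^ k) sums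
     (Gamma \<mu> * (1 - t) * (1 + t) powr (-\<mu>))"
proof -
  define b where "b k = pochhammer \<mu> k / fact k" for k
  have b: "(\<lambda>k. b k * (-t) ^ k) sums (1 + t) powr (-\<mu>)"
    using gen_binomial_real[OF t, of "-\<mu>"]
    by (simp add: b_def gbinomial_pochhammer power_minus[of t] mult_ac)
  then have b': "(\<lambda>k. if k = 0 then 0 else b (k - 1) * (-t) ^ k) sums (-t * (1 + t) powr (-\<mu>))"
  proof -
    have "(\<lambda>k. -t * (b k * (-t) ^ k)) sums (-t * (1 + t) powr (-\<mu>))"
      by (rule sums_mult[OF b])
    then have "(\<lambda>k. if Suc k = 0 then 0 else b (Suc k - 1) * (-t) ^ (Suc k)) sums (-t * (1 + t) powr (-\<mu>))"
      by (simp add: mult_ac)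
    then show ?thesis
      by (subst (asm) sums_Suc_iff[where f="\<lambda>k. if k = 0 then 0 else b (k - 1) * (-t) ^ k"]) simp
  qed
  have bG: "b k = Gamma (\<mu> + real k) / (Gamma \<mu> * fact k)" for k
    using mu by (subst b_def, subst pochhammer_Gamma) (auto dest: nonpos_Ints_nonpos)
  have eq: "Gamma \<mu> * (b k * (-t) ^ k + (if k = 0 then 0 else b (k - 1) * (-t) ^ k)) =
     (2 * real k + \<mu> - 1) * Gamma (\<mu> - 1 + real k) / fact k * (-t) ^ k" for k
  proof (cases k)
    case 0
    then show ?thesis using Gamma_plus1_pos[of "\<mu> - 1"] mu by (simp add: bG)
  next
    case (Suc m)
    have g: "Gamma \<mu> > 0" using mu by simp
    define G F where "G = Gamma (\<mu> - 1 + real k)" and "F = (fact k :: real)"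
    have F: "F > 0" by (simp add: F_def)
    have "Gamma (\<mu> + real k) = (\<mu> - 1 + real k) * G"
      using Gamma_plus1_pos[of "\<mu> - 1 + real k"] mu by (simp add: G_def)
    then have b1: "b k = (\<mu> - 1 + real k) * G / (Gamma \<mu> * F)" by (simp add: bG F_def)
    have "Gamma (\<mu> + real (k - 1)) = G"
      using Suc by (simp add: algebra_simps G_def)
    moreover have "F = real k * fact (k - 1)" using Suc by (simp add: F_def)
    moreover have "real k > 0" using Suc by simp
    ultimately have b2: "b (k - 1) = real k * G / (Gamma \<mu> * F)" by (simp add: bG)
    have "Gamma \<mu> * (b k + b (k - 1)) = (2 * real k + \<mu> - 1) * Gamma (\<mu> - 1 + real k) / fact k"
      unfolding b1 b2 G_def[symmetric] F_def[symmetric] using g F by (simp add: field_simps)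
    moreover have "Gamma \<mu> * (b k * (-t) ^ k + (if k = 0 then 0 else b (k - 1) * (-t) ^ k)) =
      Gamma \<mu> * (b k + b (k - 1)) * (-t) ^ k"
      using Suc by (simp only: distrib_left distrib_right mult.assoc) simp
    ultimately show ?thesis by simp
  qed
  have "(\<lambda>k. Gamma \<mu> * (b k * (-t) ^ k + (if k = 0 then 0 else b (k - 1) * (-t) ^ k))) sums
    (Gamma \<mu> * ((1 + t) powr (-\<mu>) + (-t * (1 + t) powr (-\<mu>))))"
    by (intro sums_mult sums_add b b')
  then show ?thesis unfolding eq by (simp add: algebra_simps)
qed

text \<open>The Gamma factor is what summation over the degree leaves behind. It is also the one
  produced by the Laplace transform of the powers of u in
  \<open>bessel_product_sums\<close>.\<close>

definition bailey_term :: "real \<Rightarrow> real \<Rightarrow> real \<Rightarrow> real \<Rightarrow> nat \<Rightarrow> real" where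
  "bailey_term \<alpha> \<beta> x y N = Gamma (\<alpha> + \<beta> + 2 + 2 * real N) * bailey \<alpha> \<beta> N x y"

lemma bailey_nonneg:
  assumes "\<alpha> > -1" "\<beta> > -1" "0 \<le> x" "x \<le> 1" "0 \<le> y" "y \<le> 1"
  shows "bailey \<alpha> \<beta> N x y \<ge> 0"
  unfolding bailey_def using assms
  by (intro sum_nonneg mult_nonneg_nonneg zero_le_power) (auto intro: less_imp_le bailey_coeff_pos)

text \<open>The product formula is inserted and the sums over n = N + k and N are exchanged;
  \<open>sums_shifted_binomial\<close> evaluates the sum over k. Absolute convergence replaces -r by
  r in that sum, so convergence is required at r/(1 - r)^2.\<close>

lemma jacobi_series_small:
  assumes al: "\<alpha> > -1" and be: "\<beta> > -1" and l: "\<alpha> + \<beta> + 1 > 0"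
    and x: "0 \<le> x" "x \<le> 1" and y: "0 \<le> y" "y \<le> 1" and r: "0 < r" "r < 1"
    and sm: "summable (\<lambda>N. bailey_term \<alpha> \<beta> x y N * (r / (1 - r)\<^sup>2) ^ N)"
  shows "(\<lambda>n. jacobi_coeff n \<alpha> \<beta> * (poly (jacobi_poly n \<alpha> \<beta>) x * poly (jacobi_poly n \<alpha> \<beta>) y) * r ^ n) sums
    ((1 - r) * (1 + r) powr (-(\<alpha> + \<beta> + 2)) * (\<Sum>N. bailey_term \<alpha> \<beta> x y N * (r / (1 + r)\<^sup>2) ^ N))"
proof -
  define l where "l = \<alpha> + \<beta> + 1"
  define \<mu> where "\<mu> N = l + 1 + 2 * real N" for N :: nat
  define R where "R N = bailey \<alpha> \<beta> N x y" for N
  have Rnn: "R N \<ge> 0" for N unfolding R_def by (rule bailey_nonneg) (use assms in auto)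
  have mu: "\<mu> N > 1" for N using l by (simp add: \<mu>_def l_def)
  define c where "c N k = (2 * real k + \<mu> N - 1) * Gamma (\<mu> N - 1 + real k) / fact k" for N k
  have cnn: "c N k \<ge> 0" for N k
  proof -
    have "Gamma (\<mu> N - 1 + real k) > 0" using mu[of N] by simp
    then show ?thesis using mu[of N] by (simp add: c_def)
  qed
  define f where "f = (\<lambda>(N, k). R N * r ^ N * (c N k * (-r) ^ k))"
  have inner: "(\<lambda>k. c N k * (-r) ^ k) sums (Gamma (\<mu> N) * (1 - r) * (1 + r) powr (-\<mu> N))" for N
    using sums_shifted_binomial[OF mu[of N], of r] r by (simp add: c_def)
  have inner': "(\<lambda>k. c N k * r ^ k) sums (Gamma (\<mu> N) * (1 + r) * (1 - r) powr (-\<mu> N))" for N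
    using sums_shifted_binomial[OF mu[of N], of "-r"] r by (simp add: c_def)
  \<comment> \<open>Used for b = 1 + r in the value of the sum and for b = 1 - r in the absolute
    bound.\<close>
  have pw: "R N * r ^ N * (Gamma (\<mu> N) * a * b powr (-\<mu> N)) =
      a * b powr (-(\<alpha> + \<beta> + 2)) * (bailey_term \<alpha> \<beta> x y N * (r / b\<^sup>2) ^ N)" if "b > 0" for a b N
  proof -
    have "b powr (-\<mu> N) = b powr (-(\<alpha> + \<beta> + 2)) * b powr (- real (2 * N))"
      by (simp add: powr_add[symmetric] \<mu>_def l_def)
    also have "b powr (- real (2 * N)) = inverse (b\<^sup>2) ^ N"
      using that by (simp only: powr_minus powr_realpow power_mult power_inverse)
    finally show ?thesis
      by (simp add: bailey_term_def R_def \<mu>_def l_def power_mult_distrib divide_inverse algebra_simps)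
  qed
  have "(\<lambda>z. norm (f z)) summable_on (UNIV \<times> UNIV)"
  proof (rule summable_on_SigmaI)
    fix N :: nat
    have "(\<lambda>k. R N * r ^ N * (c N k * r ^ k)) sums (R N * r ^ N * (Gamma (\<mu> N) * (1 + r) * (1 - r) powr (-\<mu> N)))"
      by (rule sums_mult[OF inner'])
    then have "(\<lambda>k. norm (f (N, k))) sums (R N * r ^ N * (Gamma (\<mu> N) * (1 + r) * (1 - r) powr (-\<mu> N)))"
      using r Rnn[of N] cnn[of N] by (simp add: f_def abs_mult power_abs)
    then show "((\<lambda>k. norm (f (N, k))) has_sum (R N * r ^ N * (Gamma (\<mu> N) * (1 + r) * (1 - r) powr (-\<mu> N)))) UNIV"
      by (rule sums_nonneg_imp_has_sum) simp
  next
    have "summable (\<lambda>N. (1 + r) * (1 - r) powr (-(\<alpha> + \<beta> + 2)) * (bailey_term \<alpha> \<beta> x y N * (r / (1 - r)\<^sup>2) ^ N))"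
      by (rule summable_mult[OF sm])
    then have "summable (\<lambda>N. R N * r ^ N * (Gamma (\<mu> N) * (1 + r) * (1 - r) powr (-\<mu> N)))"
      using r by (simp add: pw)
    moreover have "R N * r ^ N * (Gamma (\<mu> N) * (1 + r) * (1 - r) powr (-\<mu> N)) \<ge> 0" for N
      using Rnn[of N] r mu[of N] Gamma_real_pos[of "\<mu> N"] by (intro mult_nonneg_nonneg) auto
    ultimately show "(\<lambda>N. R N * r ^ N * (Gamma (\<mu> N) * (1 + r) * (1 - r) powr (-\<mu> N))) summable_on UNIV"
      by (intro summable_nonneg_imp_summable_on) auto
  qed auto
  then have fs: "f summable_on (UNIV \<times> UNIV)" by (rule abs_summable_summable)
  define S where "S = infsum f (UNIV \<times> UNIV)"
  have hs: "(f has_sum S) (UNIV \<times> UNIV)" using fs by (simp add: S_def)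
  have innerhs: "((\<lambda>k. f (N, k)) has_sum (R N * r ^ N * (Gamma (\<mu> N) * (1 - r) * (1 + r) powr (-\<mu> N)))) UNIV" for N
  proof (rule norm_summable_imp_has_sum)
    show "(\<lambda>k. f (N, k)) sums (R N * r ^ N * (Gamma (\<mu> N) * (1 - r) * (1 + r) powr (-\<mu> N)))"
      unfolding f_def by (simp, rule sums_mult[OF inner])
    have "(\<lambda>k. R N * r ^ N * (c N k * r ^ k)) sums (R N * r ^ N * (Gamma (\<mu> N) * (1 + r) * (1 - r) powr (-\<mu> N)))"
      by (rule sums_mult[OF inner'])
    then have "(\<lambda>k. norm (f (N, k))) sums (R N * r ^ N * (Gamma (\<mu> N) * (1 + r) * (1 - r) powr (-\<mu> N)))"
      using r Rnn[of N] cnn[of N] by (simp add: f_def abs_mult power_abs)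
    then show "summable (\<lambda>k. norm (f (N, k)))" by (rule sums_summable)
  qed
  have "((\<lambda>N. R N * r ^ N * (Gamma (\<mu> N) * (1 - r) * (1 + r) powr (-\<mu> N))) has_sum S) UNIV"
    by (rule has_sum_SigmaD[OF hs]) (rule innerhs)
  then have "(\<lambda>N. R N * r ^ N * (Gamma (\<mu> N) * (1 - r) * (1 + r) powr (-\<mu> N))) sums S"
    by (rule has_sum_imp_sums)
  then have "(\<lambda>N. (1 - r) * (1 + r) powr (-(\<alpha> + \<beta> + 2)) * (bailey_term \<alpha> \<beta> x y N * (r / (1 + r)\<^sup>2) ^ N)) sums S"
    using r by (simp add: pw)
  moreover have nz: "(1 - r) * (1 + r) powr (-(\<alpha> + \<beta> + 2)) \<noteq> 0" using r by simp
  ultimately have h: "(\<lambda>N. bailey_term \<alpha> \<beta> x y N * (r / (1 + r)\<^sup>2) ^ N) sums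
      (S / ((1 - r) * (1 + r) powr (-(\<alpha> + \<beta> + 2))))"
    by (rule sums_mult_D)
  have S_eq: "S = (1 - r) * (1 + r) powr (-(\<alpha> + \<beta> + 2)) * (\<Sum>N. bailey_term \<alpha> \<beta> x y N * (r / (1 + r)\<^sup>2) ^ N)"
  proof -
    have *: "T = S / A \<Longrightarrow> A \<noteq> 0 \<Longrightarrow> S = A * T" for A T :: real by simp
    show ?thesis by (rule *[OF _ nz]) (use h[THEN sums_unique] in simp)
  qed
  \<comment> \<open>Back from the pairs (N, k) to the pairs (n, N) with N at most n.\<close>
  have "((\<lambda>(n, N). f (N, n - N)) has_sum S) (Sigma UNIV (\<lambda>n. {..n})) = (f has_sum S) (UNIV \<times> UNIV)"
    by (rule has_sum_reindex_bij_witness[where i="\<lambda>(N, k). (N + k, N)" and j="\<lambda>(n, N). (N, n - N)"]) auto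
  then have "((\<lambda>(n, N). f (N, n - N)) has_sum S) (Sigma UNIV (\<lambda>n. {..n}))" using hs by simp
  then have "((\<lambda>n. \<Sum>N\<le>n. f (N, n - N)) has_sum S) UNIV"
    by (rule has_sum_SigmaD) (simp add: has_sum_finite)
  then have "(\<lambda>n. \<Sum>N\<le>n. f (N, n - N)) sums S" by (rule has_sum_imp_sums)
  moreover have "(\<Sum>N\<le>n. f (N, n - N)) =
    jacobi_coeff n \<alpha> \<beta> * (poly (jacobi_poly n \<alpha> \<beta>) x * poly (jacobi_poly n \<alpha> \<beta>) y) * r ^ n" for n
  proof -
    have "f (N, n - N) = (2 * real n + \<alpha> + \<beta> + 1) * r ^ n * (bailey_weight (\<alpha> + \<beta> + 1) n N * bailey \<alpha> \<beta> N x y)"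
      if "N \<le> n" for N
    proof -
      obtain k where k: "n = N + k" using le_Suc_ex[OF \<open>N \<le> n\<close>] by auto
      have e: "2 * real k + \<mu> N - 1 = 2 * real n + \<alpha> + \<beta> + 1" 
        "\<mu> N - 1 + real k = \<alpha> + \<beta> + 1 + real n + real N"
        unfolding k \<mu>_def l_def of_nat_add by simp_all
      have nk: "n - N = k" using k by simp
      have "f (N, n - N) = R N * r ^ N * ((2 * real n + \<alpha> + \<beta> + 1) * Gamma (\<alpha> + \<beta> + 1 + real n + real N) / fact k * (-r) ^ k)"
        by (simp only: f_def c_def nk e prod.case)
      also have "(-r) ^ k = (-1) ^ k * r ^ k" by (rule power_minus)
      also have "R N * r ^ N * ((2 * real n + \<alpha> + \<beta> + 1) * Gamma (\<alpha> + \<beta> + 1 + real n + real N) / fact k * ((-1) ^ k * r ^ k)) =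
        (2 * real n + \<alpha> + \<beta> + 1) * (r ^ N * r ^ k) * ((-1) ^ k * Gamma (\<alpha> + \<beta> + 1 + real n + real N) / fact k * R N)"
        by (simp add: divide_inverse)
      also have "r ^ N * r ^ k = r ^ n" by (simp only: k power_add)
      finally show ?thesis by (simp only: bailey_weight_def nk R_def)
    qed
    then have "(\<Sum>N\<le>n. f (N, n - N)) = (2 * real n + \<alpha> + \<beta> + 1) * r ^ n *
        (\<Sum>N\<le>n. bailey_weight (\<alpha> + \<beta> + 1) n N * bailey \<alpha> \<beta> N x y)"
      by (simp add: sum_distrib_left)
    also have "\<dots> = jacobi_coeff n \<alpha> \<beta> * (poly (jacobi_poly n \<alpha> \<beta>) x * poly (jacobi_poly n \<alpha> \<beta>) y) * r ^ n"
      unfolding bailey_product_formula[OF al be l] jacobi_coeff_def by simp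
    finally show ?thesis .
  qed
  ultimately show ?thesis unfolding S_eq by simp
qed

text \<open>For 0 < r < 1 the argument r/(1 + r)^2 is at most 1/4, so a radius Z > 1/4 covers all r,
  whereas the rearrangement asks for convergence at r/(1 - r)^2. The identity theorem closes the
  gap.\<close>

lemma jacobi_series_eq:
  assumes al: "\<alpha> > -1" and be: "\<beta> > -1" and l: "\<alpha> + \<beta> + 1 > 0"
    and x: "0 \<le> x" "x \<le> 1" and y: "0 \<le> y" "y \<le> 1" and r: "0 < r" "r < 1"
    and Z: "Z > 1/4" and sm: "\<And>z. 0 \<le> z \<Longrightarrow> z < Z \<Longrightarrow> summable (\<lambda>N. bailey_term \<alpha> \<beta> x y N * z ^ N)"
  shows "(\<lambda>n. jacobi_coeff n \<alpha> \<beta> * (poly (jacobi_poly n \<alpha> \<beta>) x * poly (jacobi_poly n \<alpha> \<beta>) y) * r ^ n) sums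
    ((1 - r) * (1 + r) powr (-(\<alpha> + \<beta> + 2)) * (\<Sum>N. bailey_term \<alpha> \<beta> x y N * (r / (1 + r)\<^sup>2) ^ N))"
proof -
  define D where "D n = jacobi_coeff n \<alpha> \<beta> * (poly (jacobi_poly n \<alpha> \<beta>) x * poly (jacobi_poly n \<alpha> \<beta>) y)" for n
  define b where "b = bailey_term \<alpha> \<beta> x y"
  have bnn: "b N \<ge> 0" for N
  proof -
    have "Gamma (\<alpha> + \<beta> + 2 + 2 * real N) > 0" using l by simp
    then show ?thesis using bailey_nonneg[OF al be x y, of N] by (simp add: b_def bailey_term_def)
  qed
  define e where "e = - (\<alpha> + \<beta> + 2)"
  define h1 where "h1 z = (\<Sum>n. of_real (D n) * z ^ n)" for z :: complex
  define g where "g z = (\<Sum>n. of_real (b n) * z ^ n)" for z :: complex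
  define h2 where "h2 z = (1 - z) * (1 + z) powr of_real e * g (z / (1 + z)\<^sup>2)" for z :: complex
  have sD: "summable (\<lambda>n. \<bar>D n\<bar> * t ^ n)" if "0 \<le> t" "t < 1" for t
    using summable_jacobi_series[OF al be l x y that] by (simp add: D_def)
  have s1: "(\<lambda>n. of_real (D n) * z ^ n) sums h1 z" if "norm z < 1" for z :: complex
  proof -
    have "summable (\<lambda>n. norm (of_real (D n) * z ^ n))"
      using sD[OF norm_ge_zero that] by (simp only: norm_mult norm_power norm_of_real)
    then show ?thesis unfolding h1_def by (rule summable_sums[OF summable_norm_cancel])
  qed
  have s2: "(\<lambda>n. of_real (b n) * z ^ n) sums g z" if "norm z < Z" for z :: complex
  proof -
    have "summable (\<lambda>n. norm (of_real (b n) * z ^ n))"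
      using sm[OF norm_ge_zero that] bnn by (simp only: norm_mult norm_power b_def norm_of_real abs_of_nonneg)
    then show ?thesis unfolding g_def by (rule summable_sums[OF summable_norm_cancel])
  qed
  have hol1: "h1 holomorphic_on ball 0 1"
  proof (rule power_series_holomorphic[where a="\<lambda>n. of_real (D n)"])
    fix w :: complex assume "w \<in> ball 0 1"
    then have "norm w < 1" by simp
    from s1[OF this] show "(\<lambda>n. of_real (D n) * (w - 0) ^ n) sums h1 w" by (simp only: diff_zero)
  qed
  have holg: "g holomorphic_on ball 0 Z"
  proof (rule power_series_holomorphic[where a="\<lambda>n. of_real (b n)"])
    fix w :: complex assume "w \<in> ball 0 Z"
    then have "norm w < Z" by simp
    from s2[OF this] show "(\<lambda>n. of_real (b n) * (w - 0) ^ n) sums g w" by (simp only: diff_zero)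
  qed
  \<comment> \<open>Rearranging the double series is possible for small \<open>r\<close> only; both sides continue analytically to \<open>S\<close>,
    which contains the interval from 0 to 1 and is star-shaped because \<open>1 / s + s\<close> decreases for \<open>0 < s < 1\<close>.\<close>
  define S where "S = {z :: complex. norm z < 1 \<and> norm z < Z * (norm (1 + z))\<^sup>2}"
  have opS: "open S" unfolding S_def by (intro open_Collect_conj open_Collect_less continuous_intros)
  \<comment> \<open>Keeps 1 + z away from the branch cut of the complex power.\<close>
  have nz: "Re (1 + z) > 0" if "z \<in> S" for z
    using that abs_Re_le_cmod[of z] by (auto simp: S_def)
  have nz': "1 + z \<noteq> 0" if "z \<in> S" for z using nz[OF that] by (metis less_irrefl zero_complex.sel(1))
  have maps: "z / (1 + z)\<^sup>2 \<in> ball 0 Z" if "z \<in> S" for z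
    using that nz'[OF that] by (simp add: S_def norm_divide norm_power divide_less_eq mult.commute)
  have hol2: "h2 holomorphic_on S"
  proof -
    have "(g \<circ> (\<lambda>z. z / (1 + z)\<^sup>2)) holomorphic_on S"
      by (rule holomorphic_on_compose_gen[OF _ holg])
         (use nz' maps in \<open>auto intro!: holomorphic_intros\<close>)
    moreover have "1 + z \<notin> \<real>\<^sub>\<le>\<^sub>0" if "z \<in> S" for z
      using nz[OF that] by (auto simp: complex_nonpos_Reals_iff)
    ultimately show ?thesis unfolding h2_def
      by (intro holomorphic_intros) (auto simp: o_def)
  qed
  have zS: "0 \<in> S" using Z by (simp add: S_def)
  have conn: "connected S"
  proof (rule starlike_imp_connected, unfold starlike_def, intro bexI[OF _ zS] ballI subsetI)
    fix z w assume z: "z \<in> S" and "w \<in> closed_segment 0 z"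
    then obtain u where u: "0 \<le> u" "u \<le> 1" "w = of_real u * z"
      by (auto simp: in_segment scaleR_conv_of_real)
    have n1: "norm z < 1" and n2: "norm z < Z * (norm (1 + z))\<^sup>2" using z by (auto simp: S_def)
    have sq: "(norm (1 + of_real t * z))\<^sup>2 = 1 + 2 * t * Re z + t\<^sup>2 * (norm z)\<^sup>2" for t
      unfolding cmod_power2 by (simp add: power2_eq_square algebra_simps)
    have "u * norm z < Z * (norm (1 + of_real u * z))\<^sup>2"
    proof (cases "u = 0")
      case True
      then show ?thesis using Z by simp
    next
      case False
      have "u * (1 + 2 * Re z + (norm z)\<^sup>2) \<le> 1 + 2 * u * Re z + u\<^sup>2 * (norm z)\<^sup>2"
      proof -
        have "u * (norm z)\<^sup>2 \<le> 1 * 1" using u n1 by (intro mult_mono) (auto simp: power_le_one)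
        then have "0 \<le> (1 - u) * (1 - u * (norm z)\<^sup>2)" using u by (intro mult_nonneg_nonneg) auto
        then show ?thesis by (simp add: power2_eq_square algebra_simps)
      qed
      then have "u * (norm (1 + z))\<^sup>2 \<le> (norm (1 + of_real u * z))\<^sup>2"
        using sq[of 1] sq[of u] by simp
      then have "Z * (u * (norm (1 + z))\<^sup>2) \<le> Z * (norm (1 + of_real u * z))\<^sup>2"
        using Z by (intro mult_left_mono) auto
      moreover have "u * norm z < u * (Z * (norm (1 + z))\<^sup>2)"
        using False u n2 by simp
      ultimately show ?thesis by (simp add: mult_ac)
    qed
    moreover have "norm w < 1"
      using u n1 mult_left_le_one_le[of "norm z" u] by (simp add: norm_mult)
    ultimately show "w \<in> S" using u by (simp add: S_def norm_mult)
  qed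
  have real: "h1 (of_real t) = of_real (\<Sum>n. D n * t ^ n)" if t: "0 \<le> t" "t < 1" for t
  proof -
    have "summable (\<lambda>n. D n * t ^ n)"
      by (rule summable_norm_cancel) (use sD[OF t] t in \<open>simp add: abs_mult\<close>)
    then have "(\<lambda>n. complex_of_real (D n * t ^ n)) sums of_real (\<Sum>n. D n * t ^ n)"
      by (intro sums_of_real summable_sums)
    moreover have "(\<lambda>n. complex_of_real (D n * t ^ n)) sums h1 (of_real t)"
      using s1[of "of_real t"] t by simp
    ultimately show ?thesis by (rule sums_unique2[symmetric])
  qed
  have real2: "h2 (of_real t) = of_real ((1 - t) * (1 + t) powr e * (\<Sum>N. b N * (t / (1 + t)\<^sup>2) ^ N))"
    if t: "0 \<le> t" "t < 1" for t
  proof -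
    let ?w = "t / (1 + t)\<^sup>2"
    have w: "0 \<le> ?w" "?w < Z"
    proof -
      have "4 * t \<le> (1 + t)\<^sup>2" using sum_squares_bound[of 1 t] by (simp add: power2_eq_square algebra_simps)
      then have "?w \<le> 1/4" using t by (simp add: divide_le_eq)
      then show "?w < Z" using Z by linarith
    qed (use t in simp)
    have "summable (\<lambda>n. b n * ?w ^ n)" using sm[OF w] by (simp add: b_def)
    then have "(\<lambda>n. complex_of_real (b n * ?w ^ n)) sums of_real (\<Sum>n. b n * ?w ^ n)"
      by (intro sums_of_real summable_sums)
    moreover have "(\<lambda>n. complex_of_real (b n * ?w ^ n)) sums g (of_real ?w)"
      using s2[of "of_real ?w"] w by (simp del: of_real_divide)
    ultimately have "g (of_real ?w) = of_real (\<Sum>n. b n * ?w ^ n)" by (rule sums_unique2[symmetric])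
    moreover have "complex_of_real (1 + t) powr of_real e = of_real ((1 + t) powr e)"
      using t by (intro powr_of_real) auto
    ultimately show ?thesis by (simp add: h2_def)
  qed
  have lim: "(0 :: complex) islimpt of_real ` {0<..<1/8}"
  proof (rule islimpt_approachable[THEN iffD2], intro allI impI)
    fix d :: real assume d: "d > 0"
    let ?t = "min (d/2) (1/16)"
    have "?t \<in> {0<..<1/8}" "norm (complex_of_real ?t) < d" using d by auto
    then show "\<exists>x'\<in>complex_of_real ` {0<..<1/8}. x' \<noteq> 0 \<and> dist x' 0 < d"
      by (intro bexI[of _ "of_real ?t"]) auto
  qed
  have inS: "of_real t \<in> S" if t: "0 < t" "t < 1" for t
  proof -
    have "4 * t \<le> (1 + t)\<^sup>2" using sum_squares_bound[of 1 t] by (simp add: power2_eq_square algebra_simps)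
    then have "1/4 * (4 * t) \<le> 1/4 * (1 + t)\<^sup>2" by (intro mult_left_mono) auto
    also have "\<dots> < Z * (1 + t)\<^sup>2" using Z t by (intro mult_strict_right_mono) auto
    finally have "t < Z * (1 + t)\<^sup>2" by simp
    moreover have "norm (1 + complex_of_real t) = 1 + t"
    proof -
      have "norm (complex_of_real (1 + t)) = 1 + t" using t by (subst norm_of_real) simp
      then show ?thesis by simp
    qed
    ultimately show ?thesis using t by (simp add: S_def)
  qed
  have hold: "(\<lambda>z. h1 z - h2 z) holomorphic_on S"
    by (intro holomorphic_intros hol2 holomorphic_on_subset[OF hol1]) (auto simp: S_def)
  have "h1 (of_real r) - h2 (of_real r) = 0"
  proof (rule analytic_continuation[OF hold opS conn _ zS lim])
    fix z :: complex assume "z \<in> of_real ` {0<..<1/8}"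
    then obtain t where t: "0 < t" "t < 1/8" "z = of_real t" by auto
    have t1: "0 < t" "t < 1" using t by auto
    \<comment> \<open>The bound 1/8 is small enough for the rearrangement: (1/8)/(7/8)^2 = 8/49 is
      below 1/4.\<close>
    have "(7/8)\<^sup>2 \<le> (1 - t)\<^sup>2" using t by (intro power_mono) auto
    then have "t / (1 - t)\<^sup>2 \<le> (1/8) / (7/8)\<^sup>2" using t by (intro frac_le) auto
    also have "\<dots> < Z" using Z by (simp add: power2_eq_square)
    finally have "summable (\<lambda>N. bailey_term \<alpha> \<beta> x y N * (t / (1 - t)\<^sup>2) ^ N)"
      using t by (intro sm) auto
    from jacobi_series_small[OF al be l x y t1 this]
    have "(\<Sum>n. D n * t ^ n) = (1 - t) * (1 + t) powr e * (\<Sum>N. b N * (t / (1 + t)\<^sup>2) ^ N)"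
      unfolding D_def b_def e_def by (rule sums_unique[symmetric])
    then show "h1 z - h2 z = 0" using t1 by (simp only: t(3) real real2 less_imp_le right_minus_eq)
  qed (use inS r in auto)
  then have "complex_of_real (\<Sum>n. D n * r ^ n) = of_real ((1 - r) * (1 + r) powr e * (\<Sum>N. b N * (r / (1 + r)\<^sup>2) ^ N))"
    using r by (simp only: real real2 less_imp_le right_minus_eq)
  then have eq: "(\<Sum>n. D n * r ^ n) = (1 - r) * (1 + r) powr e * (\<Sum>N. b N * (r / (1 + r)\<^sup>2) ^ N)"
    by (simp only: of_real_eq_iff)
  have "summable (\<lambda>n. D n * r ^ n)"
    by (rule summable_norm_cancel) (use sD[of r] r in \<open>simp add: abs_mult\<close>)
  then show ?thesis using eq unfolding D_def b_def e_def by (simp add: sums_iff)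
qed

section \<open>Bessel functions and bounds uniform in the order\<close>

text \<open>Log-convexity: u and v are convex combinations of x and y with the two weights
  exchanged, so adding the two inequalities gives each end point the total weight 1.\<close>

lemma Gamma_mult_le:
  fixes x y u v :: real
  assumes x: "0 < x" and u: "x \<le> u" "u \<le> y" and s: "u + v = x + y"
  shows "Gamma u * Gamma v \<le> Gamma x * Gamma y"
proof (cases "x = y")
  case True
  then show ?thesis using assms by simp
next
  case False
  have xy: "x < y" using False u by simp
  define t where "t = (u - x) / (y - x)"
  have t: "0 \<le> t" "t \<le> 1" using u xy by (auto simp: t_def divide_le_eq)
  have tu: "u = x + t * (y - x)" using xy by (simp add: t_def)
  have ue: "u = (1 - t) *\<^sub>R x + t *\<^sub>R y" unfolding tu by (simp add: algebra_simps)
  have ve: "v = (1 - (1 - t)) *\<^sub>R x + (1 - t) *\<^sub>R y" using s unfolding tu by (simp add: algebra_simps)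
  have pos: "u > 0" "v > 0" "y > 0" using assms by auto
  let ?f = "ln \<circ> (Gamma :: real \<Rightarrow> real)"
  have "?f u \<le> (1 - t) * ?f x + t * ?f y"
    unfolding ue by (rule convex_onD[OF log_convex_Gamma_real]) (use t x xy in auto)
  moreover have "?f v \<le> (1 - (1 - t)) * ?f x + (1 - t) * ?f y"
    unfolding ve by (rule convex_onD[OF log_convex_Gamma_real]) (use t x xy in auto)
  moreover have G: "Gamma u > 0" "Gamma v > 0" "Gamma x > 0" "Gamma y > 0" using pos x by auto
  ultimately have "?f u + ?f v \<le> ?f x + ?f y" by (simp add: algebra_simps)
  then have "ln (Gamma u * Gamma v) \<le> ln (Gamma x * Gamma y)"
    using G by (simp add: ln_mult)
  then show ?thesis using G by (subst (asm) ln_le_cancel_iff) auto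
qed

lemma Gamma_duplication_real:
  fixes x :: real
  assumes "x > 0"
  shows "Gamma x * Gamma (x + 1/2) = 2 powr (1 - 2 * x) * sqrt pi * Gamma (2 * x)"
proof -
  have np: "complex_of_real z \<notin> \<int>\<^sub>\<le>\<^sub>0" if "z > 0" for z
    using that by (auto dest: nonpos_Ints_nonpos simp: of_real_in_nonpos_Ints_iff)
  have "complex_of_real (Gamma x * Gamma (x + 1/2)) =
     of_real (exp ((1 - 2 * x) * ln 2) * sqrt pi * Gamma (2 * x))"
    using Gamma_legendre_duplication[of "of_real x"] np[of x] np[of "x + 1/2"] assms
    by (simp add: Gamma_complex_of_real[symmetric] exp_of_real[symmetric])
  then show ?thesis unfolding of_real_eq_iff by (simp add: powr_def)
qed

text \<open>With \<open>w = i + \<nu>/2 + 3/4\<close>, log-convexity gives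
  \<open>Gamma (i + 1) * Gamma (\<nu> + i + 1) \<ge> (Gamma (w + 1/4))\<^sup>2 \<ge> 2/3 * Gamma w * Gamma (w + 1/2)\<close>, without any
  distinction between small and large \<open>\<nu>\<close>; the duplication formula does the rest.\<close>

lemma bessel_Gamma_bound:
  assumes nu: "\<nu> \<ge> -1/2"
  shows "Gamma (2 * real i + \<nu> + 3/2) * sqrt 2 \<le>
    3 * 2 powr (2 * real i + \<nu>) * (fact i * Gamma (\<nu> + 1 + real i))"
proof -
  define w where "w = real i + \<nu> / 2 + 3/4"
  have w: "w \<ge> 1/2" using nu by (simp add: w_def)
  \<comment> \<open>A direct comparison of the square with \<open>Gamma w * Gamma (w + 1/2)\<close>
    by log-convexity goes the wrong way. Shifting one of its arguments by 1 puts the pair outside w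
    + 1/2 and w + 1.\<close>
  have "(w + 1/4) * (Gamma (w + 1/4) * Gamma (w + 1/4)) = Gamma (w + 1/4) * Gamma (w + 5/4)"
    using Gamma_plus1_pos[of "w + 1/4"] w by (simp add: add.assoc)
  also have "\<dots> \<ge> Gamma (w + 1) * Gamma (w + 1/2)"
    by (rule Gamma_mult_le) (use w in auto)
  also have "Gamma (w + 1) * Gamma (w + 1/2) = w * (Gamma w * Gamma (w + 1/2))"
    using Gamma_plus1_pos[of w] w by simp
  finally have 1: "w * (Gamma w * Gamma (w + 1/2)) \<le> (w + 1/4) * (Gamma (w + 1/4) * Gamma (w + 1/4))" .
  have "(w + 1/4) * (Gamma (w + 1/4) * Gamma (w + 1/4)) \<le> w * (3/2 * (Gamma (w + 1/4) * Gamma (w + 1/4)))"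
  proof -
    \<comment> \<open>Equivalent to w >= 1/2, which is the condition on \<nu> at i = 0, and the
      source of the factor 3/2.\<close>
    have "w + 1/4 \<le> w * (3/2)" using w by simp
    then have "(w + 1/4) * (Gamma (w + 1/4) * Gamma (w + 1/4)) \<le> (w * (3/2)) * (Gamma (w + 1/4) * Gamma (w + 1/4))"
      by (rule mult_right_mono) simp
    then show ?thesis by simp
  qed
  with 1 have "w * (Gamma w * Gamma (w + 1/2)) \<le> w * (3/2 * (Gamma (w + 1/4) * Gamma (w + 1/4)))" by linarith
  then have 2: "Gamma w * Gamma (w + 1/2) \<le> 3/2 * (Gamma (w + 1/4) * Gamma (w + 1/4))"
    using w by simp
  have 3: "Gamma (w + 1/4) * Gamma (w + 1/4) \<le> Gamma (1 + real i) * Gamma (\<nu> + 1 + real i)"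
  proof (cases "\<nu> \<ge> 0")
    case True
    then show ?thesis by (intro Gamma_mult_le) (auto simp: w_def)
  next
    case False
    then have "Gamma (w + 1/4) * Gamma (w + 1/4) \<le> Gamma (\<nu> + 1 + real i) * Gamma (1 + real i)"
      using nu by (intro Gamma_mult_le) (auto simp: w_def)
    then show ?thesis by (simp add: mult.commute)
  qed
  have "Gamma (2 * w) = Gamma w * Gamma (w + 1/2) * 2 powr (2 * w - 1) / sqrt pi"
    using Gamma_duplication_real[of w] w by (simp add: powr_diff field_simps)
  also have "\<dots> \<le> 3/2 * (fact i * Gamma (\<nu> + 1 + real i)) * 2 powr (2 * w - 1) / sqrt pi"
    using 2 3 by (intro divide_right_mono mult_right_mono) (auto simp: Gamma_fact)
  also have "\<dots> \<le> 3/2 * (fact i * Gamma (\<nu> + 1 + real i)) * 2 powr (2 * w - 1) / 1"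
    using pi_gt3 nu by (intro divide_left_mono) auto
  also have "2 powr (2 * w - 1) = 2 powr (2 * real i + \<nu>) * sqrt 2"
  proof -
    have "2 * w - 1 = (2 * real i + \<nu>) + 1/2" by (simp add: w_def algebra_simps)
    then show ?thesis by (simp add: powr_add powr_half_sqrt)
  qed
  finally have "Gamma (2 * w) * sqrt 2 \<le>
     3/2 * (fact i * Gamma (\<nu> + 1 + real i)) * (2 powr (2 * real i + \<nu>) * sqrt 2) * sqrt 2"
    by (simp add: mult_right_mono)
  also have "3/2 * (fact i * Gamma (\<nu> + 1 + real i)) * (2 powr (2 * real i + \<nu>) * sqrt 2) * sqrt 2 =
     3/2 * (fact i * Gamma (\<nu> + 1 + real i)) * 2 powr (2 * real i + \<nu>) * (sqrt 2 * sqrt 2)"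
    by (simp only: mult_ac)
  also have "\<dots> = 3 * 2 powr (2 * real i + \<nu>) * (fact i * Gamma (\<nu> + 1 + real i))" by simp
  finally have "Gamma (2 * w) * sqrt 2 \<le> 3 * 2 powr (2 * real i + \<nu>) * (fact i * Gamma (\<nu> + 1 + real i))" .
  moreover have "2 * w = 2 * real i + \<nu> + 3/2" by (simp add: w_def algebra_simps)
  ultimately show ?thesis by simp
qed

text \<open>Interpolation between the neighbouring integer exponents. Log-convexity bounds (n + 1)!
  by Gamma y times y^(1 - \<tau>), and Young's inequality splits z^\<tau> y^(1 - \<tau>) into z and
  y, which account for the two integer terms.\<close>

lemma powr_div_Gamma_le:
  fixes \<tau> z :: real
  assumes tau: "0 \<le> \<tau>" "\<tau> \<le> 1" and z: "z > 0"
  shows "z powr (real n + \<tau>) / Gamma (real n + \<tau> + 1) \<le> 2 * (z ^ n / fact n + z ^ Suc n / fact (Suc n))"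
proof -
  define y where "y = real n + 1 + \<tau>"
  have y: "y > 0" using tau by (simp add: y_def)
  have G: "Gamma y > 0" using y by simp
  have "Gamma (real n + 2) \<le> Gamma y * y powr (1 - \<tau>)"
  proof -
    have e: "real n + 2 = (1 - (1 - \<tau>)) *\<^sub>R y + (1 - \<tau>) *\<^sub>R (y + 1)" by (simp add: y_def algebra_simps)
    let ?f = "ln \<circ> (Gamma :: real \<Rightarrow> real)"
    have "?f (real n + 2) \<le> (1 - (1 - \<tau>)) * ?f y + (1 - \<tau>) * ?f (y + 1)"
      unfolding e by (rule convex_onD[OF log_convex_Gamma_real]) (use tau y in auto)
    also have "\<dots> = ln (Gamma y * y powr (1 - \<tau>))"
      using y G Gamma_plus1_pos[OF y] by (simp add: ln_mult ln_powr algebra_simps)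
    finally show ?thesis using y G by (simp add: ln_le_cancel_iff)
  qed
  also have "Gamma (real n + 2) = fact (Suc n)"
    using Gamma_fact[of "Suc n", where 'a=real] by (simp add: add.commute)
  finally have g: "fact (Suc n) \<le> Gamma y * y powr (1 - \<tau>)" .
  have yo: "z powr \<tau> * y powr (1 - \<tau>) \<le> \<tau> * z + (1 - \<tau>) * y"
    by (rule Youngs_inequality_0) (use tau z y in auto)
  have "(1 - \<tau>) * y \<le> 2 * (real n + 1)"
  proof -
    have "(1 - \<tau>) * y \<le> 1 * y" using tau y by (intro mult_right_mono) auto
    also have "\<dots> \<le> 2 * (real n + 1)" using tau by (simp add: y_def)
    finally show ?thesis .
  qed
  moreover have "\<tau> * z \<le> 1 * z" using tau z by (intro mult_right_mono) auto
  ultimately have yo': "z powr \<tau> * y powr (1 - \<tau>) \<le> z + 2 * (real n + 1)" using yo by linarith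
  have "z powr (real n + \<tau>) / Gamma y = z ^ n * (z powr \<tau> / Gamma y)"
    using z by (simp add: powr_add powr_realpow)
  also have "z powr \<tau> / Gamma y \<le> (z + 2 * (real n + 1)) / fact (Suc n)"
  proof -
    have "z powr \<tau> * fact (Suc n) \<le> z powr \<tau> * (Gamma y * y powr (1 - \<tau>))"
      using g by (intro mult_left_mono) auto
    also have "\<dots> = Gamma y * (z powr \<tau> * y powr (1 - \<tau>))" by simp
    also have "\<dots> \<le> Gamma y * (z + 2 * (real n + 1))" using yo' G by (intro mult_left_mono) auto
    finally show ?thesis using G by (simp add: divide_simps mult_ac del: fact_Suc)
  qed
  also have "z ^ n * ((z + 2 * (real n + 1)) / fact (Suc n)) = z ^ Suc n / fact (Suc n) + 2 * (z ^ n / fact n)"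
    by (simp add: divide_simps) (simp add: algebra_simps)
  also have "\<dots> \<le> 2 * (z ^ n / fact n + z ^ Suc n / fact (Suc n))"
  proof -
    have "u + 2 * v \<le> 2 * (v + u)" if "0 \<le> u" for u v :: real using that by (simp add: algebra_simps)
    from this[of "z ^ Suc n / fact (Suc n)"] show ?thesis using z by simp
  qed
  finally show ?thesis using z by (simp add: y_def add_ac mult_left_mono)
qed

text \<open>With k the integer part of m, the exponent 2i + m is compared with the integers 2i + k
  and 2i + k + 1. These pairs are disjoint for different i, so each term of the exponential series
  is used at most once and the bound does not depend on m.\<close>

lemma sum_powr_div_Gamma_le:
  fixes m z :: real
  assumes m: "m \<ge> 0" and z: "z > 0"
  shows "(\<Sum>i<M. z powr (2 * real i + m) / Gamma (2 * real i + m + 1)) \<le> 2 * exp z"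
proof -
  define k where "k = nat \<lfloor>m\<rfloor>"
  define \<tau> where "\<tau> = m - real k"
  have k: "real k \<le> m" "m < real k + 1" using m unfolding k_def by linarith+
  have tau: "0 \<le> \<tau>" "\<tau> \<le> 1" using k by (auto simp: \<tau>_def)
  define a where "a j = z ^ j / fact j" for j
  have a: "a j \<ge> 0" for j using z by (simp add: a_def)
  have "z powr (2 * real i + m) / Gamma (2 * real i + m + 1) \<le> 2 * (a (2 * i + k) + a (Suc (2 * i + k)))" for i
    using powr_div_Gamma_le[OF tau z, of "2 * i + k"] by (simp add: \<tau>_def a_def del: fact_Suc power_Suc)
  then have "(\<Sum>i<M. z powr (2 * real i + m) / Gamma (2 * real i + m + 1)) \<le>
     (\<Sum>i<M. 2 * (a (2 * i + k) + a (Suc (2 * i + k))))"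
    by (intro sum_mono)
  also have "\<dots> = 2 * (\<Sum>j<2 * M. a (j + k))"
    by (induction M) (simp_all add: algebra_simps)
  also have "(\<Sum>j<2 * M. a (j + k)) = sum a {k..<2 * M + k}"
    using sum.shift_bounds_nat_ivl[of a 0 k "2 * M"] by (simp add: lessThan_atLeast0)
  also have "\<dots> \<le> sum a {..<2 * M + k}" by (intro sum_mono2) (use a in auto)
  also have "\<dots> \<le> exp z"
  proof -
    have "a sums exp z" using exp_converges[of z] by (simp add: a_def[abs_def] scaleR_conv_of_real field_simps)
    then have "summable a" "suminf a = exp z" by (simp_all add: sums_iff)
    then show ?thesis using sum_le_suminf[of a "{..<2 * M + k}"] a by simp
  qed
  finally show ?thesis by simp
qed

section \<open>Modified Bessel functions\<close>

definition bessel_term :: "real \<Rightarrow> real \<Rightarrow> nat \<Rightarrow> real" where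
  "bessel_term \<nu> z i = sqrt z * (z / 2) powr (2 * real i + \<nu>) * bailey_coeff \<nu> i"

text \<open>This is \<open>sqrt z * I\<^sub>\<nu> z\<close> with the modified Bessel function \<open>I\<^sub>\<nu>\<close>.\<close>

definition bessel :: "real \<Rightarrow> real \<Rightarrow> real" where
  "bessel \<nu> z = (\<Sum>i. bessel_term \<nu> z i)"

lemma bessel_term_nonneg:
  assumes "\<nu> > -1" "z \<ge> 0" shows "bessel_term \<nu> z i \<ge> 0"
  unfolding bessel_term_def using bailey_coeff_pos[OF assms(1), of i] assms by simp

text \<open>\<open>bessel_Gamma_bound\<close> replaces the two Gamma factors by a single one, which
  turns the terms into those of an exponential series with shifted exponents; the factor
  \<open>sqrt z\<close> supplies the 1/2 in the shift.\<close>

lemma bessel_term_le: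
  assumes nu: "\<nu> \<ge> -1/2" and z: "z > 0"
  shows "bessel_term \<nu> z i \<le> 3 * (z powr (2 * real i + (\<nu> + 1/2)) / Gamma (2 * real i + (\<nu> + 1/2) + 1))"
proof -
  define G where "G = Gamma (2 * real i + \<nu> + 3/2)"
  define F where "F = fact i * Gamma (\<nu> + 1 + real i)"
  define P where "P = 2 powr (2 * real i + \<nu>)"
  have pos: "G > 0" "F > 0" "P > 0" using nu by (auto simp: G_def F_def P_def)
  have "G * 1 \<le> G * sqrt 2" using pos by (intro mult_left_mono) auto
  then have "G \<le> 3 * (P * F)" using bessel_Gamma_bound[OF nu, of i] by (simp add: G_def F_def P_def mult.assoc)
  then have "1 / (P * F) \<le> 3 / G" using pos by (simp add: field_simps)
  moreover have "bessel_term \<nu> z i = z powr (2 * real i + (\<nu> + 1/2)) * (1 / (P * F))"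
  proof -
    have "sqrt z * z powr (2 * real i + \<nu>) = z powr (2 * real i + (\<nu> + 1/2))"
      using z by (simp add: powr_half_sqrt[symmetric] powr_add[symmetric] add_ac)
    then show ?thesis using z
      by (simp add: bessel_term_def powr_divide bailey_coeff_def P_def F_def mult_ac)
  qed
  ultimately have "bessel_term \<nu> z i \<le> z powr (2 * real i + (\<nu> + 1/2)) * (3 / G)"
    by (simp only: mult_left_mono powr_ge_zero)
  moreover have ar: "2 * real i + (\<nu> + 1/2) + 1 = 2 * real i + \<nu> + 3/2" by simp
  ultimately show ?thesis unfolding ar G_def[symmetric] by (simp add: mult.commute)
qed

lemma summable_bessel_term:
  assumes nu: "\<nu> \<ge> -1/2" and z: "z > 0"
  shows "summable (bessel_term \<nu> z)"
proof (rule summableI_nonneg_bounded)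
  show "bessel_term \<nu> z i \<ge> 0" for i using nu z by (intro bessel_term_nonneg) auto
  fix M
  have "sum (bessel_term \<nu> z) {..<M} \<le>
      (\<Sum>i<M. 3 * (z powr (2 * real i + (\<nu> + 1/2)) / Gamma (2 * real i + (\<nu> + 1/2) + 1)))"
    by (intro sum_mono bessel_term_le nu z)
  also have "\<dots> \<le> 3 * (2 * exp z)"
    unfolding sum_distrib_left[symmetric]
    by (intro mult_left_mono sum_powr_div_Gamma_le) (use nu z in auto)
  finally show "sum (bessel_term \<nu> z) {..<M} \<le> 3 * (2 * exp z)" .
qed

text \<open>18 = 3 * 2 * 3, from \<open>bessel_term_le\<close>, \<open>sum_powr_div_Gamma_le\<close>
  and e <= 3. For z <= 1 the factor z^m is taken out of every term, all exponents being at least m,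
  and the rest is summed at z = 1.\<close>

lemma bessel_le:
  assumes m: "m \<ge> 0" and nu: "\<nu> \<ge> m - 1/2" and z: "z > 0"
  shows "bessel \<nu> z \<le> 18 * exp z * (min 1 z) powr m"
proof -
  have nu': "\<nu> \<ge> -1/2" using m nu by linarith
  let ?x = "\<lambda>i. 2 * real i + (\<nu> + 1/2)"
  have "sum (bessel_term \<nu> z) {..<M} \<le> 18 * exp z * (min 1 z) powr m" for M
  proof (cases "z \<le> 1")
    case True
    have "sum (bessel_term \<nu> z) {..<M} \<le> (\<Sum>i<M. 3 * (z powr m * (1 powr ?x i / Gamma (?x i + 1))))"
    proof (rule sum_mono)
      fix i
      have "z powr ?x i \<le> z powr m" using True z nu by (intro powr_mono') auto
      moreover have "Gamma (?x i + 1) > 0" using nu' by simp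
      ultimately have "3 * (z powr ?x i / Gamma (?x i + 1)) \<le> 3 * (z powr m * (1 powr ?x i / Gamma (?x i + 1)))"
        by (simp add: divide_right_mono)
      then show "bessel_term \<nu> z i \<le> 3 * (z powr m * (1 powr ?x i / Gamma (?x i + 1)))"
        using bessel_term_le[OF nu' z, of i] by linarith
    qed
    also have "\<dots> = 3 * z powr m * (\<Sum>i<M. 1 powr ?x i / Gamma (?x i + 1))"
      by (simp add: sum_distrib_left mult_ac)
    also have "\<dots> \<le> 3 * z powr m * (2 * exp 1)"
      by (intro mult_left_mono sum_powr_div_Gamma_le) (use nu' in auto)
    also have "\<dots> \<le> 3 * z powr m * (2 * (3 * exp z))"
    proof -
      have "exp (1::real) \<le> 3" using e_less_272 by simp
      also have "\<dots> \<le> 3 * exp z" using z by simp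
      finally show ?thesis by (intro mult_left_mono) auto
    qed
    finally show ?thesis using True by (simp add: mult_ac)
  next
    case False
    have "sum (bessel_term \<nu> z) {..<M} \<le> (\<Sum>i<M. 3 * (z powr ?x i / Gamma (?x i + 1)))"
      by (intro sum_mono bessel_term_le nu' z)
    also have "\<dots> \<le> 3 * (2 * exp z)"
      unfolding sum_distrib_left[symmetric]
      by (intro mult_left_mono sum_powr_div_Gamma_le) (use nu' z in auto)
    also have "\<dots> \<le> 18 * exp z" using exp_gt_zero[of z] by linarith
    finally show ?thesis using False by simp
  qed
  then show ?thesis unfolding bessel_def by (intro suminf_le_const summable_bessel_term nu' z)
qed

section \<open>Laplace transforms of products of Bessel functions\<close>

lemma nn_integral_Gamma_scaled:
  fixes s c :: real
  assumes s: "s > 0" and c: "c > 0"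
  shows "(\<integral>\<^sup>+u. ennreal (u powr (s - 1) * exp (- c * u)) * indicator {0<..} u \<partial>lborel) = ennreal (Gamma s / c powr s)"
proof -
  let ?f = "\<lambda>t. ennreal (indicator {0..} t * t powr (s - 1) / exp t)"
  have "ennreal (Gamma s) = integral\<^sup>N lborel ?f" by (rule Gamma_conv_nn_integral_real[OF s])
  also have "\<dots> = ennreal \<bar>c\<bar> * (\<integral>\<^sup>+u. ?f (0 + c * u) \<partial>lborel)"
    by (rule nn_integral_real_affine) (use c in auto)
  also have "(\<integral>\<^sup>+u. ?f (0 + c * u) \<partial>lborel) =
     (\<integral>\<^sup>+u. ennreal (c powr (s - 1)) * (ennreal (u powr (s - 1) * exp (- c * u)) * indicator {0<..} u) \<partial>lborel)"
  proof (rule nn_integral_cong_AE, rule AE_mp[OF AE_lborel_singleton[of 0]], rule AE_I2, rule impI)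
    fix u :: real assume "u \<noteq> 0"
    show "?f (0 + c * u) = ennreal (c powr (s - 1)) * (ennreal (u powr (s - 1) * exp (- c * u)) * indicator {0<..} u)"
    proof (cases "u > 0")
      case True
      then show ?thesis using c
        by (simp add: powr_mult exp_minus divide_inverse ennreal_mult''[symmetric] mult_ac)
    next
      case False
      with \<open>u \<noteq> 0\<close> have "\<not> 0 \<le> c * u" using c by (simp add: zero_le_mult_iff)
      then show ?thesis using False by simp
    qed
  qed
  also have "\<dots> = ennreal (c powr (s - 1)) * (\<integral>\<^sup>+u. ennreal (u powr (s - 1) * exp (- c * u)) * indicator {0<..} u \<partial>lborel)"
    by (rule nn_integral_cmult) simp
  also have "ennreal \<bar>c\<bar> * (ennreal (c powr (s - 1)) * (\<integral>\<^sup>+u. ennreal (u powr (s - 1) * exp (- c * u)) * indicator {0<..} u \<partial>lborel)) =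
     ennreal (c powr s) * (\<integral>\<^sup>+u. ennreal (u powr (s - 1) * exp (- c * u)) * indicator {0<..} u \<partial>lborel)"
    using c by (simp add: mult.assoc[symmetric] ennreal_mult''[symmetric] powr_diff)
  finally have *: "ennreal (Gamma s) = ennreal (c powr s) * (\<integral>\<^sup>+u. ennreal (u powr (s - 1) * exp (- c * u)) * indicator {0<..} u \<partial>lborel)" .
  have "ennreal (Gamma s / c powr s) = ennreal (1 / c powr s) * ennreal (Gamma s)"
    using c by (simp add: ennreal_mult''[symmetric] s less_imp_le)
  also have "\<dots> = ennreal (1 / c powr s * c powr s) * (\<integral>\<^sup>+u. ennreal (u powr (s - 1) * exp (- c * u)) * indicator {0<..} u \<partial>lborel)"
    unfolding * by (simp add: mult.assoc[symmetric] ennreal_mult''[symmetric])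
  finally show ?thesis using c by simp
qed

lemma bessel_term_scale:
  assumes u: "u > 0" and p: "p > 0"
  shows "bessel_term \<nu> (u * p) i =
    u powr (2 * real i + (\<nu> + 1/2)) * (p powr (\<nu> + 1/2) * 2 powr (-\<nu>) * ((p\<^sup>2 / 4) ^ i * bailey_coeff \<nu> i))"
proof -
  define e where "e = 2 * real i + \<nu>"
  have h1: "sqrt (u * p) = u powr (1/2) * p powr (1/2)"
    using u p by (simp add: real_sqrt_mult powr_half_sqrt)
  have h2: "((u * p) / 2) powr e = u powr e * p powr e * 2 powr (- e)"
    using u p by (simp add: powr_divide powr_mult powr_minus_divide)
  have "bessel_term \<nu> (u * p) i =
    (u powr (1/2) * u powr (2 * real i + \<nu>)) * (p powr (1/2) * p powr (2 * real i + \<nu>)) *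
     2 powr (- (2 * real i + \<nu>)) * bailey_coeff \<nu> i"
    unfolding bessel_term_def e_def[symmetric] h1 h2 by (simp only: mult_ac)
  also have "u powr (1/2) * u powr (2 * real i + \<nu>) = u powr (2 * real i + (\<nu> + 1/2))"
    by (simp add: powr_add[symmetric] add_ac)
  also have "p powr (1/2) * p powr (2 * real i + \<nu>) = p powr (\<nu> + 1/2) * p powr (real (2 * i))"
    by (simp add: powr_add[symmetric] add_ac)
  also have "p powr (real (2 * i)) = p\<^sup>2 ^ i" using p by (simp only: powr_realpow power_mult)
  also have "2 powr (- (2 * real i + \<nu>)) = 2 powr (-\<nu>) * inverse ((4::real) ^ i)"
  proof -
    have "- (2 * real i + \<nu>) = - \<nu> + - real (2 * i)" by simp
    then have "2 powr (- (2 * real i + \<nu>)) = 2 powr (-\<nu>) * 2 powr (- real (2 * i))" by (simp only: powr_add)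
    also have "2 powr (- real (2 * i)) = inverse ((2::real) ^ (2 * i))" by (simp only: powr_minus powr_realpow zero_less_numeral)
    also have "(2::real) ^ (2 * i) = 4 ^ i" by (simp only: power_mult) simp
    finally show ?thesis .
  qed
  finally have *: "bessel_term \<nu> (u * p) i =
    u powr (2 * real i + (\<nu> + 1/2)) * (p powr (\<nu> + 1/2) * p\<^sup>2 ^ i) * (2 powr (-\<nu>) * inverse (4 ^ i)) * bailey_coeff \<nu> i" .
  have **: "(p\<^sup>2 / 4) ^ i = p\<^sup>2 ^ i * inverse (4 ^ i)" by (simp add: power_divide field_simps)
  show ?thesis unfolding * ** by (simp only: mult.assoc mult.left_commute)
qed

text \<open>The Cauchy product of the two series: by the relations between x, y and p, q, the
  coefficient of each power of u is a value of \<open>bailey\<close>.\<close>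

lemma bessel_product_sums:
  assumes a: "a \<ge> -1/2" and b: "b \<ge> -1/2" and u: "u > 0" and p: "p > 0" and q: "q > 0"
    and xy: "x * y = p\<^sup>2" "(1 - x) * (1 - y) = q\<^sup>2"
  shows "(\<lambda>N. u powr (a + b + 1 + 2 * real N) *
      (p powr (a + 1/2) * q powr (b + 1/2) * 2 powr (-(a + b)) * ((1/4) ^ N * bailey a b N x y)))
    sums (bessel a (u * p) * bessel b (u * q))"
proof -
  have up: "u * p > 0" "u * q > 0" using u p q by auto
  have nn: "bessel_term a (u * p) i \<ge> 0" "bessel_term b (u * q) i \<ge> 0" for i
    using a b up by (auto intro!: bessel_term_nonneg)
  have "(\<lambda>N. \<Sum>i\<le>N. bessel_term a (u * p) i * bessel_term b (u * q) (N - i)) sums (bessel a (u * p) * bessel b (u * q))"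
    unfolding bessel_def
    by (rule Cauchy_product_sums) (use nn summable_bessel_term[OF a up(1)] summable_bessel_term[OF b up(2)] in auto)
  moreover have "(\<Sum>i\<le>N. bessel_term a (u * p) i * bessel_term b (u * q) (N - i)) =
    u powr (a + b + 1 + 2 * real N) *
      (p powr (a + 1/2) * q powr (b + 1/2) * 2 powr (-(a + b)) * ((1/4) ^ N * bailey a b N x y))" for N
  proof -
    have "bessel_term a (u * p) i * bessel_term b (u * q) (N - i) =
      u powr (a + b + 1 + 2 * real N) *
      (p powr (a + 1/2) * q powr (b + 1/2) * 2 powr (-(a + b)) * ((1/4) ^ N *
       (bailey_coeff a i * bailey_coeff b (N - i) * ((x * y) ^ i * ((1 - x) * (1 - y)) ^ (N - i)))))"
      if "i \<in> {..N}" for i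
    proof -
      have N: "real (N - i) = real N - real i" "(1/4::real) ^ N = (1/4) ^ i * (1/4) ^ (N - i)"
        using that by (auto simp: of_nat_diff power_add[symmetric])
      have "u powr (a + b + 1 + 2 * real N) = u powr (2 * real i + (a + 1/2)) * u powr (2 * real (N - i) + (b + 1/2))"
        by (simp add: powr_add[symmetric] N algebra_simps)
      moreover have "2 powr (-(a + b)) = 2 powr (-a) * (2 powr (-b) :: real)"
        by (simp add: powr_add[symmetric])
      ultimately show ?thesis
        unfolding bessel_term_scale[OF u p] bessel_term_scale[OF u q] xy N(2)
        by (simp add: power_divide mult_ac)
    qed
    then show ?thesis unfolding bailey_def sum_distrib_left by (intro sum.cong refl)
  qed
  ultimately show ?thesis by simp
qed

lemma bessel_measurable [measurable]: "bessel \<nu> \<in> borel_measurable borel"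
  unfolding bessel_def[abs_def] bessel_term_def by measurable

lemma bessel_nonneg:
  assumes "\<nu> \<ge> -1/2" "z > 0"
  shows "bessel \<nu> z \<ge> 0"
  unfolding bessel_def using assms by (intro suminf_nonneg summable_bessel_term bessel_term_nonneg) auto

text \<open>Termwise Laplace transform. In \<open>ennreal\<close> nonnegativity justifies the
  exchange of sum and integral; finiteness of both sides is read off later from a bound of the
  integral.\<close>

lemma nn_integral_bessel_product:
  assumes a: "a \<ge> -1/2" and b: "b \<ge> -1/2" and p: "p > 0" and q: "q > 0" and c: "c > 0"
    and ab: "a + b + 1 > 0"
    and xy: "x * y = p\<^sup>2" "(1 - x) * (1 - y) = q\<^sup>2" and x: "0 \<le> x" "x \<le> 1" and y: "0 \<le> y" "y \<le> 1"
  shows "(\<Sum>N. ennreal (4 * (p powr (a + 1/2) * q powr (b + 1/2)) *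
        (bailey_term a b x y N * (2 * c) powr (-(a + b + 2 + 2 * real N))))) =
    (\<integral>\<^sup>+u. ennreal (exp (- c * u) * (bessel a (u * p) * bessel b (u * q))) * indicator {0<..} u \<partial>lborel)"
proof -
  define T where "T N = p powr (a + 1/2) * q powr (b + 1/2) * 2 powr (-(a + b)) * ((1/4) ^ N * bailey a b N x y)" for N
  have Tnn: "T N \<ge> 0" for N unfolding T_def
    by (intro mult_nonneg_nonneg bailey_nonneg) (use assms in auto)
  have "(\<integral>\<^sup>+u. ennreal (exp (- c * u) * (bessel a (u * p) * bessel b (u * q))) * indicator {0<..} u \<partial>lborel) =
    (\<integral>\<^sup>+u. (\<Sum>N. ennreal (T N) * (ennreal (u powr ((a + b + 2 + 2 * real N) - 1) * exp (- c * u)) * indicator {0<..} u)) \<partial>lborel)"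
  proof (rule nn_integral_cong)
    fix u :: real
    show "ennreal (exp (- c * u) * (bessel a (u * p) * bessel b (u * q))) * indicator {0<..} u =
      (\<Sum>N. ennreal (T N) * (ennreal (u powr ((a + b + 2 + 2 * real N) - 1) * exp (- c * u)) * indicator {0<..} u))"
    proof (cases "u > 0")
      case True
      have "(\<lambda>N. u powr (a + b + 1 + 2 * real N) * T N) sums (bessel a (u * p) * bessel b (u * q))"
        unfolding T_def by (rule bessel_product_sums[OF a b True p q xy])
      then have "(\<lambda>N. exp (- c * u) * (u powr (a + b + 1 + 2 * real N) * T N)) sums
         (exp (- c * u) * (bessel a (u * p) * bessel b (u * q)))" by (rule sums_mult)
      then have "ennreal (exp (- c * u) * (bessel a (u * p) * bessel b (u * q))) =
        (\<Sum>N. ennreal (exp (- c * u) * (u powr (a + b + 1 + 2 * real N) * T N)))"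
        using Tnn by (intro suminf_ennreal_eq[symmetric]) auto
      also have "\<dots> = (\<Sum>N. ennreal (T N) * ennreal (u powr ((a + b + 2 + 2 * real N) - 1) * exp (- c * u)))"
      proof (intro suminf_cong)
        fix N
        have e: "a + b + 2 + 2 * real N - 1 = a + b + 1 + 2 * real N" by simp
        show "ennreal (exp (- c * u) * (u powr (a + b + 1 + 2 * real N) * T N)) =
           ennreal (T N) * ennreal (u powr ((a + b + 2 + 2 * real N) - 1) * exp (- c * u))"
          unfolding e ennreal_mult'[symmetric, OF Tnn] by (simp only: mult_ac)
      qed
      finally show ?thesis using True by simp
    qed simp
  qed
  also have "\<dots> = (\<Sum>N. \<integral>\<^sup>+u. ennreal (T N) * (ennreal (u powr ((a + b + 2 + 2 * real N) - 1) * exp (- c * u)) * indicator {0<..} u) \<partial>lborel)"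
    by (rule nn_integral_suminf) simp
  also have "\<dots> = (\<Sum>N. ennreal (4 * (p powr (a + 1/2) * q powr (b + 1/2)) *
        (bailey_term a b x y N * (2 * c) powr (-(a + b + 2 + 2 * real N)))))"
  proof (intro suminf_cong)
    fix N
    define s where "s = a + b + 2 + 2 * real N"
    have s: "s > 0" using ab by (simp add: s_def)
    have "(\<integral>\<^sup>+u. ennreal (T N) * (ennreal (u powr (s - 1) * exp (- c * u)) * indicator {0<..} u) \<partial>lborel) =
       ennreal (T N) * ennreal (Gamma s / c powr s)"
      by (subst nn_integral_cmult) (simp_all only: nn_integral_Gamma_scaled[OF s c], simp)
    also have "\<dots> = ennreal (T N * (Gamma s / c powr s))"
      using Tnn[of N] s by (intro ennreal_mult[symmetric]) auto
    also have "T N * (Gamma s / c powr s) = 4 * (p powr (a + 1/2) * q powr (b + 1/2)) *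
        (bailey_term a b x y N * (2 * c) powr (- s))"
    proof -
      have *: "4 * (2 * c) powr (- s) = 2 powr (-(a + b)) * (1/4) ^ N / c powr s"
      proof -
        have "(2 * c) powr (- s) = 2 powr (- s) / c powr s" using c by (simp add: powr_mult powr_minus_divide)
        also have "2 powr (- s) = 2 powr (-(a + b)) * 2 powr (- 2) * 2 powr (- real (2 * N))"
          unfolding s_def powr_add[symmetric] by (simp add: algebra_simps)
        also have "2 powr (- real (2 * N)) = (1/4 :: real) ^ N"
          by (simp only: powr_minus powr_realpow zero_less_numeral) (simp add: power_mult power_one_over inverse_eq_divide)
        also have "2 powr (- 2) = (1/4 :: real)" by (simp add: powr_minus powr_numeral)
        finally show ?thesis by simp
      qed
      define P B where "P = p powr (a + 1/2) * q powr (b + 1/2)" and "B = bailey_term a b x y N"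
      have "4 * P * (B * (2 * c) powr (- s)) = P * B * (4 * (2 * c) powr (- s))" by simp
      also have "\<dots> = P * B * (2 powr (-(a + b)) * (1/4) ^ N / c powr s)" by (simp only: *)
      also have "\<dots> = (P * 2 powr (-(a + b)) * ((1/4) ^ N * bailey a b N x y)) * (Gamma s / c powr s)"
        by (simp add: B_def bailey_term_def s_def)
      finally show ?thesis unfolding T_def P_def B_def by (rule sym)
    qed
    finally show "(\<integral>\<^sup>+u. ennreal (T N) * (ennreal (u powr ((a + b + 2 + 2 * real N) - 1) * exp (- c * u)) * indicator {0<..} u) \<partial>lborel) =
      ennreal (4 * (p powr (a + 1/2) * q powr (b + 1/2)) *
        (bailey_term a b x y N * (2 * c) powr (-(a + b + 2 + 2 * real N))))"
      unfolding s_def .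
  qed
  finally show ?thesis by (rule sym)
qed

text \<open>Half of the exponential decay pays for the power: 4 + 2w is at most (4 + 4M) (1 +
  w/(2M)), and the M-th power of exp (w/(2M)) is exp (w/2).\<close>

lemma linear_powr_le_exp:
  fixes M w :: real
  assumes M: "M > 0" and w: "w \<ge> 0"
  shows "(4 + 2 * w) powr M * exp (- w) \<le> (4 + 4 * M) powr M * exp (- w / 2)"
proof -
  have "4 + 2 * w \<le> (4 + 4 * M) * (1 + w / (2 * M))" using M w by (simp add: field_simps)
  also have "\<dots> \<le> (4 + 4 * M) * exp (w / (2 * M))"
    using M exp_ge_add_one_self[of "w / (2 * M)"] by (intro mult_left_mono) auto
  finally have "(4 + 2 * w) powr M \<le> ((4 + 4 * M) * exp (w / (2 * M))) powr M"
    using M w by (intro powr_mono2) auto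
  also have "\<dots> = (4 + 4 * M) powr M * exp (w / 2)"
    using M by (simp add: powr_mult exp_powr_real)
  finally have "(4 + 2 * w) powr M * exp (- w) \<le> (4 + 4 * M) powr M * exp (w / 2) * exp (- w)"
    by (intro mult_right_mono) auto
  also have "\<dots> = (4 + 4 * M) powr M * exp (- w / 2)"
    by (simp add: mult.assoc exp_add[symmetric] field_simps)
  finally show ?thesis .
qed

text \<open>324 is the square of the 18 in \<open>bessel_le\<close>, and h stands for the factor
  that depends on \<theta> and \<phi> only. The last factor gives decay for large A, that is, for
  large times.\<close>

definition bessel_bound :: "real \<Rightarrow> real \<Rightarrow> real \<Rightarrow> real \<Rightarrow> real" where
  "bessel_bound m k A h = 324 * h * (4 + 4 * (m + k)) powr (m + k) * (min 1 (4 / A)) powr k"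

text \<open>In the application \<open>p = sin (\<theta>/2) * sin (\<phi>/2)\<close> and \<open>S = (sin (\<theta>/2) + sin (\<phi>/2))\<^sup>2\<close>, similarly \<open>q\<close> and
  \<open>T\<close> with cosines, and \<open>e = 1 - p - q\<close>.  The hypothesis \<open>S \<le> 2 * e + 4 * p\<close> covers at once the cases
  of \<open>\<theta>\<close> and \<open>\<phi>\<close> close together and far apart.\<close>

lemma bessel_product_le:
  assumes m: "m \<ge> 0" and k: "k > 0" and a: "a \<ge> m - 1/2" and b: "b \<ge> k - 1/2"
    and p: "p > 0" and q: "q > 0" and e: "0 \<le> e" "e \<le> A" and A: "A > 0"
    and S: "S > 0" "S \<le> 2 * e + 4 * p" and T: "T > 0" "T \<le> 2 * e + 4 * q" "T \<le> 4" and u: "u > 0"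
  shows "exp (- (A + p + q) * u) * (bessel a (u * p) * bessel b (u * q)) \<le>
     bessel_bound m k A ((p / S) powr m * (q / T) powr k) * exp (- (A / 2) * u)"
proof -
  have w: "4 + 2 * (u * A) \<ge> 0" using u A by simp
  have eA: "u * e \<le> u * A" using u e by simp
  \<comment> \<open>In the product with 2e + 4p the minimum is estimated by u p next to e, but by 1
    next to p, so that both terms contain p.\<close>
  have min_le: "min 1 (u * p) \<le> (4 + 2 * (u * A)) * (p / S)" if "p > 0" "S > 0" "S \<le> 2 * e + 4 * p" for p S
  proof -
    have "min 1 (u * p) * S \<le> min 1 (u * p) * (2 * e + 4 * p)"
      using that u by (intro mult_left_mono) auto
    also have "\<dots> \<le> u * p * (2 * e) + 1 * (4 * p)"
      unfolding distrib_left using that u e by (intro add_mono mult_right_mono) auto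
    also have "\<dots> = p * (4 + 2 * (u * e))" by (simp add: algebra_simps)
    also have "\<dots> \<le> p * (4 + 2 * (u * A))" using eA that by (intro mult_left_mono) auto
    finally show ?thesis using that by (simp add: field_simps)
  qed
  have 1: "(min 1 (u * p)) powr m \<le> (4 + 2 * (u * A)) powr m * (p / S) powr m"
  proof -
    have "(min 1 (u * p)) powr m \<le> ((4 + 2 * (u * A)) * (p / S)) powr m"
      using min_le[OF p S] u p m by (intro powr_mono2) auto
    then show ?thesis using w p S by (simp add: powr_mult del: times_divide_eq_right)
  qed
  have 2: "(min 1 (u * q)) powr k \<le> (4 + 2 * (u * A)) powr k * (q / T) powr k * (min 1 (4 / A)) powr k"
  proof -
    \<comment> \<open>A second bound of the same minimum, better for A > 4: T <= 4 inserts the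
      factor 4/T, and u A <= 4 + 2 u A pays for 1/A. Its power k > 0 becomes the decay in
      time.\<close>
    have "min 1 (u * q) \<le> (4 + 2 * (u * A)) * (q / T) * (4 / A)"
    proof -
      have "min 1 (u * q) \<le> u * q" by simp
      also have "\<dots> \<le> u * q * (4 / T)" using T u q by (simp add: field_simps)
      also have "\<dots> = (u * A) * (q / T) * (4 / A)" using A by simp
      also have "\<dots> \<le> (4 + 2 * (u * A)) * (q / T) * (4 / A)"
        using u A q T by (intro mult_right_mono) auto
      finally show ?thesis .
    qed
    then have "min 1 (u * q) \<le> (4 + 2 * (u * A)) * (q / T) * min 1 (4 / A)"
      using min_le[OF q T(1,2)] by (cases "1 \<le> 4 / A") (simp_all only: min_absorb1 min_absorb2 mult_1_right linear not_le less_imp_le)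
    then have "(min 1 (u * q)) powr k \<le> ((4 + 2 * (u * A)) * (q / T) * min 1 (4 / A)) powr k"
      using u q k by (intro powr_mono2) auto
    then show ?thesis using w q T A by (simp add: powr_mult del: times_divide_eq_right)
  qed
  have a': "a \<ge> -1/2" and b': "b \<ge> -1/2" using a b m k by auto
  have B1: "bessel a (u * p) \<le> 18 * exp (u * p) * (min 1 (u * p)) powr m"
    using bessel_le[OF m a] u p by simp
  have B2: "bessel b (u * q) \<le> 18 * exp (u * q) * (min 1 (u * q)) powr k"
    using bessel_le[OF less_imp_le[OF k] b] u q by simp
  have "bessel a (u * p) * bessel b (u * q) \<le>
     (18 * exp (u * p) * (min 1 (u * p)) powr m) * (18 * exp (u * q) * (min 1 (u * q)) powr k)"
    by (intro mult_mono B1 B2 bessel_nonneg a' b') (use u p q in auto)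
  also have "\<dots> \<le> (18 * exp (u * p) * ((4 + 2 * (u * A)) powr m * (p / S) powr m)) *
     (18 * exp (u * q) * ((4 + 2 * (u * A)) powr k * (q / T) powr k * (min 1 (4 / A)) powr k))"
    by (intro mult_mono mult_left_mono 1 2) auto
  also have "\<dots> = exp (u * p) * exp (u * q) * (324 * ((p / S) powr m * (q / T) powr k) * (min 1 (4 / A)) powr k
      * ((4 + 2 * (u * A)) powr m * (4 + 2 * (u * A)) powr k))" by simp
  also have "(4 + 2 * (u * A)) powr m * (4 + 2 * (u * A)) powr k = (4 + 2 * (u * A)) powr (m + k)"
    by (simp add: powr_add)
  finally have "exp (- (A + p + q) * u) * (bessel a (u * p) * bessel b (u * q)) \<le>
    exp (- (A + p + q) * u) * (exp (u * p) * exp (u * q) * (324 * ((p / S) powr m * (q / T) powr k) * (min 1 (4 / A)) powr k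
      * (4 + 2 * (u * A)) powr (m + k)))"
    by (intro mult_left_mono) auto
  also have "\<dots> = (324 * ((p / S) powr m * (q / T) powr k) * (min 1 (4 / A)) powr k) *
     ((4 + 2 * (u * A)) powr (m + k) * exp (- (u * A)))"
  proof -
    have "exp (- (A + p + q) * u) * (exp (u * p) * exp (u * q)) = exp (- (u * A))"
      by (simp add: exp_add[symmetric] algebra_simps)
    then show ?thesis by (simp add: mult_ac)
  qed
  also have "\<dots> \<le> (324 * ((p / S) powr m * (q / T) powr k) * (min 1 (4 / A)) powr k) *
     ((4 + 4 * (m + k)) powr (m + k) * exp (- (u * A) / 2))"
    using m k u A by (intro mult_left_mono linear_powr_le_exp) auto
  also have "\<dots> = bessel_bound m k A ((p / S) powr m * (q / T) powr k) * exp (- (A / 2) * u)"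
    by (simp add: bessel_bound_def mult_ac)
  finally show ?thesis .
qed

text \<open>The Laplace integral is bounded by \<open>bessel_product_le\<close>. As all terms of the
  series are nonnegative, this yields convergence together with the estimate.\<close>

lemma bailey_series_le:
  assumes m: "m \<ge> 0" and k: "k > 0" and a: "a \<ge> m - 1/2" and b: "b \<ge> k - 1/2"
    and p: "p > 0" and q: "q > 0" and e: "0 \<le> e" "e \<le> c - p - q" and A: "c - p - q > 0"
    and S: "S > 0" "S \<le> 2 * e + 4 * p" and T: "T > 0" "T \<le> 2 * e + 4 * q" "T \<le> 4"
    and xy: "x * y = p\<^sup>2" "(1 - x) * (1 - y) = q\<^sup>2" and x: "0 \<le> x" "x \<le> 1" and y: "0 \<le> y" "y \<le> 1"
  shows "summable (\<lambda>N. bailey_term a b x y N * (2 * c) powr (-(a + b + 2 + 2 * real N)))"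
    and "4 * (p powr (a + 1/2) * q powr (b + 1/2)) * (\<Sum>N. bailey_term a b x y N * (2 * c) powr (-(a + b + 2 + 2 * real N)))
      \<le> bessel_bound m k (c - p - q) ((p / S) powr m * (q / T) powr k) * (2 / (c - p - q))"
    and "(\<Sum>N. bailey_term a b x y N * (2 * c) powr (-(a + b + 2 + 2 * real N))) \<ge> 0"
proof -
  define A where "A = c - p - q"
  define h where "h = (p / S) powr m * (q / T) powr k"
  define P where "P = 4 * (p powr (a + 1/2) * q powr (b + 1/2))"
  define t where "t N = bailey_term a b x y N * (2 * c) powr (-(a + b + 2 + 2 * real N))" for N
  have Apos: "A > 0" using A by (simp add: A_def)
  have a': "a \<ge> -1/2" and b': "b \<ge> -1/2" and ab: "a + b + 1 > 0" using a b m k by auto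
  have c: "c > 0" using A p q by simp
  have Ppos: "P > 0" using p q by (simp add: P_def)
  have tnn: "t N \<ge> 0" for N
  proof -
    have "Gamma (a + b + 2 + 2 * real N) > 0" using ab by simp
    then show ?thesis using bailey_nonneg[OF _ _ x y, of a b N] a' b'
      by (simp add: t_def bailey_term_def)
  qed
  have bb: "bessel_bound m k A h \<ge> 0" by (simp add: bessel_bound_def h_def)
  have "(\<Sum>N. ennreal (P * t N)) =
    (\<integral>\<^sup>+u. ennreal (exp (- c * u) * (bessel a (u * p) * bessel b (u * q))) * indicator {0<..} u \<partial>lborel)"
    unfolding P_def t_def by (rule nn_integral_bessel_product[OF a' b' p q c ab xy x y])
  also have "\<dots> \<le> (\<integral>\<^sup>+u. ennreal (bessel_bound m k A h) * (ennreal (u powr (1 - 1) * exp (- (A / 2) * u)) * indicator {0<..} u) \<partial>lborel)"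
  proof (rule nn_integral_mono)
    fix u :: real
    show "ennreal (exp (- c * u) * (bessel a (u * p) * bessel b (u * q))) * indicator {0<..} u \<le>
      ennreal (bessel_bound m k A h) * (ennreal (u powr (1 - 1) * exp (- (A / 2) * u)) * indicator {0<..} u)"
    proof (cases "u > 0")
      case True
      have "c = A + p + q" by (simp add: A_def)
      then have "exp (- c * u) * (bessel a (u * p) * bessel b (u * q)) \<le> bessel_bound m k A h * exp (- (A / 2) * u)"
        unfolding h_def
        using bessel_product_le[OF m k a b p q e(1) _ _ S T True, of A] e(2) A by (simp add: A_def)
      then show ?thesis using True bb by (simp add: ennreal_mult[symmetric] ennreal_leI)
    qed simp
  qed
  also have "\<dots> = ennreal (bessel_bound m k A h) * ennreal (Gamma 1 / (A / 2) powr 1)"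
    by (subst nn_integral_cmult) (simp_all only: nn_integral_Gamma_scaled[of 1 "A / 2", OF zero_less_one half_gt_zero[OF Apos]], simp)
  also have "\<dots> = ennreal (bessel_bound m k A h * (2 / A))"
    using Apos bb by (simp add: ennreal_mult[symmetric])
  finally have le: "(\<Sum>N. ennreal (P * t N)) \<le> ennreal (bessel_bound m k A h * (2 / A))" .
  have part: "(\<Sum>N<n. P * t N) \<le> bessel_bound m k A h * (2 / A)" for n
  proof -
    have "ennreal (\<Sum>N<n. P * t N) = (\<Sum>N<n. ennreal (P * t N))"
      using Ppos tnn by (intro sum_ennreal[symmetric]) auto
    also have "\<dots> \<le> (\<Sum>N. ennreal (P * t N))" by (intro sum_le_suminf) auto
    finally have "ennreal (\<Sum>N<n. P * t N) \<le> ennreal (bessel_bound m k A h * (2 / A))" using le by simp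
    then show ?thesis using bb Apos by (subst (asm) ennreal_le_iff) auto
  qed
  have sm: "summable (\<lambda>N. P * t N)"
    by (rule summableI_nonneg_bounded[OF _ part]) (use Ppos tnn in auto)
  then have smt: "summable t" using Ppos by (simp add: summable_cmult_iff)
  then show "summable (\<lambda>N. bailey_term a b x y N * (2 * c) powr (-(a + b + 2 + 2 * real N)))"
    by (simp add: t_def[abs_def])
  show "(\<Sum>N. bailey_term a b x y N * (2 * c) powr (-(a + b + 2 + 2 * real N))) \<ge> 0"
    using suminf_nonneg[OF smt tnn] by (simp add: t_def)
  have "P * suminf t \<le> bessel_bound m k A h * (2 / A)"
    unfolding suminf_mult[OF smt, symmetric] by (rule suminf_le_const[OF sm part])
  then show "4 * (p powr (a + 1/2) * q powr (b + 1/2)) * (\<Sum>N. bailey_term a b x y N * (2 * c) powr (-(a + b + 2 + 2 * real N)))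
      \<le> bessel_bound m k (c - p - q) ((p / S) powr m * (q / T) powr k) * (2 / (c - p - q))"
    by (simp add: P_def t_def[abs_def] h_def A_def)
qed

text \<open>With z = 1/(2c)^2 the condition on z reads c > p + q: exp (-c u) beats the growth exp
  ((p + q) u) of the Bessel product.\<close>

lemma summable_bailey_term:
  assumes a: "a \<ge> -1/2" and b: "b > -1/2"
    and p: "p > 0" and q: "q > 0" and pq: "q \<le> 1"
    and xy: "x * y = p\<^sup>2" "(1 - x) * (1 - y) = q\<^sup>2" and x: "0 \<le> x" "x \<le> 1" and y: "0 \<le> y" "y \<le> 1"
    and z: "0 \<le> z" "z < 1 / (4 * (p + q)\<^sup>2)"
  shows "summable (\<lambda>N. bailey_term a b x y N * z ^ N)"
proof (cases "z = 0")
  case False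
  then have z0: "z > 0" using z by simp
  define c where "c = 1 / (2 * sqrt z)"
  have c0: "c > 0" using z0 by (simp add: c_def)
  have cz: "(2 * c)\<^sup>2 = 1 / z" using z0 by (simp add: c_def power_divide)
  have pq2: "(2 * (p + q))\<^sup>2 = 4 * (p + q)\<^sup>2" by (simp only: power_mult_distrib) simp
  have "4 * (p + q)\<^sup>2 > 0" using p q by simp
  then have "z * (2 * (p + q))\<^sup>2 < 1" using z(2) unfolding pq2 by (simp only: pos_less_divide_eq)
  then have "(2 * (p + q))\<^sup>2 < (2 * c)\<^sup>2" using z0 unfolding cz by (simp add: field_simps)
  then have "2 * (p + q) < 2 * c" by (rule power_less_imp_less_base) (use c0 in simp)
  then have cpq: "p + q < c" by simp
  have "summable (\<lambda>N. bailey_term a b x y N * (2 * c) powr (-(a + b + 2 + 2 * real N)))"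
    \<comment> \<open>Only convergence matters here: with e = 0, S = 4p and T = 4q the upper bounds
      on S and T by e, p and q are equalities, and q <= 1 gives T <= 4.\<close>
    by (rule bailey_series_le(1)[where m=0 and k="b+1/2" and e=0 and S="4*p" and T="4*q" and p=p and q=q])
       (use assms cpq in auto)
  moreover have "(2 * c) powr (-(a + b + 2 + 2 * real N)) = (2 * c) powr (-(a + b + 2)) * z ^ N" for N
  proof -
    have "(2 * c) powr (-(a + b + 2 + 2 * real N)) = (2 * c) powr (-(a + b + 2)) * (2 * c) powr (- real (2 * N))"
      unfolding powr_add[symmetric] by simp
    also have "(2 * c) powr (- real (2 * N)) = inverse (((2 * c)\<^sup>2) ^ N)"
    proof -
      have "(2 * c) powr real (2 * N) = (2 * c) ^ (2 * N)" using c0 by (intro powr_realpow) simp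
      then show ?thesis by (simp only: powr_minus power_mult)
    qed
    also have "\<dots> = z ^ N" unfolding cz by (simp add: power_one_over inverse_eq_divide)
    finally show ?thesis .
  qed
  ultimately have "summable (\<lambda>N. (2 * c) powr (-(a + b + 2)) * (bailey_term a b x y N * z ^ N))"
    by (simp add: mult_ac)
  then show ?thesis using c0 by (subst (asm) summable_cmult_iff) auto
next
  case True
  have "summable (\<lambda>N. if N = 0 then bailey_term a b x y 0 else 0)" by simp
  also have "(\<lambda>N. if N = 0 then bailey_term a b x y 0 else 0) = (\<lambda>N. bailey_term a b x y N * z ^ N)"
    using True by (auto simp: fun_eq_iff)
  finally show ?thesis .
qed

section \<open>The kernel of the fractional integral\<close>

lemma jordan_sin:
  fixes y :: real
  assumes "0 \<le> y" "y \<le> pi / 2"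
  shows "2 * y / pi \<le> sin y"
proof -
  have c: "concave_on {0..pi/2} (sin :: real \<Rightarrow> real)"
    by (rule f''_le0_imp_concave[where f' = cos and f'' = "\<lambda>x. - sin x"])
       (auto intro!: derivative_eq_intros sin_ge_zero)
  have "(1 - 2 * y / pi) * sin 0 + (2 * y / pi) * sin (pi / 2) \<le> sin ((1 - 2 * y / pi) *\<^sub>R 0 + (2 * y / pi) *\<^sub>R (pi / 2))"
    by (rule concave_onD[OF c]) (use assms in \<open>auto simp: field_simps\<close>)
  then show ?thesis by simp
qed

lemma cosh_ge_quadratic: "cosh y \<ge> 1 + y\<^sup>2 / 2" for y :: real
proof -
  let ?f = "\<lambda>n. if even n then y ^ n /\<^sub>R fact n else 0"
  have s: "?f sums cosh y" by (rule cosh_converges)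
  have nn: "?f n \<ge> 0" for n by (auto simp: zero_le_even_power)
  have "sum ?f {..<3} \<le> suminf ?f"
    by (rule sum_le_suminf) (use s nn in \<open>auto simp: sums_iff\<close>)
  also have "suminf ?f = cosh y" using s by (rule sums_unique[symmetric])
  finally show ?thesis by (simp add: numeral_3_eq_3 power2_eq_square)
qed

lemma sinh_le_double:
  fixes y :: real
  assumes "0 \<le> y" "y \<le> 1/2"
  shows "sinh y \<le> 2 * y"
proof -
  have "exp y \<le> 1 + y + y\<^sup>2" by (rule exp_bound) (use assms in auto)
  moreover have "exp (- y) \<ge> 1 - y" using exp_ge_add_one_self[of "-y"] by simp
  moreover have "y\<^sup>2 \<le> y * (1/2)" unfolding power2_eq_square using assms by (intro mult_left_mono) auto
  ultimately show ?thesis using assms by (simp add: sinh_def)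
qed

text \<open>The left-hand side is twice the square of sin (d/4), and Jordan's inequality with pi < 4
  gives sin (d/4) >= d/8.\<close>

lemma one_minus_cos_half_ge:
  fixes d :: real
  assumes "0 \<le> d" "d \<le> pi"
  shows "1 - cos (d / 2) \<ge> d\<^sup>2 / 32"
proof -
  have "d / 8 \<le> 2 * (d / 4) / pi"
    using mult_left_mono[of pi 4 d] pi_less_4 pi_gt_zero assms by (simp add: field_simps)
  also have "\<dots> \<le> sin (d / 4)" using assms by (intro jordan_sin) auto
  finally have "(d / 8)\<^sup>2 \<le> (sin (d / 4))\<^sup>2" using assms by (intro power_mono) auto
  moreover have "1 - cos (d / 2) = 2 * (sin (d / 4))\<^sup>2"
    using cos_double_sin[of "d / 4"] by simp
  ultimately show ?thesis by (simp add: power2_eq_square)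
qed

text \<open>The time-dependent factor in the bound of the Poisson kernel. For e = 1 - cos ((\<theta>
  - \<phi>)/2) the recurring denominator is cosh (t/2) - p - q, the A of
  \<open>bessel_bound\<close>.\<close>

definition time_weight :: "real \<Rightarrow> real \<Rightarrow> real \<Rightarrow> real" where
  "time_weight k e t = sinh (t / 2) / (cosh (t / 2) - 1 + e) * (min 1 (4 / (cosh (t / 2) - 1 + e))) powr k"

text \<open>For small times the bound is the Poisson kernel of a half-plane, with d the distance of
  \<theta> and \<phi>.\<close>

lemma time_weight_small:
  assumes k: "k > 0" and d: "0 < d" and e: "e \<ge> d\<^sup>2 / 32" and t: "0 < t" "t \<le> 1"
  shows "time_weight k e t \<le> 32 * t / (t\<^sup>2 + d\<^sup>2)"
proof -
  let ?A = "cosh (t / 2) - 1 + e"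
  have A: "?A \<ge> (t\<^sup>2 + d\<^sup>2) / 32"
  proof -
    have "1 + t\<^sup>2 / 4 / 2 \<le> cosh (t / 2)" using cosh_ge_quadratic[of "t / 2"] by (simp only: power_divide) simp
    moreover have "(X + D) / 32 \<le> c - 1 + e" if "1 + X / 4 / 2 \<le> c" "D / 32 \<le> e" "0 \<le> X" for X D c e :: real
      using that by (simp add: field_simps)
    ultimately show ?thesis using e zero_le_power2 by blast
  qed
  have pos: "(t\<^sup>2 + d\<^sup>2) / 32 > 0" using t d by (simp add: add_pos_pos)
  have s: "sinh (t / 2) \<le> t" using sinh_le_double[of "t / 2"] t by simp
  have A0: "?A > 0" using A pos by linarith
  have "(min 1 (4 / ?A)) powr k \<le> 1 powr k" using A0 k by (intro powr_mono2) auto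
  then have "time_weight k e t \<le> sinh (t / 2) / ?A * 1"
    unfolding time_weight_def using A0 t by (intro mult_left_mono) auto
  also have "\<dots> \<le> t / ((t\<^sup>2 + d\<^sup>2) / 32)" using s A pos t by (simp only: mult_1_right) (intro frac_le, auto)
  finally show ?thesis by (simp add: mult.commute)
qed

text \<open>For t >= 1 the first quotient is bounded, and the decay comes from the last factor
  alone, hence the rate k/2.\<close>

lemma time_weight_large:
  assumes k: "k > 0" and e: "e \<ge> 0" and t: "1 \<le> t"
  shows "time_weight k e t \<le> 10 * 80 powr k * exp (- (k / 2) * t)"
proof -
  let ?A = "cosh (t / 2) - 1 + e"
  define E where "E = exp (t / 2)"
  have "E \<ge> 1 + t / 2" unfolding E_def by (rule exp_ge_add_one_self)
  then have E: "E \<ge> 3/2" using t by simp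
  have "cosh (t / 2) = (E + 1 / E) / 2" by (simp add: cosh_def E_def exp_minus inverse_eq_divide)
  moreover have "(E + 1 / E) / 2 - 1 \<ge> E / 20"
  proof -
    \<comment> \<open>What has to be shown is 9/20 E^2 - E + 1/2 >= 0; lowering 1/2 to 39/80 makes
      3/2 a root, so that the quadratic factors.\<close>
    have "0 \<le> (E - 3/2) * (9/20 * E - 13/40)" using E by (intro mult_nonneg_nonneg) auto
    also have "(E - 3/2) * (9/20 * E - 13/40) = 9/20 * (E * E) - E + 39/80" by (simp add: field_simps)
    finally have *: "0 \<le> 9/20 * (E * E) - E + 39/80" .
    have "X + 20 * E \<le> 10 * (X + 1)" if "0 \<le> 9/20 * X - E + 39/80" for X :: real
      using that by (simp add: field_simps)
    from this[OF *] have "E * E + 20 * E \<le> 10 * (E * E + 1)" .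
    then show ?thesis using E by (simp add: field_simps)
  qed
  ultimately have A: "?A \<ge> E / 20" using e by linarith
  have A0: "?A > 0" using A E by linarith
  have s: "0 \<le> sinh (t / 2)" "sinh (t / 2) \<le> E / 2" using t by (auto simp: sinh_def E_def)
  have "sinh (t / 2) / ?A \<le> (E / 2) / (E / 20)" using s A E by (intro frac_le) auto
  then have 1: "sinh (t / 2) / ?A \<le> 10" using E by simp
  have "min 1 (4 / ?A) \<le> 4 / (E / 20)"
    using A E A0 by (intro min.coboundedI2 frac_le) auto
  then have "(min 1 (4 / ?A)) powr k \<le> (4 / (E / 20)) powr k" using A0 k by (intro powr_mono2) auto
  also have "4 / (E / 20) = 80 * exp (- (t / 2))" by (simp add: E_def exp_minus field_simps)
  also have "(80 * exp (- (t / 2))) powr k = 80 powr k * exp (- (k / 2) * t)"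
    by (simp add: powr_mult exp_powr_real mult.commute)
  finally have 2: "(min 1 (4 / ?A)) powr k \<le> 80 powr k * exp (- (k / 2) * t)" .
  have "time_weight k e t \<le> 10 * (80 powr k * exp (- (k / 2) * t))"
    unfolding time_weight_def using 1 2 s A0 by (intro mult_mono) auto
  then show ?thesis by simp
qed

lemma nn_integral_powr_tail:
  fixes d \<sigma> :: real
  assumes d: "d > 0" and s: "\<sigma> < 1"
  shows "(\<integral>\<^sup>+t. ennreal (t powr (\<sigma> - 2)) * indicator {d..} t \<partial>lborel) = ennreal (d powr (\<sigma> - 1) / (1 - \<sigma>))"
proof -
  have "(\<integral>\<^sup>+t. ennreal (t powr (\<sigma> - 2)) * indicator {d..} t \<partial>lborel) =
     0 - (d powr (\<sigma> - 1) / (\<sigma> - 1))"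
  proof (rule nn_integral_FTC_atLeast[where F = "\<lambda>t. t powr (\<sigma> - 1) / (\<sigma> - 1)"])
    show "((\<lambda>t. t powr (\<sigma> - 1) / (\<sigma> - 1)) has_real_derivative t powr (\<sigma> - 2)) (at t)" if "d \<le> t" for t
    proof -
      have "((\<lambda>t. t powr (\<sigma> - 1)) has_real_derivative (\<sigma> - 1) * t powr (\<sigma> - 1 - 1)) (at t)"
        using that d by (intro has_real_derivative_powr) auto
      from DERIV_cdivide[OF this, of "\<sigma> - 1"] show ?thesis using s by simp
    qed
    show "((\<lambda>t. t powr (\<sigma> - 1) / (\<sigma> - 1)) \<longlongrightarrow> 0) at_top"
      using s by real_asymp
  qed (use d in auto)
  also have "0 - (d powr (\<sigma> - 1) / (\<sigma> - 1)) = d powr (\<sigma> - 1) / (1 - \<sigma>)" using s by (simp add: field_simps)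
  finally show ?thesis .
qed

text \<open>A Poisson kernel of width d is about t/d^2 below d and 1/t above d, so its integral
  against t^(\<sigma> - 1) scales like d^(\<sigma> - 1), the tail converging because \<sigma> < 1.
  The contribution of t > 1 is a constant, which is absorbed because d < 4.\<close>

lemma nn_integral_time_weight:
  assumes s: "0 < \<sigma>" "\<sigma> < 1" and k: "k > 0" and d: "0 < d" "d < pi" and e: "e \<ge> d\<^sup>2 / 32"
  shows "(\<integral>\<^sup>+t. ennreal (t powr (\<sigma> - 1) * time_weight k e t) * indicator {0<..} t \<partial>lborel) \<le>
     ennreal ((32 + 32 / (1 - \<sigma>) + 80 * 80 powr k / k) * d powr (\<sigma> - 1))"
proof -
  have e0: "e \<ge> 0" using e by (rule order_trans[rotated]) simp
  let ?f1 = "\<lambda>t. ennreal (32 * d powr (\<sigma> - 2)) * indicator {0..d} t"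
  let ?f2 = "\<lambda>t. ennreal 32 * (ennreal (t powr (\<sigma> - 2)) * indicator {d..} t)"
  let ?f3 = "\<lambda>t. ennreal (10 * 80 powr k) * (ennreal (t powr (1 - 1) * exp (- (k / 2) * t)) * indicator {0<..} t)"
  have "(\<integral>\<^sup>+t. ennreal (t powr (\<sigma> - 1) * time_weight k e t) * indicator {0<..} t \<partial>lborel) \<le>
    (\<integral>\<^sup>+t. (?f1 t + ?f2 t) + ?f3 t \<partial>lborel)"
  proof (rule nn_integral_mono)
    fix t :: real
    show "ennreal (t powr (\<sigma> - 1) * time_weight k e t) * indicator {0<..} t \<le> (?f1 t + ?f2 t) + ?f3 t"
    proof (cases "t > 0")
      case t0: True
      have "ennreal (t powr (\<sigma> - 1) * time_weight k e t) \<le> (?f1 t + ?f2 t) + ?f3 t"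
      proof (cases "t \<le> 1")
        case True
        have tw: "time_weight k e t \<le> 32 * t / (t\<^sup>2 + d\<^sup>2)" by (rule time_weight_small[OF k d(1) e t0 True])
        have pt: "t powr (\<sigma> - 1) * t = t powr \<sigma>" using t0 powr_add[of t "\<sigma> - 1" 1] by simp
        show ?thesis
        proof (cases "t \<le> d")
          case True
          have "32 * t / (t\<^sup>2 + d\<^sup>2) \<le> 32 * t / d\<^sup>2" using t0 d by (intro divide_left_mono) (auto simp: pos_add_strict)
          then have "t powr (\<sigma> - 1) * time_weight k e t \<le> t powr (\<sigma> - 1) * (32 * t / d\<^sup>2)"
            using tw by (intro mult_left_mono) auto
          also have "\<dots> = 32 * (t powr \<sigma> / d\<^sup>2)" using pt by simp
          also have "\<dots> \<le> 32 * (d powr \<sigma> / d\<^sup>2)"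
            using True t0 s by (intro mult_left_mono divide_right_mono powr_mono2) auto
          also have "d powr \<sigma> / d\<^sup>2 = d powr (\<sigma> - 2)" using d by (simp add: powr_diff powr_numeral)
          finally have "ennreal (t powr (\<sigma> - 1) * time_weight k e t) \<le> ?f1 t"
            using True t0 by (simp add: ennreal_leI)
          then show ?thesis by (meson add_increasing2 zero_le)
        next
          case False
          have "32 * t / (t\<^sup>2 + d\<^sup>2) \<le> 32 * t / t\<^sup>2" using t0 d by (intro divide_left_mono) (auto simp: pos_add_strict)
          then have "t powr (\<sigma> - 1) * time_weight k e t \<le> t powr (\<sigma> - 1) * (32 * t / t\<^sup>2)"
            using tw by (intro mult_left_mono) auto
          also have "\<dots> = 32 * (t powr \<sigma> / t\<^sup>2)" using pt by simp
          also have "t powr \<sigma> / t\<^sup>2 = t powr (\<sigma> - 2)" using t0 by (simp add: powr_diff powr_numeral)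
          finally have "ennreal (t powr (\<sigma> - 1) * time_weight k e t) \<le> ?f2 t"
            using False t0 by (simp add: ennreal_leI ennreal_mult[symmetric] del: ennreal_numeral)
          then show ?thesis by (meson add_increasing add_increasing2 zero_le)
        qed
      next
        case False
        then have t1: "t \<ge> 1" by simp
        have "t powr (\<sigma> - 1) \<le> t powr 0" using t1 s by (intro powr_mono) auto
        then have "t powr (\<sigma> - 1) \<le> 1" using t1 by simp
        moreover have "time_weight k e t \<ge> 0"
          unfolding time_weight_def using e0 t0 cosh_real_ge_1[of "t/2"] by simp
        ultimately have "t powr (\<sigma> - 1) * time_weight k e t \<le> 1 * (10 * 80 powr k * exp (- (k / 2) * t))"
          using time_weight_large[OF k e0 t1] by (intro mult_mono) auto
        then have "ennreal (t powr (\<sigma> - 1) * time_weight k e t) \<le> ennreal (10 * 80 powr k * exp (- (k / 2) * t))"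
          by (intro ennreal_leI) simp
        also have "\<dots> = ?f3 t" using t0 by (subst ennreal_mult) auto
        finally show ?thesis by (meson add_increasing zero_le)
      qed
      then show ?thesis using t0 by simp
    qed simp
  qed
  also have "\<dots> = (\<integral>\<^sup>+t. ?f1 t \<partial>lborel) + (\<integral>\<^sup>+t. ?f2 t \<partial>lborel) + (\<integral>\<^sup>+t. ?f3 t \<partial>lborel)"
    by (simp add: nn_integral_add)
  also have "(\<integral>\<^sup>+t. ?f1 t \<partial>lborel) = ennreal (32 * d powr (\<sigma> - 1))"
  proof -
    have "d powr (\<sigma> - 1) = d powr (\<sigma> - 2) * d"
      using powr_add[of d "\<sigma> - 2" 1] d by simp
    then show ?thesis using d by (simp add: nn_integral_cmult_indicator ennreal_mult[symmetric] mult.assoc)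
  qed
  also have "(\<integral>\<^sup>+t. ?f2 t \<partial>lborel) = ennreal (32 * (d powr (\<sigma> - 1) / (1 - \<sigma>)))"
  proof -
    have "(\<integral>\<^sup>+t. ?f2 t \<partial>lborel) = ennreal 32 * ennreal (d powr (\<sigma> - 1) / (1 - \<sigma>))"
      by (subst nn_integral_cmult) (simp, simp only: nn_integral_powr_tail[OF d(1) s(2)])
    also have "\<dots> = ennreal (32 * (d powr (\<sigma> - 1) / (1 - \<sigma>)))" using s by (intro ennreal_mult[symmetric]) auto
    finally show ?thesis .
  qed
  also have "(\<integral>\<^sup>+t. ?f3 t \<partial>lborel) = ennreal (10 * 80 powr k * (2 / k))"
  proof -
    have "(\<integral>\<^sup>+t. ?f3 t \<partial>lborel) = ennreal (10 * 80 powr k) * ennreal (Gamma 1 / (k / 2) powr 1)"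
      by (subst nn_integral_cmult) (simp, simp only: nn_integral_Gamma_scaled[OF zero_less_one half_gt_zero[OF k]])
    then show ?thesis using k by (simp add: ennreal_mult[symmetric])
  qed
  also have "ennreal (32 * d powr (\<sigma> - 1)) + ennreal (32 * (d powr (\<sigma> - 1) / (1 - \<sigma>))) + ennreal (10 * 80 powr k * (2 / k)) =
     ennreal (32 * d powr (\<sigma> - 1) + 32 * (d powr (\<sigma> - 1) / (1 - \<sigma>)) + 10 * 80 powr k * (2 / k))"
    using s k by (subst ennreal_plus[symmetric]; simp)+
  also have "\<dots> \<le> ennreal ((32 + 32 / (1 - \<sigma>) + 80 * 80 powr k / k) * d powr (\<sigma> - 1))"
  proof (rule ennreal_leI)
    have "1 \<le> 4 * d powr (\<sigma> - 1)"
    proof -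
      have "4 powr (-1) \<le> (4::real) powr (\<sigma> - 1)" using s by (intro powr_mono) auto
      also have "\<dots> \<le> d powr (\<sigma> - 1)" using s d pi_less_4 by (intro powr_mono2') auto
      finally show ?thesis by (simp add: powr_minus)
    qed
    then have "10 * 80 powr k * (2 / k) * 1 \<le> 10 * 80 powr k * (2 / k) * (4 * d powr (\<sigma> - 1))"
      using k by (intro mult_left_mono) auto
    then show "32 * d powr (\<sigma> - 1) + 32 * (d powr (\<sigma> - 1) / (1 - \<sigma>)) + 10 * 80 powr k * (2 / k) \<le>
      (32 + 32 / (1 - \<sigma>) + 80 * 80 powr k / k) * d powr (\<sigma> - 1)"
      by (simp add: algebra_simps)
  qed
  finally show ?thesis .
qed

section \<open>From the Poisson series to the fractional kernel\<close>

lemma jacobi_fun_eq: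
  assumes "0 < \<theta>" "\<theta> < pi"
  shows "jacobi_fun n a b \<theta> = jacobi_d n a b * poly (jacobi_poly n a b) ((sin (\<theta> / 2))\<^sup>2)"
proof -
  have "-1 < cos \<theta>" "cos \<theta> < 1"
    using assms cos_monotone_0_pi[of \<theta> pi] cos_monotone_0_pi[of 0 \<theta>] by auto
  moreover have "(1 - cos \<theta>) / 2 = (sin (\<theta> / 2))\<^sup>2"
    using cos_double_sin[of "\<theta> / 2"] by simp
  ultimately show ?thesis by (simp add: jacobi_fun_def jacobi_P_eq_poly)
qed

lemma jacobi_d_square:
  assumes "a > -1" "b > -1" "a + b + 1 > 0"
  shows "jacobi_d n a b * jacobi_d n a b = jacobi_coeff n a b"
proof -
  have "jacobi_d n a b = sqrt (jacobi_coeff n a b)"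
    using Gamma_fact[of n, where 'a=real] by (simp add: jacobi_d_def jacobi_coeff_def add.commute)
  then show ?thesis using jacobi_coeff_nonneg[OF assms, of n] by simp
qed

lemma cos_half_diff_less_1:
  assumes "0 < \<theta>" "\<theta> < pi" "0 < \<phi>" "\<phi> < pi" "\<theta> \<noteq> \<phi>"
  shows "cos ((\<theta> - \<phi>) / 2) < 1"
proof -
  have "cos \<bar>(\<theta> - \<phi>) / 2\<bar> < cos 0"
  proof (rule cos_monotone_0_pi)
    show "\<bar>(\<theta> - \<phi>) / 2\<bar> \<le> pi" unfolding abs_le_iff using assms by (simp add: field_simps)
  qed (use assms in auto)
  then show ?thesis by (simp only: cos_abs_real cos_zero)
qed

text \<open>With r = exp (-t) and h = exp (-t/2) one has 1 + r = 2 cosh (t/2) h and 1 - r = 2 sinh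
  (t/2) h. So r/(1 + r)^2 is the inverse square of 2 cosh (t/2), and the powers of h cancel against
  exp (-t (a + b + 1)/2). Off the diagonal p + q < 1, which gives the radius beyond 1/4 that
  \<open>jacobi_series_eq\<close> asks for.\<close>

lemma poisson_series_eq:
  assumes a: "a \<ge> -1/2" and b: "b > -1/2" and th: "0 < \<theta>" "\<theta> < pi" and ph: "0 < \<phi>" "\<phi> < pi" and ne: "\<theta> \<noteq> \<phi>"
    and t: "t > 0"
  shows "(\<Sum>n. exp (- t * \<bar>real n + (a + b + 1) / 2\<bar>) * jacobi_fun n a b \<theta> * jacobi_fun n a b \<phi>) =
    2 * sinh (t / 2) * (\<Sum>N. bailey_term a b ((sin (\<theta> / 2))\<^sup>2) ((sin (\<phi> / 2))\<^sup>2) N *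
        (2 * cosh (t / 2)) powr (-(a + b + 2 + 2 * real N)))"
proof -
  define x y where "x = (sin (\<theta> / 2))\<^sup>2" and "y = (sin (\<phi> / 2))\<^sup>2"
  define p q where "p = sin (\<theta> / 2) * sin (\<phi> / 2)" and "q = cos (\<theta> / 2) * cos (\<phi> / 2)"
  have ab: "a + b + 1 > 0" using a b by linarith
  have sc: "0 < sin (\<theta> / 2)" "0 < sin (\<phi> / 2)" "0 < cos (\<theta> / 2)" "0 < cos (\<phi> / 2)"
    using th ph by (auto intro!: sin_gt_zero cos_gt_zero)
  have pq: "p > 0" "q > 0" using sc by (auto simp: p_def q_def)
  have pqc: "p + q = cos ((\<theta> - \<phi>) / 2)"
    by (simp add: p_def q_def cos_diff diff_divide_distrib)
  have pq1: "p + q < 1" unfolding pqc by (rule cos_half_diff_less_1[OF th ph ne])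
  have xy: "x * y = p\<^sup>2" "(1 - x) * (1 - y) = q\<^sup>2"
    by (simp_all add: x_def y_def p_def q_def power_mult_distrib cos_squared_eq)
  have x: "0 \<le> x" "x \<le> 1" and y: "0 \<le> y" "y \<le> 1"
    by (simp_all add: x_def y_def abs_square_le_1)
  define r where "r = exp (- t)"
  have r: "0 < r" "r < 1" using t by (auto simp: r_def)
  define c where "c = cosh (t / 2)"
  have c0: "c > 0" by (simp add: c_def)
  define h where "h = exp (- (t / 2))"
  have h: "h > 0" by (simp add: h_def)
  have hr: "r = h * h" by (simp add: r_def h_def exp_add[symmetric])
  have ch: "2 * c = exp (t / 2) + h" by (simp add: c_def cosh_def h_def)
  have sh: "2 * sinh (t / 2) = exp (t / 2) - h" by (simp add: sinh_def h_def)
  have eh: "exp (t / 2) * h = 1" by (simp add: h_def exp_add[symmetric])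
  have eh': "h * exp (t / 2) = 1" using eh by (simp only: mult.commute)
  have r1: "1 + r = 2 * c * h" "1 - r = 2 * sinh (t / 2) * h"
    unfolding ch sh by (simp_all add: hr algebra_simps eh eh')
  have rc: "r / (1 + r)\<^sup>2 = inverse ((2 * c)\<^sup>2)"
    unfolding r1 using h c0 by (simp add: hr power2_eq_square field_simps)
  have "(\<lambda>n. jacobi_coeff n a b * (poly (jacobi_poly n a b) x * poly (jacobi_poly n a b) y) * r ^ n) sums
    ((1 - r) * (1 + r) powr (-(a + b + 2)) * (\<Sum>N. bailey_term a b x y N * (r / (1 + r)\<^sup>2) ^ N))"
  proof (rule jacobi_series_eq[where Z="1 / (4 * (p + q)\<^sup>2)"])
    have "(p + q)\<^sup>2 < 1" using pq pq1 by (simp add: power_less_one_iff abs_square_less_1)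
    then show "1 / 4 < 1 / (4 * (p + q)\<^sup>2)" using pq by (simp add: field_simps)
    show "summable (\<lambda>N. bailey_term a b x y N * z ^ N)" if "0 \<le> z" "z < 1 / (4 * (p + q)\<^sup>2)" for z
      by (rule summable_bailey_term[OF a b pq(1) pq(2) _ xy x y that]) (use pq pq1 in simp)
  qed (use a b ab x y r in auto)
  then have "(\<lambda>n. exp (- t * ((a + b + 1) / 2)) * (jacobi_coeff n a b * (poly (jacobi_poly n a b) x * poly (jacobi_poly n a b) y) * r ^ n)) sums
    (exp (- t * ((a + b + 1) / 2)) * ((1 - r) * (1 + r) powr (-(a + b + 2)) * (\<Sum>N. bailey_term a b x y N * (r / (1 + r)\<^sup>2) ^ N)))"
    by (rule sums_mult)
  moreover have "exp (- t * ((a + b + 1) / 2)) * (jacobi_coeff n a b * (poly (jacobi_poly n a b) x * poly (jacobi_poly n a b) y) * r ^ n) =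
     exp (- t * \<bar>real n + (a + b + 1) / 2\<bar>) * jacobi_fun n a b \<theta> * jacobi_fun n a b \<phi>" for n
  proof -
    have "r ^ n = exp (- t * real n)" by (simp add: r_def exp_of_nat_mult[symmetric] mult.commute)
    moreover have "\<bar>real n + (a + b + 1) / 2\<bar> = real n + (a + b + 1) / 2" using ab by simp
    moreover have "exp (- t * (real n + (a + b + 1) / 2)) = exp (- t * real n) * exp (- t * ((a + b + 1) / 2))"
      by (simp only: distrib_left exp_add)
    moreover have "jacobi_coeff n a b = jacobi_d n a b * jacobi_d n a b"
      by (rule jacobi_d_square[symmetric]) (use a b ab in auto)
    ultimately show ?thesis
      unfolding jacobi_fun_eq[OF th] jacobi_fun_eq[OF ph] x_def y_def by (simp only: mult_ac)
  qed
  ultimately have "(\<Sum>n. exp (- t * \<bar>real n + (a + b + 1) / 2\<bar>) * jacobi_fun n a b \<theta> * jacobi_fun n a b \<phi>) =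
     exp (- t * ((a + b + 1) / 2)) * ((1 - r) * (1 + r) powr (-(a + b + 2)) * (\<Sum>N. bailey_term a b x y N * (r / (1 + r)\<^sup>2) ^ N))"
    by (simp add: sums_iff)
  also have "\<dots> = 2 * sinh (t / 2) * ((2 * c) powr (-(a + b + 2)) * (\<Sum>N. bailey_term a b x y N * (r / (1 + r)\<^sup>2) ^ N))"
  proof -
    have "(1 + r) powr (-(a + b + 2)) = (2 * c) powr (-(a + b + 2)) * h powr (-(a + b + 2))"
      unfolding r1 by (rule powr_mult)
    moreover have "exp (- t * ((a + b + 1) / 2)) * (h * h powr (-(a + b + 2))) = 1"
    proof -
      have "h powr (-(a + b + 2)) = exp (- (a + b + 2) * (- (t / 2)))"
        by (simp add: h_def exp_powr_real mult.commute)
      then show ?thesis by (simp add: h_def exp_add[symmetric] field_simps)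
    qed
    moreover have "exp (- t * ((a + b + 1) / 2)) * ((2 * sinh (t / 2) * h) * ((2 * c) powr (-(a + b + 2)) * h powr (-(a + b + 2))) * X) =
       2 * sinh (t / 2) * ((2 * c) powr (-(a + b + 2)) * X) * (exp (- t * ((a + b + 1) / 2)) * (h * h powr (-(a + b + 2))))" for X
      by (simp only: mult_ac)
    ultimately show ?thesis unfolding r1(2) by (simp only: mult_1_right)
  qed
  also have "(2 * c) powr (-(a + b + 2)) * (\<Sum>N. bailey_term a b x y N * (r / (1 + r)\<^sup>2) ^ N) =
     (\<Sum>N. bailey_term a b x y N * (2 * c) powr (-(a + b + 2 + 2 * real N)))"
  proof -
    have e: "bailey_term a b x y N * (2 * c) powr (-(a + b + 2 + 2 * real N)) =
       (2 * c) powr (-(a + b + 2)) * (bailey_term a b x y N * (r / (1 + r)\<^sup>2) ^ N)" for N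
    proof -
      have "(2 * c) powr (-(a + b + 2 + 2 * real N)) = (2 * c) powr (-(a + b + 2)) * (2 * c) powr (- real (2 * N))"
        unfolding powr_add[symmetric] by simp
      also have "(2 * c) powr (- real (2 * N)) = inverse (((2 * c)\<^sup>2) ^ N)"
      proof -
        have "(2 * c) powr real (2 * N) = (2 * c) ^ (2 * N)" using c0 by (intro powr_realpow) simp
        then show ?thesis by (simp only: powr_minus power_mult)
      qed
      also have "\<dots> = (r / (1 + r)\<^sup>2) ^ N" by (simp only: rc power_inverse)
      finally show ?thesis by (simp only: mult_ac)
    qed
    have "r / (1 + r)\<^sup>2 < 1 / (4 * (p + q)\<^sup>2)"
    proof -
      have "4 * (p + q)\<^sup>2 < 4 * 1" using pq pq1 by (simp add: power_less_one_iff abs_square_less_1)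
      moreover have "4 * r \<le> (1 + r)\<^sup>2" using sum_squares_bound[of 1 r] by (simp add: power2_eq_square algebra_simps)
      ultimately have "r * (4 * (p + q)\<^sup>2) < (1 + r)\<^sup>2"
        using r mult_strict_left_mono[of "4 * (p + q)\<^sup>2" 4 r] by linarith
      then show ?thesis using pq r by (simp add: divide_simps mult.commute)
    qed
    then have "summable (\<lambda>N. bailey_term a b x y N * (r / (1 + r)\<^sup>2) ^ N)"
      by (intro summable_bailey_term[OF a b pq(1) pq(2) _ xy x y]) (use pq pq1 r in auto)
    then show ?thesis unfolding e by (rule suminf_mult[symmetric])
  qed
  finally show ?thesis unfolding x_def y_def c_def .
qed

text \<open>For \<alpha>, \<beta> >= -1/2, multiplying by |\<theta> - \<phi>|^(\<sigma> - 1) gives,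
  up to constants, |\<theta> - \<phi>|^\<sigma> divided by the measure of the interval of radius
  |\<theta> - \<phi>| around \<theta>: the size of a Riesz potential kernel.\<close>

definition endpoint_factor :: "real \<Rightarrow> real \<Rightarrow> real \<Rightarrow> real \<Rightarrow> real" where
  "endpoint_factor \<alpha> \<beta> \<theta> \<phi> = (sin (\<theta> / 2) + sin (\<phi> / 2)) powr (-(2 * \<alpha> + 1)) *
     (cos (\<theta> / 2) + cos (\<phi> / 2)) powr (-(2 * \<beta> + 1))"

definition poisson_const :: "real \<Rightarrow> real \<Rightarrow> real" where
  "poisson_const \<alpha> \<beta> = 324 * (4 + 4 * (\<alpha> + \<beta> + 1)) powr (\<alpha> + \<beta> + 1)"

text \<open>The bound of the series contains p^(a + 1/2) q^(b + 1/2) on its left-hand side. The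
  transplantation factors account for p^(a - \<alpha>) q^(b - \<beta>), and the rest cancels against
  the same powers in the Bessel bound, which is used with m = \<alpha> + 1/2 and k = \<beta> + 1/2.
  So a and b disappear from the right-hand side.\<close>

lemma poisson_series_le:
  assumes al: "\<alpha> \<ge> -1/2" and be: "\<beta> > -1/2" and a: "a \<ge> \<alpha>" and b: "b \<ge> \<beta>"
    and th: "0 < \<theta>" "\<theta> < pi" and ph: "0 < \<phi>" "\<phi> < pi" and ne: "\<theta> \<noteq> \<phi>" and t: "t > 0"
  defines "P \<equiv> (\<Sum>n. exp (- t * \<bar>real n + (a + b + 1) / 2\<bar>) * jacobi_fun n a b \<theta> * jacobi_fun n a b \<phi>)"
  shows "0 \<le> P"
    and "(sin (\<theta> / 2) * sin (\<phi> / 2)) powr (a - \<alpha>) * (cos (\<theta> / 2) * cos (\<phi> / 2)) powr (b - \<beta>) * P \<le>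
      poisson_const \<alpha> \<beta> * endpoint_factor \<alpha> \<beta> \<theta> \<phi> * time_weight (\<beta> + 1/2) (1 - cos ((\<theta> - \<phi>) / 2)) t"
proof -
  define s1 s2 c1 c2 where "s1 = sin (\<theta> / 2)" and "s2 = sin (\<phi> / 2)" and "c1 = cos (\<theta> / 2)" and "c2 = cos (\<phi> / 2)"
  have sc: "0 < s1" "0 < s2" "0 < c1" "0 < c2"
    using th ph by (auto intro!: sin_gt_zero cos_gt_zero simp: s1_def s2_def c1_def c2_def)
  have sq: "s1\<^sup>2 + c1\<^sup>2 = 1" "s2\<^sup>2 + c2\<^sup>2 = 1" by (simp_all add: s1_def s2_def c1_def c2_def)
  define p q e c where "p = s1 * s2" and "q = c1 * c2" and "e = 1 - p - q" and "c = cosh (t / 2)"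
  have pq: "p > 0" "q > 0" using sc by (auto simp: p_def q_def)
  have ecos: "1 - cos ((\<theta> - \<phi>) / 2) = e"
    by (simp add: e_def p_def q_def s1_def s2_def c1_def c2_def cos_diff diff_divide_distrib)
  have e: "e > 0" using cos_half_diff_less_1[OF th ph ne] ecos by simp
  have c1': "c > 1" using cosh_ge_quadratic[of "t/2"] t unfolding c_def
    by (smt (verit) divide_pos_pos zero_less_power)
  define A where "A = c - p - q"
  have A: "A > 0" "e \<le> A" using e c1' by (auto simp: A_def e_def)
  have Aeq: "A = cosh (t / 2) - 1 + e" by (simp add: A_def e_def c_def)
  define S T where "S = (s1 + s2)\<^sup>2" and "T = (c1 + c2)\<^sup>2"
  \<comment> \<open>The squared chord between two points of the unit circle. Each summand alone is
    at most 2e, which gives the hypotheses on S and T.\<close>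
  have sd: "(s1 - s2)\<^sup>2 + (c1 - c2)\<^sup>2 = 2 * e"
    using sq by (simp add: e_def p_def q_def power2_eq_square algebra_simps)
  have S: "S > 0" "S \<le> 2 * e + 4 * p"
  proof -
    have "S = (s1 - s2)\<^sup>2 + 4 * p" by (simp add: S_def p_def power2_eq_square algebra_simps)
    moreover have "(s1 - s2)\<^sup>2 \<le> 2 * e" using sd zero_le_power2[of "c1 - c2"] by linarith
    ultimately show "S \<le> 2 * e + 4 * p" by simp
    show "S > 0" using sc by (simp add: S_def)
  qed
  have T: "T > 0" "T \<le> 2 * e + 4 * q" "T \<le> 4"
  proof -
    have "T = (c1 - c2)\<^sup>2 + 4 * q" by (simp add: T_def q_def power2_eq_square algebra_simps)
    moreover have "(c1 - c2)\<^sup>2 \<le> 2 * e" using sd zero_le_power2[of "s1 - s2"] by linarith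
    ultimately show "T \<le> 2 * e + 4 * q" by simp
    show "T > 0" using sc by (simp add: T_def)
    have "c1 + c2 \<le> 2" unfolding c1_def c2_def using add_mono[OF cos_le_one[of "\<theta> / 2"] cos_le_one[of "\<phi> / 2"]] by simp
    then have "T \<le> 2\<^sup>2" unfolding T_def using sc by (intro power_mono) auto
    then show "T \<le> 4" by simp
  qed
  have xy: "s1\<^sup>2 * s2\<^sup>2 = p\<^sup>2" "(1 - s1\<^sup>2) * (1 - s2\<^sup>2) = q\<^sup>2"
  proof -
    have "1 - s1\<^sup>2 = c1\<^sup>2" "1 - s2\<^sup>2 = c2\<^sup>2" using sq by (simp_all add: algebra_simps)
    then show "s1\<^sup>2 * s2\<^sup>2 = p\<^sup>2" "(1 - s1\<^sup>2) * (1 - s2\<^sup>2) = q\<^sup>2" by (simp_all add: p_def q_def power_mult_distrib)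
  qed
  have x: "0 \<le> s1\<^sup>2" "s1\<^sup>2 \<le> 1" and y: "0 \<le> s2\<^sup>2" "s2\<^sup>2 \<le> 1" by (simp_all add: s1_def s2_def abs_square_le_1)
  define F where "F = (\<Sum>N. bailey_term a b (s1\<^sup>2) (s2\<^sup>2) N * (2 * c) powr (-(a + b + 2 + 2 * real N)))"
  have m: "\<alpha> + 1/2 \<ge> 0" and k: "\<beta> + 1/2 > 0" using al be by auto
  have ak: "a \<ge> \<alpha> + 1/2 - 1/2" "b \<ge> \<beta> + 1/2 - 1/2" using a b by auto
  note bs = bailey_series_le[OF m k ak pq less_imp_le[OF e] A(2)[unfolded A_def] A(1)[unfolded A_def] S T xy x y]
  have F0: "F \<ge> 0" unfolding F_def by (rule bs(3))
  define H where "H = (p / S) powr (\<alpha> + 1/2) * (q / T) powr (\<beta> + 1/2)"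
  have FB: "4 * (p powr (a + 1/2) * q powr (b + 1/2)) * F \<le> bessel_bound (\<alpha> + 1/2) (\<beta> + 1/2) A H * (2 / A)"
    unfolding F_def H_def A_def by (rule bs(2))
  have Peq: "P = 2 * sinh (t / 2) * F"
    unfolding P_def F_def s1_def s2_def c_def
    by (rule poisson_series_eq) (use al be a b th ph ne t in auto)
  show "0 \<le> P" unfolding Peq using F0 t by simp
  have pp: "p powr (a + 1/2) = p powr (\<alpha> + 1/2) * p powr (a - \<alpha>)" "q powr (b + 1/2) = q powr (\<beta> + 1/2) * q powr (b - \<beta>)"
    by (simp_all only: powr_add[symmetric]) (simp_all add: add.commute)
  define X where "X = p powr (a - \<alpha>) * q powr (b - \<beta>)"
  define Y where "Y = p powr (\<alpha> + 1/2) * q powr (\<beta> + 1/2)"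
  have Y0: "Y > 0" using pq by (simp add: Y_def)
  have HY: "H = Y * endpoint_factor \<alpha> \<beta> \<theta> \<phi>"
  proof -
    have 1: "S powr (\<alpha> + 1/2) = (s1 + s2) powr (2 * \<alpha> + 1)"
      using sc unfolding S_def by (subst powr_numeral[symmetric], simp, subst powr_powr, simp add: algebra_simps)
    have 2: "T powr (\<beta> + 1/2) = (c1 + c2) powr (2 * \<beta> + 1)"
      using sc unfolding T_def by (subst powr_numeral[symmetric], simp, subst powr_powr, simp add: algebra_simps)
    have "H = Y * (1 / S powr (\<alpha> + 1/2) * (1 / T powr (\<beta> + 1/2)))"
      using pq S T by (simp add: H_def Y_def powr_divide)
    also have "1 / S powr (\<alpha> + 1/2) * (1 / T powr (\<beta> + 1/2)) = endpoint_factor \<alpha> \<beta> \<theta> \<phi>"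
      unfolding endpoint_factor_def s1_def[symmetric] s2_def[symmetric] c1_def[symmetric] c2_def[symmetric] powr_minus_divide 1 2 ..
    finally show ?thesis .
  qed
  have "Y * (X * P) = (sinh (t / 2) / 2) * (4 * (p powr (a + 1/2) * q powr (b + 1/2)) * F)"
    unfolding Peq pp X_def Y_def by simp
  also have "\<dots> \<le> (sinh (t / 2) / 2) * (bessel_bound (\<alpha> + 1/2) (\<beta> + 1/2) A H * (2 / A))"
    using t by (intro mult_left_mono FB) auto
  also have "\<dots> = H * (poisson_const \<alpha> \<beta> * time_weight (\<beta> + 1/2) e t)"
  proof -
    have m: "\<alpha> + 1/2 + (\<beta> + 1/2) = \<alpha> + \<beta> + 1" by simp
    show ?thesis unfolding bessel_bound_def time_weight_def poisson_const_def m Aeq[symmetric] by simp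
  qed
  also have "\<dots> = Y * (poisson_const \<alpha> \<beta> * endpoint_factor \<alpha> \<beta> \<theta> \<phi> * time_weight (\<beta> + 1/2) e t)"
    unfolding HY by simp
  finally have "X * P \<le> poisson_const \<alpha> \<beta> * endpoint_factor \<alpha> \<beta> \<theta> \<phi> * time_weight (\<beta> + 1/2) e t"
    using Y0 by simp
  then show "(sin (\<theta> / 2) * sin (\<phi> / 2)) powr (a - \<alpha>) * (cos (\<theta> / 2) * cos (\<phi> / 2)) powr (b - \<beta>) * P \<le>
      poisson_const \<alpha> \<beta> * endpoint_factor \<alpha> \<beta> \<theta> \<phi> * time_weight (\<beta> + 1/2) (1 - cos ((\<theta> - \<phi>) / 2)) t"
    by (simp only: X_def p_def q_def s1_def s2_def c1_def c2_def ecos)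
qed

text \<open>A non-integrable f is covered because its Bochner integral is 0. Kernels can thus be
  estimated before their defining integrals are known to converge.\<close>

lemma norm_integral_le_nn_integral:
  fixes f :: "'a \<Rightarrow> 'b :: {banach, second_countable_topology}"
  shows "ennreal (norm (integral\<^sup>L M f)) \<le> (\<integral>\<^sup>+x. ennreal (norm (f x)) \<partial>M)"
proof (cases "integrable M f")
  case True
  then show ?thesis by (rule integral_norm_bound_ennreal)
next
  case False
  then show ?thesis by (simp add: not_integrable_integral_eq)
qed

definition kernel_const :: "real \<Rightarrow> real \<Rightarrow> real \<Rightarrow> real" where
  "kernel_const \<sigma> \<alpha> \<beta> = poisson_const \<alpha> \<beta> *
     (32 + 32 / (1 - \<sigma>) + 80 * 80 powr (\<beta> + 1/2) / (\<beta> + 1/2)) / Gamma \<sigma>"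

lemma jacobi_kernel_le:
  assumes s: "0 < \<sigma>" "\<sigma> < 1" and al: "\<alpha> \<ge> -1/2" and be: "\<beta> > -1/2" and a: "a \<ge> \<alpha>" and b: "b \<ge> \<beta>"
    and th: "0 < \<theta>" "\<theta> < pi" and ph: "0 < \<phi>" "\<phi> < pi" and ne: "\<theta> \<noteq> \<phi>"
  shows "(sin (\<theta> / 2) * sin (\<phi> / 2)) powr (a - \<alpha>) * (cos (\<theta> / 2) * cos (\<phi> / 2)) powr (b - \<beta>) *
       \<bar>jacobi_kernel \<sigma> a b \<theta> \<phi>\<bar> \<le>
      kernel_const \<sigma> \<alpha> \<beta> * (\<bar>\<theta> - \<phi>\<bar> powr (\<sigma> - 1) * endpoint_factor \<alpha> \<beta> \<theta> \<phi>)"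
proof -
  define X where "X = (sin (\<theta> / 2) * sin (\<phi> / 2)) powr (a - \<alpha>) * (cos (\<theta> / 2) * cos (\<phi> / 2)) powr (b - \<beta>)"
  define P where "P t = (\<Sum>n. exp (- t * \<bar>real n + (a + b + 1) / 2\<bar>) * jacobi_fun n a b \<theta> * jacobi_fun n a b \<phi>)" for t
  define d where "d = \<bar>\<theta> - \<phi>\<bar>"
  define e where "e = 1 - cos ((\<theta> - \<phi>) / 2)"
  define C where "C = poisson_const \<alpha> \<beta> * endpoint_factor \<alpha> \<beta> \<theta> \<phi>"
  define D where "D = (32 + 32 / (1 - \<sigma>) + 80 * 80 powr (\<beta> + 1/2) / (\<beta> + 1/2)) * d powr (\<sigma> - 1)"
  have X0: "X \<ge> 0" by (simp add: X_def)
  have C0: "C \<ge> 0" by (simp add: C_def poisson_const_def endpoint_factor_def)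
  have D0: "D \<ge> 0" using s be by (simp add: D_def)
  have d: "0 < d" "d < pi" using th ph ne by (auto simp: d_def)
  have "cos (d / 2) = cos ((\<theta> - \<phi>) / 2)"
  proof -
    have "cos (d / 2) = cos \<bar>(\<theta> - \<phi>) / 2\<bar>" by (simp add: d_def)
    then show ?thesis by (simp only: cos_abs_real)
  qed
  then have e: "e \<ge> d\<^sup>2 / 32" using one_minus_cos_half_ge[of d] d by (simp add: e_def)
  have k: "\<beta> + 1/2 > 0" using be by simp
  have G: "Gamma \<sigma> > 0" using s by simp
  have PP: "0 \<le> P t" "X * P t \<le> C * time_weight (\<beta> + 1/2) e t" if "t > 0" for t
    unfolding P_def X_def C_def e_def
    by (rule poisson_series_le[OF al be a b th ph ne that])+
  define I where "I = (LINT t:{0<..}|lborel. P t / t powr (1 - \<sigma>))"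
  have Keq: "jacobi_kernel \<sigma> a b \<theta> \<phi> = 1 / Gamma \<sigma> * I"
    by (simp only: jacobi_kernel_def I_def P_def)
  have "ennreal (X * \<bar>I\<bar>) = ennreal X * ennreal (norm I)"
    using X0 by (simp add: ennreal_mult)
  also have "\<dots> \<le> ennreal X * (\<integral>\<^sup>+t. ennreal (norm (indicator {0<..} t *\<^sub>R (P t / t powr (1 - \<sigma>)))) \<partial>lborel)"
    unfolding I_def set_lebesgue_integral_def
    by (intro mult_left_mono norm_integral_le_nn_integral) simp
  also have "\<dots> \<le> ennreal C * (\<integral>\<^sup>+t. ennreal (t powr (\<sigma> - 1) * time_weight (\<beta> + 1/2) e t) * indicator {0<..} t \<partial>lborel)"
  proof -
    have [measurable]: "P \<in> borel_measurable borel" unfolding P_def by measurable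
    have [measurable]: "time_weight (\<beta> + 1/2) e \<in> borel_measurable borel"
      unfolding time_weight_def[abs_def] sinh_def cosh_def by measurable
    have "ennreal X * (\<integral>\<^sup>+t. ennreal (norm (indicator {0<..} t *\<^sub>R (P t / t powr (1 - \<sigma>)))) \<partial>lborel) =
      (\<integral>\<^sup>+t. ennreal X * ennreal (norm (indicator {0<..} t *\<^sub>R (P t / t powr (1 - \<sigma>)))) \<partial>lborel)"
      by (rule nn_integral_cmult[symmetric]) measurable
    also have "\<dots> \<le> (\<integral>\<^sup>+t. ennreal C * (ennreal (t powr (\<sigma> - 1) * time_weight (\<beta> + 1/2) e t) * indicator {0<..} t) \<partial>lborel)"
    proof (rule nn_integral_mono)
      fix t :: real
      show "ennreal X * ennreal (norm (indicator {0<..} t *\<^sub>R (P t / t powr (1 - \<sigma>)))) \<le>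
        ennreal C * (ennreal (t powr (\<sigma> - 1) * time_weight (\<beta> + 1/2) e t) * indicator {0<..} t)"
      proof (cases "t > 0")
        case True
        have pw: "t powr (\<sigma> - 1) = 1 / t powr (1 - \<sigma>)"
          using powr_minus_divide[of t "1 - \<sigma>"] by simp
        have "X * (P t / t powr (1 - \<sigma>)) = (X * P t) * t powr (\<sigma> - 1)" by (simp add: pw)
        also have "\<dots> \<le> (C * time_weight (\<beta> + 1/2) e t) * t powr (\<sigma> - 1)"
          by (intro mult_right_mono PP(2) True) simp
        finally have "X * (P t / t powr (1 - \<sigma>)) \<le> C * (t powr (\<sigma> - 1) * time_weight (\<beta> + 1/2) e t)"
          by (simp add: mult_ac)
        then have "ennreal (X * (P t / t powr (1 - \<sigma>))) \<le> ennreal (C * (t powr (\<sigma> - 1) * time_weight (\<beta> + 1/2) e t))"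
          by (rule ennreal_leI)
        moreover have "ennreal X * ennreal (norm (indicator {0<..} t *\<^sub>R (P t / t powr (1 - \<sigma>)))) = ennreal (X * (P t / t powr (1 - \<sigma>)))"
          using True PP(1)[OF True] X0 by (subst ennreal_mult) auto
        moreover have "ennreal C * (ennreal (t powr (\<sigma> - 1) * time_weight (\<beta> + 1/2) e t) * indicator {0<..} t) =
           ennreal (C * (t powr (\<sigma> - 1) * time_weight (\<beta> + 1/2) e t))"
          unfolding ennreal_mult'[OF C0] using True by simp
        ultimately show ?thesis by (simp only:)
      qed simp
    qed
    also have "\<dots> = ennreal C * (\<integral>\<^sup>+t. ennreal (t powr (\<sigma> - 1) * time_weight (\<beta> + 1/2) e t) * indicator {0<..} t \<partial>lborel)"
      by (rule nn_integral_cmult) measurable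
    finally show ?thesis .
  qed
  also have "\<dots> \<le> ennreal C * ennreal D"
    unfolding D_def by (intro mult_left_mono nn_integral_time_weight s k d e) simp
  finally have "ennreal (X * \<bar>I\<bar>) \<le> ennreal (C * D)" using C0 D0 by (simp add: ennreal_mult)
  then have "X * \<bar>I\<bar> \<le> C * D" using C0 D0 by (subst (asm) ennreal_le_iff) auto
  then have "X * \<bar>I\<bar> / Gamma \<sigma> \<le> C * D / Gamma \<sigma>" using G by (intro divide_right_mono) auto
  moreover have "X * \<bar>jacobi_kernel \<sigma> a b \<theta> \<phi>\<bar> = X * \<bar>I\<bar> / Gamma \<sigma>"
    unfolding Keq using G by (simp add: abs_mult)
  moreover have "C * D / Gamma \<sigma> = kernel_const \<sigma> \<alpha> \<beta> * (\<bar>\<theta> - \<phi>\<bar> powr (\<sigma> - 1) * endpoint_factor \<alpha> \<beta> \<theta> \<phi>)"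
    by (simp add: C_def D_def kernel_const_def d_def)
  ultimately show ?thesis unfolding X_def by simp
qed

section \<open>The Schur test\<close>

lemma nn_integral_powr_from_0:
  fixes g r :: real
  assumes g: "g < 1" and r: "r \<ge> 0"
  shows "(\<integral>\<^sup>+y. ennreal (y powr (- g)) * indicator {0..r} y \<partial>lborel) = ennreal (r powr (1 - g) / (1 - g))"
proof -
  have "((\<lambda>y. y powr (- g)) has_integral (r powr (- g + 1) / (- g + 1))) {0..r}"
    by (rule has_integral_powr_from_0) (use g r in auto)
  then have "integral\<^sup>N lborel (\<lambda>y. indicator {0..r} y * (y powr (- g))) = ennreal (r powr (- g + 1) / (- g + 1))"
    by (intro nn_integral_has_integral_lebesgue) auto
  moreover have "integral\<^sup>N lborel (\<lambda>y. indicator {0..r} y * (y powr (- g))) =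
     (\<integral>\<^sup>+y. ennreal (y powr (- g)) * indicator {0..r} y \<partial>lborel)"
    by (intro nn_integral_cong) (auto simp: indicator_def)
  ultimately show ?thesis by (simp add: add.commute)
qed

lemma nn_integral_powr_centered:
  fixes g r x :: real
  assumes g: "g < 1" and r: "r \<ge> 0"
  shows "(\<integral>\<^sup>+y. ennreal (\<bar>x - y\<bar> powr (- g)) * indicator {x - r..x + r} y \<partial>lborel) \<le> ennreal (2 * (r powr (1 - g) / (1 - g)))"
proof -
  let ?f = "\<lambda>y. ennreal (y powr (- g)) * indicator {0..r} y"
  have "(\<integral>\<^sup>+y. ennreal (\<bar>x - y\<bar> powr (- g)) * indicator {x - r..x + r} y \<partial>lborel) \<le>
    (\<integral>\<^sup>+y. ?f (x + (- 1) * y) + ?f (- x + 1 * y) \<partial>lborel)"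
    by (intro nn_integral_mono) (auto simp: indicator_def abs_if)
  also have "\<dots> = (\<integral>\<^sup>+y. ?f (x + (- 1) * y) \<partial>lborel) + (\<integral>\<^sup>+y. ?f (- x + 1 * y) \<partial>lborel)"
    by (intro nn_integral_add) measurable
  also have "(\<integral>\<^sup>+y. ?f (x + (- 1) * y) \<partial>lborel) = (\<integral>\<^sup>+y. ?f y \<partial>lborel)"
    using nn_integral_real_affine[of ?f "- 1" x] by simp
  also have "(\<integral>\<^sup>+y. ?f (- x + 1 * y) \<partial>lborel) = (\<integral>\<^sup>+y. ?f y \<partial>lborel)"
    using nn_integral_real_affine[of ?f 1 "- x"] by simp
  also have "(\<integral>\<^sup>+y. ?f y \<partial>lborel) + (\<integral>\<^sup>+y. ?f y \<partial>lborel) = ennreal (2 * (r powr (1 - g) / (1 - g)))"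
    unfolding nn_integral_powr_from_0[OF g r] using g by (subst ennreal_plus[symmetric]) auto
  finally show ?thesis .
qed

text \<open>The first two factors form a kernel homogeneous of degree -1, which on the half-line
  maps y^(-g) to a multiple of x^(-g). This is the model of the Schur condition near one end
  point.\<close>

definition hom_kernel :: "real \<Rightarrow> real \<Rightarrow> real \<Rightarrow> real \<Rightarrow> real" where
  "hom_kernel c g x y = \<bar>x - y\<bar> powr (- c) * (x + y) powr (- (1 - c)) * y powr (- g)"

lemma hom_kernel_nonneg: "hom_kernel c g x y \<ge> 0"
  by (simp add: hom_kernel_def)

lemma powr_minus_le_double:
  fixes c x y :: real
  assumes "0 \<le> c" "c \<le> 1" "x > 0" "y \<ge> x / 2"
  shows "y powr (- c) \<le> 2 * x powr (- c)"
proof -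
  have "y powr (- c) \<le> (x / 2) powr (- c)" using assms by (intro powr_mono2') auto
  also have "\<dots> = 2 powr c * x powr (- c)" using assms by (simp add: powr_divide powr_minus_divide)
  also have "\<dots> \<le> 2 powr 1 * x powr (- c)" using assms by (intro mult_right_mono powr_mono) auto
  finally show ?thesis by simp
qed

text \<open>The three terms belong to y <= x/2, to y comparable with x, and to y >= 2x. In the outer
  zones |x - y| is comparable with the larger variable; in the middle zone all other factors are
  comparable with powers of x.\<close>

lemma hom_kernel_le:
  assumes c: "0 \<le> c" "c < 1" and g: "0 \<le> g" "g \<le> 1/2" and x: "x > 0" and y: "y > 0"
  shows "hom_kernel c g x y \<le> 2 * x powr (- 1) * (y powr (- g) * indicator {0..x} y) +
      2 * x powr (- g - (1 - c)) * (\<bar>x - y\<bar> powr (- c) * indicator {x - x..x + x} y) +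
      2 * (y powr (- g - 1) * indicator {2 * x..} y)"
proof -
  consider "y \<le> x / 2" | "x / 2 \<le> y" "y \<le> 2 * x" | "2 * x \<le> y" by linarith
  then show ?thesis
  proof cases
    case 1
    have "\<bar>x - y\<bar> powr (- c) \<le> 2 * x powr (- c)" using 1 c x y by (intro powr_minus_le_double) auto
    moreover have "(x + y) powr (- (1 - c)) \<le> x powr (- (1 - c))" using x y c by (intro powr_mono2') auto
    ultimately have "hom_kernel c g x y \<le> (2 * x powr (- c)) * x powr (- (1 - c)) * y powr (- g)"
      unfolding hom_kernel_def by (intro mult_mono) auto
    also have "\<dots> = 2 * x powr (- 1) * y powr (- g)" by (simp add: mult.assoc powr_add[symmetric])
    also have "\<dots> = 2 * x powr (- 1) * (y powr (- g) * indicator {0..x} y)" using 1 x y by simp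
    finally show ?thesis by (smt (verit) mult_nonneg_nonneg powr_ge_zero indicator_pos_le)
  next
    case 2
    have "y powr (- g) \<le> 2 * x powr (- g)" using 2 g x y by (intro powr_minus_le_double) auto
    moreover have "(x + y) powr (- (1 - c)) \<le> x powr (- (1 - c))" using x y c by (intro powr_mono2') auto
    ultimately have "hom_kernel c g x y \<le> \<bar>x - y\<bar> powr (- c) * x powr (- (1 - c)) * (2 * x powr (- g))"
      unfolding hom_kernel_def by (intro mult_mono) auto
    also have "\<dots> = 2 * (x powr (- g) * x powr (- (1 - c))) * (\<bar>x - y\<bar> powr (- c))" by (simp only: mult_ac)
    also have "x powr (- g) * x powr (- (1 - c)) = x powr (- g - (1 - c))"
      unfolding powr_add[symmetric] by (simp only: add_uminus_conv_diff)
    also have "2 * x powr (- g - (1 - c)) * (\<bar>x - y\<bar> powr (- c)) =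
       2 * x powr (- g - (1 - c)) * (\<bar>x - y\<bar> powr (- c) * indicator {x - x..x + x} y)" using 2 y by simp
    finally show ?thesis by (smt (verit) mult_nonneg_nonneg powr_ge_zero indicator_pos_le)
  next
    case 3
    have "\<bar>x - y\<bar> powr (- c) \<le> 2 * y powr (- c)" using 3 c x y by (intro powr_minus_le_double) auto
    moreover have "(x + y) powr (- (1 - c)) \<le> y powr (- (1 - c))" using x y c by (intro powr_mono2') auto
    ultimately have "hom_kernel c g x y \<le> (2 * y powr (- c)) * y powr (- (1 - c)) * y powr (- g)"
      unfolding hom_kernel_def by (intro mult_mono) auto
    also have "\<dots> = 2 * y powr (- c + (- (1 - c) + - g))" by (simp only: mult.assoc powr_add)
    also have "- c + (- (1 - c) + - g) = - g - 1" by simp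
    also have "2 * y powr (- g - 1) = 2 * (y powr (- g - 1) * indicator {2 * x..} y)" using 3 by simp
    finally show ?thesis by (smt (verit) mult_nonneg_nonneg powr_ge_zero indicator_pos_le)
  qed
qed

text \<open>Convergence at 0 uses g <= 1/2, convergence at infinity g >= g0 > 0. The constant
  depends on these bounds and not on g, so it serves all exponents of the Schur test.\<close>

lemma nn_integral_hom_kernel:
  assumes c: "0 \<le> c" "c < 1" and g: "0 < g0" "g0 \<le> g" "g \<le> 1/2" and x: "x > 0"
  shows "(\<integral>\<^sup>+y. ennreal (hom_kernel c g x y) * indicator {0<..} y \<partial>lborel) \<le>
     ennreal ((4 + 4 / (1 - c) + 2 / g0) * x powr (- g))"
proof -
  have g': "0 \<le> g" "g > 0" using g by auto
  let ?f1 = "\<lambda>y. ennreal (2 * x powr (- 1)) * (ennreal (y powr (- g)) * indicator {0..x} y)"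
  let ?f2 = "\<lambda>y. ennreal (2 * x powr (- g - (1 - c))) * (ennreal (\<bar>x - y\<bar> powr (- c)) * indicator {x - x..x + x} y)"
  let ?f3 = "\<lambda>y. ennreal 2 * (ennreal (y powr ((1 - g) - 2)) * indicator {2 * x..} y)"
  have "(\<integral>\<^sup>+y. ennreal (hom_kernel c g x y) * indicator {0<..} y \<partial>lborel) \<le> (\<integral>\<^sup>+y. (?f1 y + ?f2 y) + ?f3 y \<partial>lborel)"
  proof (rule nn_integral_mono)
    fix y :: real
    show "ennreal (hom_kernel c g x y) * indicator {0<..} y \<le> (?f1 y + ?f2 y) + ?f3 y"
    proof (cases "y > 0")
      case True
      have "ennreal (hom_kernel c g x y) \<le> ennreal (2 * x powr (- 1) * (y powr (- g) * indicator {0..x} y) +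
        2 * x powr (- g - (1 - c)) * (\<bar>x - y\<bar> powr (- c) * indicator {x - x..x + x} y) +
        2 * (y powr (- g - 1) * indicator {2 * x..} y))"
        by (rule ennreal_leI, rule hom_kernel_le) (use c g' g x True in auto)
      also have "\<dots> = (?f1 y + ?f2 y) + ?f3 y"
      proof -
        have e: "- g - 1 = (1 - g) - 2" by simp
        have i: "ennreal (u * (v * indicator B y)) = ennreal u * (ennreal v * indicator B y)" if "0 \<le> u" "0 \<le> v" for u v B
          using that by (simp add: indicator_def ennreal_mult)
        show ?thesis unfolding e
          by (subst ennreal_plus; (intro add_nonneg_nonneg mult_nonneg_nonneg)?)
             (simp_all only: i powr_ge_zero zero_le_numeral mult_nonneg_nonneg indicator_pos_le ennreal_plus)
      qed
      finally show ?thesis using True by simp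
    qed simp
  qed
  also have "\<dots> = (\<integral>\<^sup>+y. ?f1 y \<partial>lborel) + (\<integral>\<^sup>+y. ?f2 y \<partial>lborel) + (\<integral>\<^sup>+y. ?f3 y \<partial>lborel)"
    by (simp add: nn_integral_add)
  also have "\<dots> \<le> ennreal (4 * x powr (- g)) + ennreal (4 / (1 - c) * x powr (- g)) + ennreal (2 / g0 * x powr (- g))"
  proof (intro add_mono)
    have "(\<integral>\<^sup>+y. ?f1 y \<partial>lborel) = ennreal (2 * x powr (- 1)) * ennreal (x powr (1 - g) / (1 - g))"
      by (subst nn_integral_cmult) (simp, use g nn_integral_powr_from_0[of g x] x in simp)
    also have "\<dots> = ennreal (2 * (x powr (- 1) * x powr (1 - g)) / (1 - g))"
      using g by (subst ennreal_mult[symmetric]) auto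
    also have "x powr (- 1) * x powr (1 - g) = x powr (- g)" unfolding powr_add[symmetric] by simp
    also have "ennreal (2 * x powr (- g) / (1 - g)) \<le> ennreal (4 * x powr (- g))"
    proof (rule ennreal_leI)
      have "2 * x powr (- g) / (1 - g) \<le> 2 * x powr (- g) / (1/2)" using g by (intro divide_left_mono) auto
      then show "2 * x powr (- g) / (1 - g) \<le> 4 * x powr (- g)" by simp
    qed
    finally show "(\<integral>\<^sup>+y. ?f1 y \<partial>lborel) \<le> ennreal (4 * x powr (- g))" .
  next
    have "(\<integral>\<^sup>+y. ?f2 y \<partial>lborel) = ennreal (2 * x powr (- g - (1 - c))) * (\<integral>\<^sup>+y. (ennreal (\<bar>x - y\<bar> powr (- c)) * indicator {x - x..x + x} y) \<partial>lborel)"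
      by (rule nn_integral_cmult) measurable
    also have "\<dots> \<le> ennreal (2 * x powr (- g - (1 - c))) * ennreal (2 * (x powr (1 - c) / (1 - c)))"
      by (intro mult_left_mono nn_integral_powr_centered) (use c x in auto)
    also have "\<dots> = ennreal (4 / (1 - c) * (x powr (- g - (1 - c)) * x powr (1 - c)))"
      using c by (subst ennreal_mult[symmetric]) auto
    also have "x powr (- g - (1 - c)) * x powr (1 - c) = x powr (- g)" by (simp add: powr_add[symmetric])
    finally show "(\<integral>\<^sup>+y. ?f2 y \<partial>lborel) \<le> ennreal (4 / (1 - c) * x powr (- g))" .
  next
    have "(\<integral>\<^sup>+y. ?f3 y \<partial>lborel) = ennreal 2 * ennreal ((2 * x) powr (1 - g - 1) / (1 - (1 - g)))"
      by (subst nn_integral_cmult) (simp, use nn_integral_powr_tail[of "2 * x" "1 - g"] x g' in simp)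
    also have "\<dots> = ennreal (2 * ((2 * x) powr (- g) / g))"
      using g' by (subst ennreal_mult[symmetric]) auto
    also have "\<dots> \<le> ennreal (2 / g0 * x powr (- g))"
    proof (rule ennreal_leI)
      have "(2 * x) powr (- g) \<le> x powr (- g)" using x g' by (intro powr_mono2') auto
      then have "(2 * x) powr (- g) / g \<le> x powr (- g) / g0" using g by (intro frac_le) auto
      then show "2 * ((2 * x) powr (- g) / g) \<le> 2 / g0 * x powr (- g)" by simp
    qed
    finally show "(\<integral>\<^sup>+y. ?f3 y \<partial>lborel) \<le> ennreal (2 / g0 * x powr (- g))" .
  qed
  also have "\<dots> = ennreal ((4 + 4 / (1 - c) + 2 / g0) * x powr (- g))"
    using c g by (simp add: ennreal_plus[symmetric] distrib_right del: ennreal_plus)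
  finally show ?thesis .
qed

lemma sin_half_ge:
  assumes "0 < \<theta>" "\<theta> < pi" shows "sin (\<theta> / 2) \<ge> \<theta> / 4"
proof -
  have "\<theta> / 4 \<le> \<theta> / pi" using assms pi_less_4 by (intro divide_left_mono) auto
  also have "\<theta> / pi = 2 * (\<theta> / 2) / pi" by simp
  also have "\<dots> \<le> sin (\<theta> / 2)" by (rule jordan_sin) (use assms in auto)
  finally show ?thesis .
qed

lemma cos_half_eq: "cos (\<theta> / 2) = sin ((pi - \<theta>) / 2)" for \<theta> :: real
  by (simp add: sin_cos_eq diff_divide_distrib)

text \<open>The test function of the Schur test. Near either end point it behaves like the distance
  to the power -g, and its powers belong to the same family.\<close>

definition singular_weight :: "real \<Rightarrow> real \<Rightarrow> real" where
  "singular_weight g \<theta> = (sin (\<theta> / 2) * cos (\<theta> / 2)) powr (- g)"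

text \<open>One of u and v is at least 1, so one of the two factors is at most 1.\<close>

lemma product_powr_split:
  fixes u v g :: real
  assumes "u > 0" "v > 0" "u + v \<ge> 2" "g \<ge> 0"
  shows "u powr (- g) * v powr (- g) \<le> u powr (- g) + v powr (- g)"
proof -
  have "u \<ge> 1 \<or> v \<ge> 1" using assms by linarith
  then show ?thesis
  proof
    assume "u \<ge> 1"
    then have "u powr (- g) \<le> 1 powr (- g)" using assms by (intro powr_mono2') auto
    then have "u powr (- g) * v powr (- g) \<le> 1 * v powr (- g)" by (intro mult_right_mono) auto
    then show ?thesis by (simp add: add_increasing)
  next
    assume "v \<ge> 1"
    then have "v powr (- g) \<le> 1 powr (- g)" using assms by (intro powr_mono2') auto
    then have "u powr (- g) * v powr (- g) \<le> u powr (- g) * 1" by (intro mult_left_mono) auto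
    then show ?thesis by (simp add: add_increasing2)
  qed
qed

lemma powr_minus_quarter:
  fixes x y g :: real
  assumes "x > 0" "y \<ge> x / 4" "0 \<le> g" "g \<le> 1"
  shows "y powr (- g) \<le> 4 * x powr (- g)"
proof -
  have "y powr (- g) \<le> (x / 4) powr (- g)" using assms by (intro powr_mono2') auto
  also have "\<dots> = 4 powr g * x powr (- g)" using assms by (simp add: powr_divide powr_minus_divide)
  also have "\<dots> \<le> 4 powr 1 * x powr (- g)" using assms by (intro mult_right_mono powr_mono) auto
  finally show ?thesis by simp
qed

text \<open>One homogeneous kernel for each end point, the second in reflected variables. In 2560 =
  256 * 10 the first factor comes from comparing sines and cosines with distances to the end points,
  the second from absorbing mixed products.\<close>

lemma singular_product_le:
  fixes \<theta> \<phi> c g :: real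
  assumes th: "0 < \<theta>" "\<theta> < pi" and ph: "0 < \<phi>" "\<phi> < pi" and c: "0 \<le> c" "c < 1" and g: "0 \<le> g" "g \<le> 1/2"
  shows "\<bar>\<theta> - \<phi>\<bar> powr (- c) * ((sin (\<theta> / 2) + sin (\<phi> / 2)) powr (- (1 - c)) * (cos (\<theta> / 2) + cos (\<phi> / 2)) powr (- (1 - c)))
     * singular_weight g \<phi> \<le> 2560 * (hom_kernel c g \<theta> \<phi> + hom_kernel c g (pi - \<theta>) (pi - \<phi>))"
proof -
  define \<theta>' \<phi>' where "\<theta>' = pi - \<theta>" and "\<phi>' = pi - \<phi>"
  have th': "0 < \<theta>'" "\<theta>' < pi" and ph': "0 < \<phi>'" "\<phi>' < pi" using th ph by (auto simp: \<theta>'_def \<phi>'_def)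
  define e where "e = 1 - c"
  have e: "0 \<le> e" "e \<le> 1" using c by (auto simp: e_def)
  define d where "d = \<bar>\<theta> - \<phi>\<bar> powr (- c)"
  have d': "d = \<bar>\<theta>' - \<phi>'\<bar> powr (- c)" by (simp add: d_def \<theta>'_def \<phi>'_def abs_minus_commute)
  have d0: "d \<ge> 0" by (simp add: d_def)
  define U V where "U = (\<theta> + \<phi>) powr (- e)" and "V = (\<theta>' + \<phi>') powr (- e)"
  define X Y where "X = \<phi> powr (- g)" and "Y = \<phi>' powr (- g)"
  have nn: "U \<ge> 0" "V \<ge> 0" "X \<ge> 0" "Y \<ge> 0" by (simp_all add: U_def V_def X_def Y_def)
  have pi2: "pi > 2" using pi_gt3 by simp
  have ss: "sin (\<theta> / 2) \<ge> \<theta> / 4" "sin (\<phi> / 2) \<ge> \<phi> / 4" "cos (\<theta> / 2) \<ge> \<theta>' / 4" "cos (\<phi> / 2) \<ge> \<phi>' / 4"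
    using sin_half_ge[OF th] sin_half_ge[OF ph] sin_half_ge[OF th'] sin_half_ge[OF ph']
    by (simp_all add: cos_half_eq \<theta>'_def \<phi>'_def)
  have 1: "(sin (\<theta> / 2) + sin (\<phi> / 2)) powr (- e) \<le> 4 * U"
    unfolding U_def by (rule powr_minus_quarter) (use ss th ph e in auto)
  have 2: "(cos (\<theta> / 2) + cos (\<phi> / 2)) powr (- e) \<le> 4 * V"
    unfolding V_def by (rule powr_minus_quarter) (use ss th' ph' e in auto)
  have 3: "sin (\<phi> / 2) powr (- g) \<le> 4 * X"
    unfolding X_def by (rule powr_minus_quarter) (use ss ph g in auto)
  have 4: "cos (\<phi> / 2) powr (- g) \<le> 4 * Y"
    unfolding Y_def by (rule powr_minus_quarter) (use ss ph' g in auto)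
  have "singular_weight g \<phi> = sin (\<phi> / 2) powr (- g) * cos (\<phi> / 2) powr (- g)"
    unfolding singular_weight_def by (rule powr_mult)
  also have "\<dots> \<le> (4 * X) * (4 * Y)" by (intro mult_mono 3 4) (use nn in auto)
  finally have sw: "singular_weight g \<phi> \<le> 16 * (X * Y)" by simp
  have XY: "X * Y \<le> X + Y" unfolding X_def Y_def
    by (rule product_powr_split) (use ph ph' g pi2 in \<open>auto simp: \<phi>'_def\<close>)
  have UV: "U * V \<le> U + V" unfolding U_def V_def
    by (rule product_powr_split) (use th ph th' ph' e pi2 in \<open>auto simp: \<theta>'_def \<phi>'_def\<close>)
  \<comment> \<open>U and V are bounded below, their arguments being less than 2 pi < 8.\<close>
  have big: "8 * (z powr (- e)) \<ge> 1" if "0 < z" "z < 8" for z :: real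
  proof -
    have "8 powr (- 1) \<le> (8::real) powr (- e)" using e by (intro powr_mono) auto
    also have "\<dots> \<le> z powr (- e)" using that e by (intro powr_mono2') auto
    finally show ?thesis by (simp add: powr_minus)
  qed
  have U8: "8 * U \<ge> 1" and V8: "8 * V \<ge> 1"
    unfolding U_def V_def by (rule big; use th ph th' ph' pi_less_4 in linarith)+
  \<comment> \<open>The mixed product is harmless: Y exceeds X only for \<phi> beyond pi/2, and
    there U is at most 1 and may be replaced by 8 V.\<close>
  have UY: "U * Y \<le> U * X + 8 * (V * Y)"
  proof (cases "\<phi> \<le> pi / 2")
    case True
    then have "Y \<le> X" unfolding X_def Y_def using ph g by (intro powr_mono2') (auto simp: \<phi>'_def)
    then have "U * Y \<le> U * X" using nn by (intro mult_left_mono) auto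
    moreover have "0 \<le> V * Y" using nn by simp
    ultimately show ?thesis by linarith
  next
    case False
    then have "1 \<le> \<theta> + \<phi>" using th pi2 by auto
    then have "U \<le> 1 powr (- e)" unfolding U_def using e by (intro powr_mono2') auto
    then have "U \<le> 8 * V" using V8 by simp
    then have "U * Y \<le> 8 * V * Y" using nn by (intro mult_right_mono) auto
    moreover have "0 \<le> U * X" using nn by simp
    ultimately show ?thesis by linarith
  qed
  have VX: "V * X \<le> V * Y + 8 * (U * X)"
  proof (cases "\<phi>' \<le> pi / 2")
    case True
    then have "X \<le> Y" unfolding X_def Y_def using ph' g by (intro powr_mono2') (auto simp: \<phi>'_def)
    then have "V * X \<le> V * Y" using nn by (intro mult_left_mono) auto
    moreover have "0 \<le> U * X" using nn by simp
    ultimately show ?thesis by linarith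
  next
    case False
    then have "1 \<le> \<theta>' + \<phi>'" using th' pi2 by auto
    then have "V \<le> 1 powr (- e)" unfolding V_def using e by (intro powr_mono2') auto
    then have "V \<le> 8 * U" using U8 by simp
    then have "V * X \<le> 8 * U * X" using nn by (intro mult_right_mono) auto
    moreover have "0 \<le> V * Y" using nn by simp
    ultimately show ?thesis by linarith
  qed
  have "(U * V) * (X * Y) \<le> (U + V) * (X + Y)" by (intro mult_mono UV XY) (use nn in auto)
  also have "\<dots> = U * X + U * Y + V * X + V * Y" by (simp add: algebra_simps)
  also have "\<dots> \<le> 10 * (U * X) + 10 * (V * Y)" using UY VX by linarith
  finally have UVXY: "(U * V) * (X * Y) \<le> 10 * (U * X) + 10 * (V * Y)" .
  have "d * ((sin (\<theta> / 2) + sin (\<phi> / 2)) powr (- e) * (cos (\<theta> / 2) + cos (\<phi> / 2)) powr (- e)) * singular_weight g \<phi>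
    \<le> d * ((4 * U) * (4 * V)) * (16 * (X * Y))"
    by (intro mult_mono mult_nonneg_nonneg 1 2 sw order_refl) (use nn d0 in \<open>auto simp: singular_weight_def\<close>)
  also have "\<dots> = 256 * d * ((U * V) * (X * Y))" by simp
  also have "\<dots> \<le> 256 * d * (10 * (U * X) + 10 * (V * Y))"
    using d0 by (intro mult_left_mono UVXY) auto
  also have "\<dots> = 2560 * (d * U * X + d * V * Y)" by (simp add: algebra_simps)
  also have "d * U * X = hom_kernel c g \<theta> \<phi>" by (simp add: hom_kernel_def d_def U_def X_def e_def)
  also have "d * V * Y = hom_kernel c g \<theta>' \<phi>'" by (simp add: hom_kernel_def d' V_def Y_def e_def)
  finally show ?thesis unfolding d_def e_def \<theta>'_def \<phi>'_def .
qed

section \<open>The Schur test between different exponents\<close>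

lemma weighted_am_gm3:
  fixes x y z a b c :: real
  assumes pos: "x > 0" "y > 0" "z > 0" and w: "a \<ge> 0" "b \<ge> 0" "c \<ge> 0" "a + b + c = 1"
  shows "x powr a * y powr b * z powr c \<le> a * x + b * y + c * z"
proof -
  define m where "m = a * x + b * y + c * z"
  have nn: "0 \<le> a * x" "0 \<le> b * y" "0 \<le> c * z" using pos w by auto
  have m: "m > 0"
  proof (rule ccontr)
    assume "\<not> m > 0"
    then have "a * x = 0" "b * y = 0" "c * z = 0" using nn unfolding m_def by linarith+
    then show False using pos w by auto
  qed
  have ln: "ln t \<le> ln m + (t / m - 1)" if "t > 0" for t
    using ln_add_one_self_le_self2[of "t / m - 1"] that m by (simp add: ln_div)
  have "ln (x powr a * y powr b * z powr c) = a * ln x + b * ln y + c * ln z"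
    using pos by (simp add: ln_mult ln_powr)
  also have "\<dots> \<le> a * (ln m + (x / m - 1)) + b * (ln m + (y / m - 1)) + c * (ln m + (z / m - 1))"
    by (intro add_mono mult_left_mono ln pos w)
  also have "\<dots> = (a + b + c) * (ln m - 1) + (a * x + b * y + c * z) / m"
    by (simp add: algebra_simps add_divide_distrib)
  also have "\<dots> = ln m" using w m by (simp add: m_def)
  finally show ?thesis using pos m unfolding m_def[symmetric] by (subst (asm) ln_le_cancel_iff) auto
qed

lemma epowr_ennreal: "x \<ge> 0 \<Longrightarrow> epowr (ennreal x) r = ennreal (x powr r)"
  by (simp add: epowr_def)

lemma epowr_infinity [simp]: "epowr \<infinity> r = \<infinity>"
  by (simp add: epowr_def)

lemma epowr_0 [simp]: "epowr 0 r = 0"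
  by (simp add: epowr_def)

lemma epowr_mono:
  assumes "x \<le> y" "r > 0"
  shows "epowr x r \<le> epowr y r"
proof (cases "y = \<infinity>")
  case False
  then have "y < \<infinity>" "x < \<infinity>" using assms by (auto simp: top.not_eq_extremum)
  then show ?thesis using assms
    by (auto simp: epowr_def intro!: ennreal_leI powr_mono2 enn2real_mono)
qed (simp add: epowr_def)

lemma epowr_cmult:
  assumes "c > 0"
  shows "epowr (ennreal c * x) r = ennreal (c powr r) * epowr x r"
proof (cases x)
  case (real y)
  then show ?thesis using assms
    by (simp add: ennreal_mult[symmetric] epowr_ennreal powr_mult)
next
  case top
  then show ?thesis using assms by (simp add: epowr_def ennreal_mult_eq_top_iff ennreal_mult_top)
qed

lemma epowr_inverse:
  assumes "r > 0"
  shows "epowr (epowr x r) (1 / r) = x" "epowr (epowr x (1 / r)) r = x"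
  using assms by (cases x; simp add: epowr_ennreal powr_powr epowr_def)+

lemma epowr_eq_0_iff: "epowr x r = 0 \<longleftrightarrow> x = 0"
  by (cases x) (auto simp: epowr_def)

lemma epowr_eq_infinity_iff: "epowr x r = \<infinity> \<longleftrightarrow> x = \<infinity>"
  by (auto simp: epowr_def)

lemma epowr_measurable [measurable]:
  assumes [measurable]: "F \<in> borel_measurable M"
  shows "(\<lambda>x. epowr (F x) r) \<in> borel_measurable M"
  unfolding epowr_def by measurable

lemma eLp_norm_mono:
  assumes "\<And>x. x \<in> space M \<Longrightarrow> F x \<le> G x" "r > 0"
  shows "eLp_norm r M F \<le> eLp_norm r M G"
  unfolding eLp_norm_def using assms by (intro epowr_mono nn_integral_mono) auto

lemma eLp_norm_cmult:
  assumes [measurable]: "F \<in> borel_measurable M" and "c > 0" "r > 0"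
  shows "eLp_norm r M (\<lambda>x. ennreal c * F x) = ennreal c * eLp_norm r M F"
proof -
  have "(\<integral>\<^sup>+ x. epowr (ennreal c * F x) r \<partial>M) = ennreal (c powr r) * (\<integral>\<^sup>+ x. epowr (F x) r \<partial>M)"
    unfolding epowr_cmult[OF \<open>c > 0\<close>] by (rule nn_integral_cmult) measurable
  then show ?thesis using assms by (simp add: eLp_norm_def epowr_cmult powr_powr)
qed

text \<open>The weighted arithmetic-geometric mean inequality with exponents \<open>1/q\<close>, \<open>1 - 1/p\<close>, \<open>1/p - 1/q\<close> replaces
  a triple Hoelder inequality; \<open>r\<close> and \<open>b\<close> stand for the values of the first two integrals.\<close>

lemma schur_pointwise:
  fixes K f v C p q :: real
  assumes p: "1 < p" and q: "p \<le> q" and s: "s * (1 - 1 / p + 1 / q) = 1"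
    and K: "K \<ge> 0" and f: "f \<ge> 0" and v: "v > 0" and r: "r > 0" and b: "b > 0"
  shows "K * f \<le> r powr (1 / q) * b powr (1 - 1 / p) *
     ((1 / (q * r)) * (K powr s * f powr p * v powr (- q)) + ((1 - 1 / p) / b) * (K powr s * v powr (p / (p - 1))) +
      (1 / p - 1 / q) * f powr p)"
proof (cases "K = 0 \<or> f = 0")
  case True
  have "0 \<le> 1 - 1 / p" "0 \<le> 1 / p - 1 / q" using p q by (auto simp: field_simps)
  then have "0 \<le> r powr (1 / q) * b powr (1 - 1 / p) *
     ((1 / (q * r)) * (K powr s * f powr p * v powr (- q)) + ((1 - 1 / p) / b) * (K powr s * v powr (p / (p - 1))) +
      (1 / p - 1 / q) * f powr p)"
    using p q r b by (intro mult_nonneg_nonneg add_nonneg_nonneg) auto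
  then show ?thesis using True by auto
next
  case False
  then have K0: "K > 0" and f0: "f > 0" using K f by auto
  define X Y Z where "X = K powr s * f powr p * v powr (- q)" and "Y = K powr s * v powr (p / (p - 1))" and "Z = f powr p"
  have pos: "X / r > 0" "Y / b > 0" "Z > 0" using K0 f0 v r b by (auto simp: X_def Y_def Z_def)
  have w: "1 / q \<ge> 0" "1 - 1 / p \<ge> 0" "1 / p - 1 / q \<ge> 0" "1 / q + (1 - 1 / p) + (1 / p - 1 / q) = 1"
    using p q by (auto simp: field_simps)
  have KK: "s * (1 / q) + s * (1 - 1 / p) = 1" using s by (simp add: algebra_simps)
  have ff: "p * (1 / q) + p * (1 / p - 1 / q) = 1" using p by (simp add: right_diff_distrib)
  have vv: "- q * (1 / q) + p / (p - 1) * (1 - 1 / p) = 0"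
  proof -
    have e: "1 - 1 / p = (p - 1) / p" using p by (simp add: diff_divide_distrib)
    have 1: "p / (p - 1) * (1 - 1 / p) = 1" unfolding e using p by simp
    have 2: "- q * (1 / q) = - 1" using p q by simp
    show ?thesis unfolding 1 2 by simp
  qed
  have X1: "X powr (1 / q) = K powr (s * (1 / q)) * f powr (p * (1 / q)) * v powr (- q * (1 / q))"
    unfolding X_def powr_mult powr_powr ..
  have Y1: "Y powr (1 - 1 / p) = K powr (s * (1 - 1 / p)) * v powr (p / (p - 1) * (1 - 1 / p))"
    unfolding Y_def powr_mult powr_powr ..
  have Z1: "Z powr (1 / p - 1 / q) = f powr (p * (1 / p - 1 / q))" unfolding Z_def powr_powr ..
  have "X powr (1 / q) * Y powr (1 - 1 / p) * Z powr (1 / p - 1 / q) =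
     (K powr (s * (1 / q)) * K powr (s * (1 - 1 / p))) * (f powr (p * (1 / q)) * f powr (p * (1 / p - 1 / q))) *
     (v powr (- q * (1 / q)) * v powr (p / (p - 1) * (1 - 1 / p)))"
    unfolding X1 Y1 Z1 by (simp only: mult_ac)
  also have "\<dots> = K * f" unfolding powr_add[symmetric] KK ff vv using K0 f0 v by simp
  finally have KF: "K * f = X powr (1 / q) * Y powr (1 - 1 / p) * Z powr (1 / p - 1 / q)" ..
  have "(X / r) powr (1 / q) * (Y / b) powr (1 - 1 / p) * Z powr (1 / p - 1 / q) \<le>
     (1 / q) * (X / r) + (1 - 1 / p) * (Y / b) + (1 / p - 1 / q) * Z"
    by (rule weighted_am_gm3[OF pos w])
  then have "(r powr (1 / q) * b powr (1 - 1 / p)) * ((X / r) powr (1 / q) * (Y / b) powr (1 - 1 / p) * Z powr (1 / p - 1 / q)) \<le>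
     (r powr (1 / q) * b powr (1 - 1 / p)) * ((1 / q) * (X / r) + (1 - 1 / p) * (Y / b) + (1 / p - 1 / q) * Z)"
    by (intro mult_left_mono) auto
  also have "(r powr (1 / q) * b powr (1 - 1 / p)) * ((X / r) powr (1 / q) * (Y / b) powr (1 - 1 / p) * Z powr (1 / p - 1 / q)) = K * f"
    unfolding KF using r b pos by (simp add: powr_divide)
  also have "(1 / q) * (X / r) + (1 - 1 / p) * (Y / b) + (1 / p - 1 / q) * Z =
     (1 / (q * r)) * X + ((1 - 1 / p) / b) * Y + (1 / p - 1 / q) * Z" by simp
  finally show ?thesis unfolding X_def Y_def Z_def .
qed

text \<open>When \<open>schur_pointwise\<close> is integrated with r the value of the first
  integral, its three terms contribute at most 1/q, 1 - 1/p and 1/p - 1/q, which add up to 1. The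
  values 0 and infinity of that integral are treated apart, as r is a positive real.\<close>

lemma schur_test_inner:
  fixes K :: "'a \<Rightarrow> real" and f v :: "'a \<Rightarrow> real"
  assumes p: "1 < p" and q: "p \<le> q" and s: "s * (1 - 1 / p + 1 / q) = 1"
    and [measurable]: "K \<in> borel_measurable M" "f \<in> borel_measurable M" "v \<in> borel_measurable M"
    and K: "\<And>y. y \<in> space M \<Longrightarrow> K y \<ge> 0" and f: "\<And>y. y \<in> space M \<Longrightarrow> f y \<ge> 0" and v: "\<And>y. y \<in> space M \<Longrightarrow> v y > 0"
    and b: "b > 0" and B: "(\<integral>\<^sup>+y. ennreal (K y powr s * v y powr (p / (p - 1))) \<partial>M) \<le> ennreal b"
    and F: "(\<integral>\<^sup>+y. ennreal (f y powr p) \<partial>M) \<le> 1"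
  shows "epowr (\<integral>\<^sup>+y. ennreal (K y * f y) \<partial>M) q \<le>
    (\<integral>\<^sup>+y. ennreal (K y powr s * f y powr p * v y powr (- q)) \<partial>M) * ennreal (b powr (q * (1 - 1 / p)))"
proof -
  define A where "A = (\<integral>\<^sup>+y. ennreal (K y powr s * f y powr p * v y powr (- q)) \<partial>M)"
  have q0: "q > 0" using p q by simp
  have w: "0 \<le> 1 - 1 / p" "0 \<le> 1 / p - 1 / q" using p q by (auto simp: field_simps)
  consider "A = \<infinity>" | "A = 0" | r where "A = ennreal r" "r > 0"
    by (cases A) (auto simp: less_eq_real_def)
  then show ?thesis
  proof cases
    case 1
    then show ?thesis using b unfolding A_def[symmetric] by (simp add: ennreal_mult_eq_top_iff ennreal_top_mult)
  next
    case 2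
    have "AE y in M. ennreal (K y powr s * f y powr p * v y powr (- q)) = 0"
      using 2 unfolding A_def by (subst (asm) nn_integral_0_iff_AE) auto
    then have "AE y in M. ennreal (K y * f y) = 0"
      using AE_space
    proof eventually_elim
      case (elim y)
      have "v y > 0" using v elim by simp
      then have vq: "v y powr (- q) > 0" by simp
      have "K y powr s * f y powr p * v y powr (- q) \<le> 0" using elim by (simp only: ennreal_eq_0_iff)
      moreover note vq
      ultimately have "K y powr s * f y powr p \<le> 0" by (metis mult_pos_pos not_le)
      then have "K y = 0 \<or> f y = 0" using K[of y] f[of y] elim
        by (metis (full_types) mult_nonneg_nonneg order_antisym powr_ge_zero mult_eq_0_iff powr_eq_0_iff)
      then show ?case by auto
    qed
    then have "(\<integral>\<^sup>+y. ennreal (K y * f y) \<partial>M) = 0" by (subst nn_integral_0_iff_AE) auto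
    then show ?thesis by simp
  next
    case (3 r)
    define c where "c = r powr (1 / q) * b powr (1 - 1 / p)"
    have c: "c > 0" using 3 b by (simp add: c_def)
    let ?X = "\<lambda>y. ennreal (1 / (q * r)) * ennreal (K y powr s * f y powr p * v y powr (- q))"
    let ?Y = "\<lambda>y. ennreal ((1 - 1 / p) / b) * ennreal (K y powr s * v y powr (p / (p - 1)))"
    let ?Z = "\<lambda>y. ennreal (1 / p - 1 / q) * ennreal (f y powr p)"
    have "(\<integral>\<^sup>+y. ennreal (K y * f y) \<partial>M) \<le> (\<integral>\<^sup>+y. ennreal c * ((?X y + ?Y y) + ?Z y) \<partial>M)"
    proof (rule nn_integral_mono)
      fix y assume y: "y \<in> space M"
      have "ennreal (K y * f y) \<le> ennreal (c * ((1 / (q * r)) * (K y powr s * f y powr p * v y powr (- q)) +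
         ((1 - 1 / p) / b) * (K y powr s * v y powr (p / (p - 1))) + (1 / p - 1 / q) * f y powr p))"
        unfolding c_def by (intro ennreal_leI schur_pointwise p q s K f v y 3 b)
      also have "\<dots> = ennreal c * ((?X y + ?Y y) + ?Z y)"
      proof -
        have *: "ennreal (c * (x1 * x2 + y1 * y2 + z1 * z2)) = ennreal c * ((ennreal x1 * ennreal x2 + ennreal y1 * ennreal y2) + ennreal z1 * ennreal z2)"
          if "0 \<le> x1" "0 \<le> x2" "0 \<le> y1" "0 \<le> y2" "0 \<le> z1" "0 \<le> z2" for x1 x2 y1 y2 z1 z2
          using that c by (simp add: ennreal_mult ennreal_plus)
        show ?thesis by (rule *) (use w q0 3 b in auto)
      qed
      finally show "ennreal (K y * f y) \<le> ennreal c * ((?X y + ?Y y) + ?Z y)" .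
    qed
    also have "\<dots> = ennreal c * (((\<integral>\<^sup>+y. ?X y \<partial>M) + (\<integral>\<^sup>+y. ?Y y \<partial>M)) + (\<integral>\<^sup>+y. ?Z y \<partial>M))"
      by (simp add: nn_integral_cmult nn_integral_add)
    also have "\<dots> \<le> ennreal c * ((ennreal (1 / q) + ennreal (1 - 1 / p)) + ennreal (1 / p - 1 / q))"
    proof (intro mult_left_mono add_mono)
      have "(\<integral>\<^sup>+y. ?X y \<partial>M) = ennreal (1 / (q * r)) * A" by (simp add: A_def nn_integral_cmult)
      also have "\<dots> = ennreal (1 / q)" using 3 q0 by (simp add: ennreal_mult[symmetric])
      finally show "(\<integral>\<^sup>+y. ?X y \<partial>M) \<le> ennreal (1 / q)" by simp
      have "(\<integral>\<^sup>+y. ?Y y \<partial>M) = ennreal ((1 - 1 / p) / b) * (\<integral>\<^sup>+y. ennreal (K y powr s * v y powr (p / (p - 1))) \<partial>M)"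
        by (simp add: nn_integral_cmult)
      also have "\<dots> \<le> ennreal ((1 - 1 / p) / b) * ennreal b" by (intro mult_left_mono B) simp
      also have "\<dots> = ennreal (1 - 1 / p)" using b w by (subst ennreal_mult[symmetric]) auto
      finally show "(\<integral>\<^sup>+y. ?Y y \<partial>M) \<le> ennreal (1 - 1 / p)" .
      have "(\<integral>\<^sup>+y. ?Z y \<partial>M) = ennreal (1 / p - 1 / q) * (\<integral>\<^sup>+y. ennreal (f y powr p) \<partial>M)"
        by (simp add: nn_integral_cmult)
      also have "\<dots> \<le> ennreal (1 / p - 1 / q) * 1" by (intro mult_left_mono F) simp
      finally show "(\<integral>\<^sup>+y. ?Z y \<partial>M) \<le> ennreal (1 / p - 1 / q)" by simp
    qed simp
    also have "(ennreal (1 / q) + ennreal (1 - 1 / p)) + ennreal (1 / p - 1 / q) = 1"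
    proof -
      have "(ennreal (1 / q) + ennreal (1 - 1 / p)) + ennreal (1 / p - 1 / q) = ennreal (1 / q + (1 - 1 / p) + (1 / p - 1 / q))"
        using w q0 by (simp only: ennreal_plus[symmetric] add_nonneg_nonneg zero_le_divide_1_iff less_imp_le)
      also have "1 / q + (1 - 1 / p) + (1 / p - 1 / q) = 1" by simp
      finally show ?thesis by simp
    qed
    finally have "(\<integral>\<^sup>+y. ennreal (K y * f y) \<partial>M) \<le> ennreal c" by simp
    then have "epowr (\<integral>\<^sup>+y. ennreal (K y * f y) \<partial>M) q \<le> epowr (ennreal c) q" by (rule epowr_mono[OF _ q0])
    also have "\<dots> = ennreal (c powr q)" using c by (simp add: epowr_ennreal)
    also have "c powr q = r * b powr (q * (1 - 1 / p))"
    proof -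
      have "c powr q = r powr (1 / q * q) * b powr ((1 - 1 / p) * q)" unfolding c_def powr_mult powr_powr ..
      then show ?thesis using 3 q0 by (simp add: mult.commute)
    qed
    also have "ennreal (r * b powr (q * (1 - 1 / p))) = A * ennreal (b powr (q * (1 - 1 / p)))"
      using 3 by (simp add: ennreal_mult)
    finally show ?thesis unfolding A_def .
  qed
qed

text \<open>The second Schur condition turns the other integral into v(x)^q, Fubini exchanges the
  variables, and the first condition, through the symmetry of K, then removes v.\<close>

lemma schur_test_normalized:
  fixes K :: "'a \<Rightarrow> 'a \<Rightarrow> real" and f v :: "'a \<Rightarrow> real"
  assumes "sigma_finite_measure M"
    and p: "1 < p" and q: "p \<le> q" and s: "s * (1 - 1 / p + 1 / q) = 1"
    and Km [measurable]: "(\<lambda>(x, y). K x y) \<in> borel_measurable (M \<Otimes>\<^sub>M M)"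
    and [measurable]: "f \<in> borel_measurable M" "v \<in> borel_measurable M"
    and K: "\<And>x y. x \<in> space M \<Longrightarrow> y \<in> space M \<Longrightarrow> K x y \<ge> 0"
    and sym: "\<And>x y. x \<in> space M \<Longrightarrow> y \<in> space M \<Longrightarrow> K x y = K y x"
    and f: "\<And>y. y \<in> space M \<Longrightarrow> f y \<ge> 0" and v: "\<And>y. y \<in> space M \<Longrightarrow> v y > 0"
    and C: "C \<ge> 1"
    and B1: "\<And>x. x \<in> space M \<Longrightarrow> (\<integral>\<^sup>+y. ennreal (K x y powr s * v y powr q) \<partial>M) \<le> ennreal (C * v x powr q)"
    and B2: "\<And>x. x \<in> space M \<Longrightarrow> (\<integral>\<^sup>+y. ennreal (K x y powr s * v y powr (p / (p - 1))) \<partial>M) \<le> ennreal (C * v x powr (p / (p - 1)))"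
    and F: "(\<integral>\<^sup>+y. ennreal (f y powr p) \<partial>M) \<le> 1"
  shows "(\<integral>\<^sup>+x. epowr (\<integral>\<^sup>+y. ennreal (K x y * f y) \<partial>M) q \<partial>M) \<le> ennreal (C powr q)"
proof -
  interpret sigma_finite_measure M by fact
  interpret pair_sigma_finite M M ..
  define e where "e = q * (1 - 1 / p)"
  \<comment> \<open>This is p <= q in disguise. The two Schur conditions give the constant C^(1 +
    e), whose q-th root is at most C for every p and q since C >= 1.\<close>
  have e: "1 + e \<le> q" using p q by (simp add: e_def field_simps)
  have vp: "(C * v x powr (p / (p - 1))) powr e = C powr e * v x powr q" for x
  proof -
    have "p / (p - 1) * e = q" using p by (simp add: e_def field_simps)
    then show ?thesis unfolding powr_mult powr_powr by simp
  qed
  let ?G = "\<lambda>x y. ennreal (C powr e * v x powr q * (K x y powr s * (f y powr p * v y powr (- q))))"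
  have "(\<integral>\<^sup>+x. epowr (\<integral>\<^sup>+y. ennreal (K x y * f y) \<partial>M) q \<partial>M) \<le> (\<integral>\<^sup>+x. (\<integral>\<^sup>+y. ?G x y \<partial>M) \<partial>M)"
  proof (rule nn_integral_mono)
    fix x assume x: "x \<in> space M"
    have [measurable]: "K x \<in> borel_measurable M" using measurable_compose_Pair1[OF x Km] by simp
    have "epowr (\<integral>\<^sup>+y. ennreal (K x y * f y) \<partial>M) q \<le>
      (\<integral>\<^sup>+y. ennreal (K x y powr s * f y powr p * v y powr (- q)) \<partial>M) * ennreal ((C * v x powr (p / (p - 1))) powr (q * (1 - 1 / p)))"
    proof (rule schur_test_inner[OF p q s])
      have "v x > 0" by (rule v[OF x])
      then show "0 < C * v x powr (p / (p - 1))" using C by simp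
    qed (use K f v x C B2 F in auto)
    also have "\<dots> = ennreal (C powr e * v x powr q) * (\<integral>\<^sup>+y. ennreal (K x y powr s * f y powr p * v y powr (- q)) \<partial>M)"
      unfolding e_def[symmetric] vp by (rule mult.commute)
    also have "\<dots> = (\<integral>\<^sup>+y. ennreal (C powr e * v x powr q) * ennreal (K x y powr s * f y powr p * v y powr (- q)) \<partial>M)"
      by (rule nn_integral_cmult[symmetric]) measurable
    also have "\<dots> = (\<integral>\<^sup>+y. ?G x y \<partial>M)"
      by (intro nn_integral_cong, subst ennreal_mult[symmetric]) (simp_all add: mult.assoc)
    finally show "epowr (\<integral>\<^sup>+y. ennreal (K x y * f y) \<partial>M) q \<le> (\<integral>\<^sup>+y. ?G x y \<partial>M)" .
  qed
  also have "\<dots> = (\<integral>\<^sup>+y. (\<integral>\<^sup>+x. ?G x y \<partial>M) \<partial>M)"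
    by (rule Fubini'[symmetric]) measurable
  also have "\<dots> \<le> (\<integral>\<^sup>+y. ennreal (C powr (1 + e)) * ennreal (f y powr p) \<partial>M)"
  proof (rule nn_integral_mono)
    fix y assume y: "y \<in> space M"
    have [measurable]: "(\<lambda>x. K x y) \<in> borel_measurable M" using measurable_Pair1[OF Km y] by simp
    have "(\<integral>\<^sup>+x. ?G x y \<partial>M) = (\<integral>\<^sup>+x. ennreal (C powr e * (f y powr p * v y powr (- q))) * ennreal (K y x powr s * v x powr q) \<partial>M)"
      using sym y by (intro nn_integral_cong, subst ennreal_mult[symmetric]) (auto simp: mult_ac)
    also have "\<dots> = ennreal (C powr e * (f y powr p * v y powr (- q))) * (\<integral>\<^sup>+x. ennreal (K y x powr s * v x powr q) \<partial>M)"
    proof (rule nn_integral_cmult)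
      have "K y \<in> borel_measurable M" using measurable_compose_Pair1[OF y Km] by simp
      then show "(\<lambda>x. ennreal (K y x powr s * v x powr q)) \<in> borel_measurable M" by measurable
    qed
    also have "\<dots> \<le> ennreal (C powr e * (f y powr p * v y powr (- q))) * ennreal (C * v y powr q)"
      by (intro mult_left_mono B1 y) simp
    also have "\<dots> = ennreal (C powr (1 + e) * f y powr p)"
    proof -
      have "v y powr (- q) * v y powr q = 1" using v[OF y] by (simp add: powr_add[symmetric])
      moreover have "C powr (1 + e) = C * C powr e" using C by (simp add: powr_add)
      moreover have "(C powr e * (f y powr p * v y powr (- q))) * (C * v y powr q) = C * C powr e * f y powr p * (v y powr (- q) * v y powr q)"
        by (simp only: mult_ac)
      ultimately show ?thesis using C by (subst ennreal_mult[symmetric]) auto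
    qed
    finally show "(\<integral>\<^sup>+x. ?G x y \<partial>M) \<le> ennreal (C powr (1 + e)) * ennreal (f y powr p)"
      by (simp add: ennreal_mult)
  qed
  also have "\<dots> = ennreal (C powr (1 + e)) * (\<integral>\<^sup>+y. ennreal (f y powr p) \<partial>M)"
    by (rule nn_integral_cmult) measurable
  also have "\<dots> \<le> ennreal (C powr q) * 1"
    using C e by (intro mult_mono F ennreal_leI powr_mono) auto
  finally show ?thesis by simp
qed

text \<open>Scaling reduces to norm 1, and a finite norm makes F finite almost everywhere, so that a
  real-valued f can take its place. F is \<open>ennreal\<close>-valued because it will be an l^2
  norm that may be infinite.\<close>

lemma schur_test:
  fixes K :: "'a \<Rightarrow> 'a \<Rightarrow> real" and v :: "'a \<Rightarrow> real" and F :: "'a \<Rightarrow> ennreal"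
  assumes sf: "sigma_finite_measure M"
    and p: "1 < p" and q: "p \<le> q" and s: "s * (1 - 1 / p + 1 / q) = 1"
    and Km [measurable]: "(\<lambda>(x, y). K x y) \<in> borel_measurable (M \<Otimes>\<^sub>M M)"
    and [measurable]: "F \<in> borel_measurable M" "v \<in> borel_measurable M"
    and K: "\<And>x y. x \<in> space M \<Longrightarrow> y \<in> space M \<Longrightarrow> K x y \<ge> 0"
    and sym: "\<And>x y. x \<in> space M \<Longrightarrow> y \<in> space M \<Longrightarrow> K x y = K y x"
    and v: "\<And>y. y \<in> space M \<Longrightarrow> v y > 0"
    and C: "C \<ge> 1"
    and B1: "\<And>x. x \<in> space M \<Longrightarrow> (\<integral>\<^sup>+y. ennreal (K x y powr s * v y powr q) \<partial>M) \<le> ennreal (C * v x powr q)"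
    and B2: "\<And>x. x \<in> space M \<Longrightarrow> (\<integral>\<^sup>+y. ennreal (K x y powr s * v y powr (p / (p - 1))) \<partial>M) \<le> ennreal (C * v x powr (p / (p - 1)))"
  shows "eLp_norm q M (\<lambda>x. \<integral>\<^sup>+y. ennreal (K x y) * F y \<partial>M) \<le> ennreal C * eLp_norm p M F"
proof -
  interpret sigma_finite_measure M by fact
  have p0: "p > 0" and q0: "q > 0" using p q by auto
  have Kx: "K x \<in> borel_measurable M" if "x \<in> space M" for x
    using measurable_compose_Pair1[OF that Km] by simp
  consider "eLp_norm p M F = \<infinity>" | "eLp_norm p M F = 0" | n where "eLp_norm p M F = ennreal n" "n > 0"
    by (cases "eLp_norm p M F") (auto simp: less_eq_real_def)
  then show ?thesis
  proof cases
    case 1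
    then show ?thesis using C by (simp add: ennreal_mult_eq_top_iff ennreal_mult_top)
  next
    case 2
    then have "(\<integral>\<^sup>+ x. epowr (F x) p \<partial>M) = 0" by (simp add: eLp_norm_def epowr_eq_0_iff)
    then have AE: "AE x in M. F x = 0" by (subst (asm) nn_integral_0_iff_AE) (auto simp: epowr_eq_0_iff)
    have "(\<integral>\<^sup>+y. ennreal (K x y) * F y \<partial>M) = 0" if "x \<in> space M" for x
    proof -
      have "(\<integral>\<^sup>+y. ennreal (K x y) * F y \<partial>M) = (\<integral>\<^sup>+y. 0 \<partial>M)"
        by (rule nn_integral_cong_AE) (use AE in \<open>auto elim!: eventually_mono\<close>)
      then show ?thesis by simp
    qed
    then have "(\<integral>\<^sup>+x. epowr (\<integral>\<^sup>+y. ennreal (K x y) * F y \<partial>M) q \<partial>M) = (\<integral>\<^sup>+x. 0 \<partial>M)"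
      by (intro nn_integral_cong) simp
    then show ?thesis by (simp add: eLp_norm_def)
  next
    case (3 n)
    have Fp: "(\<integral>\<^sup>+ x. epowr (F x) p \<partial>M) = ennreal (n powr p)"
      using 3 epowr_inverse(2)[OF p0, of "\<integral>\<^sup>+ x. epowr (F x) p \<partial>M"] by (simp add: eLp_norm_def epowr_ennreal)
    have "AE x in M. epowr (F x) p \<noteq> \<infinity>"
      by (rule nn_integral_noteq_infinite) (auto simp: Fp)
    then have fin: "AE x in M. F x \<noteq> \<infinity>" by (simp only: epowr_eq_infinity_iff)
    define f where "f x = enn2real (F x) / n" for x
    have [measurable]: "f \<in> borel_measurable M" unfolding f_def by measurable
    have f0: "f x \<ge> 0" for x using 3 by (simp add: f_def)
    have Ff: "F x = ennreal n * ennreal (f x)" if "F x \<noteq> \<infinity>" for x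
      using that 3 f0[of x] by (cases "F x") (auto simp: f_def ennreal_mult[symmetric])
    have "(\<integral>\<^sup>+ x. epowr (F x) p \<partial>M) = (\<integral>\<^sup>+ x. ennreal (n powr p) * ennreal (f x powr p) \<partial>M)"
    proof (rule nn_integral_cong_AE, use fin in eventually_elim)
      case (elim x)
      show ?case unfolding Ff[OF elim] using 3 f0[of x] by (simp add: epowr_cmult epowr_ennreal)
    qed
    also have "\<dots> = ennreal (n powr p) * (\<integral>\<^sup>+ x. ennreal (f x powr p) \<partial>M)" by (rule nn_integral_cmult) measurable
    finally have "ennreal (n powr p) * (\<integral>\<^sup>+ x. ennreal (f x powr p) \<partial>M) = ennreal (n powr p) * 1" by (simp add: Fp)
    then have fp: "(\<integral>\<^sup>+ x. ennreal (f x powr p) \<partial>M) = 1"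
      using 3 by (subst (asm) ennreal_mult_cancel_left) auto
    have T: "(\<integral>\<^sup>+y. ennreal (K x y) * F y \<partial>M) = ennreal n * (\<integral>\<^sup>+y. ennreal (K x y * f y) \<partial>M)" if x: "x \<in> space M" for x
    proof -
      note Kx[OF x, measurable]
      have "(\<integral>\<^sup>+y. ennreal (K x y) * F y \<partial>M) = (\<integral>\<^sup>+y. ennreal n * ennreal (K x y * f y) \<partial>M)"
      proof (rule nn_integral_cong_AE, use fin AE_space in eventually_elim)
        case (elim y)
        show ?case unfolding Ff[OF elim(1)] using K[OF x elim(2)] f0[of y] 3 by (simp add: ennreal_mult mult_ac)
      qed
      also have "\<dots> = ennreal n * (\<integral>\<^sup>+y. ennreal (K x y * f y) \<partial>M)" by (rule nn_integral_cmult) measurable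
      finally show ?thesis .
    qed
    have "(\<integral>\<^sup>+x. epowr (\<integral>\<^sup>+y. ennreal (K x y) * F y \<partial>M) q \<partial>M) =
       (\<integral>\<^sup>+x. ennreal (n powr q) * epowr (\<integral>\<^sup>+y. ennreal (K x y * f y) \<partial>M) q \<partial>M)"
      using 3 by (intro nn_integral_cong) (simp add: T epowr_cmult)
    also have "\<dots> = ennreal (n powr q) * (\<integral>\<^sup>+x. epowr (\<integral>\<^sup>+y. ennreal (K x y * f y) \<partial>M) q \<partial>M)"
      by (rule nn_integral_cmult) measurable
    also have "\<dots> \<le> ennreal (n powr q) * ennreal (C powr q)"
      by (intro mult_left_mono schur_test_normalized[where f = f and v = v, OF sf p q s Km _ _ K sym]) (use f0 v C B1 B2 fp in auto)
    also have "\<dots> = ennreal ((C * n) powr q)" by (simp add: powr_mult ennreal_mult[symmetric] mult.commute)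
    finally have "eLp_norm q M (\<lambda>x. \<integral>\<^sup>+y. ennreal (K x y) * F y \<partial>M) \<le> epowr (ennreal ((C * n) powr q)) (1 / q)"
      unfolding eLp_norm_def using q0 by (intro epowr_mono) auto
    also have "\<dots> = ennreal C * eLp_norm p M F"
      using 3 C q0 by (simp add: epowr_ennreal powr_powr ennreal_mult)
    finally show ?thesis .
  qed
qed

text \<open>Since \<open>0 powr _ = 0\<close>, this kernel vanishes on the diagonal instead of being infinite there.\<close>

definition frac_kernel :: "real \<Rightarrow> real \<Rightarrow> real \<Rightarrow> real \<Rightarrow> real \<Rightarrow> real" where
  "frac_kernel \<sigma> \<alpha> \<beta> \<theta> \<phi> = \<bar>\<theta> - \<phi>\<bar> powr (\<sigma> - 1) * endpoint_factor \<alpha> \<beta> \<theta> \<phi>"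

lemma frac_kernel_nonneg: "frac_kernel \<sigma> \<alpha> \<beta> \<theta> \<phi> \<ge> 0"
  by (simp add: frac_kernel_def endpoint_factor_def)

lemma frac_kernel_sym: "frac_kernel \<sigma> \<alpha> \<beta> \<theta> \<phi> = frac_kernel \<sigma> \<alpha> \<beta> \<phi> \<theta>"
  by (simp add: frac_kernel_def endpoint_factor_def abs_minus_commute add.commute)

section \<open>Jacobi measures and the Schur conditions for the fractional kernel\<close>

definition jacobi_weight :: "real \<Rightarrow> real \<Rightarrow> real \<Rightarrow> real" where
  "jacobi_weight \<alpha> \<beta> \<theta> = sin (\<theta> / 2) powr (2 * \<alpha> + 1) * cos (\<theta> / 2) powr (2 * \<beta> + 1)"

lemma jacobi_measure_weight:
  "jacobi_measure \<alpha> \<beta> = density (restrict_space lborel {0<..<pi}) (\<lambda>\<theta>. ennreal (jacobi_weight \<alpha> \<beta> \<theta>))"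
  by (simp add: jacobi_measure_def jacobi_weight_def)

lemma space_jacobi_measure [simp]: "space (jacobi_measure \<alpha> \<beta>) = {0<..<pi}"
  by (simp add: jacobi_measure_def space_restrict_space)

lemma sets_jacobi_measure: "sets (jacobi_measure \<alpha> \<beta>) = sets (restrict_space lborel {0<..<pi})"
  by (simp add: jacobi_measure_def)

lemma measurable_jacobi_measure:
  "f \<in> borel_measurable borel \<Longrightarrow> f \<in> borel_measurable (jacobi_measure \<alpha> \<beta>)"
  unfolding measurable_cong_sets[OF sets_jacobi_measure refl] by (rule measurable_restrict_space1) simp

lemma jacobi_measurable_iff:
  "borel_measurable (jacobi_measure a b) = borel_measurable (jacobi_measure \<alpha> \<beta>)"
  unfolding measurable_cong_sets[OF sets_jacobi_measure refl] ..

lemma jacobi_weight_measurable [measurable]: "jacobi_weight \<alpha> \<beta> \<in> borel_measurable borel"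
  unfolding jacobi_weight_def[abs_def] by measurable

text \<open>All Jacobi measures have the same measurable sets, so the parameters of the hypothesis
  are independent of those of the integral. This allows passing from one measure to another.\<close>

lemma nn_integral_jacobi_measure:
  assumes "F \<in> borel_measurable (jacobi_measure a b)"
  shows "(\<integral>\<^sup>+\<phi>. F \<phi> \<partial>jacobi_measure \<alpha> \<beta>) =
    (\<integral>\<^sup>+\<phi>. (ennreal (jacobi_weight \<alpha> \<beta> \<phi>) * F \<phi>) * indicator {0<..<pi} \<phi> \<partial>lborel)"
proof -
  have F: "F \<in> borel_measurable (restrict_space lborel {0<..<pi})"
    using assms unfolding measurable_cong_sets[OF sets_jacobi_measure refl] .
  have w: "(\<lambda>\<theta>. ennreal (jacobi_weight \<alpha> \<beta> \<theta>)) \<in> borel_measurable (restrict_space lborel {0<..<pi})"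
    by (rule measurable_restrict_space1) simp
  show ?thesis unfolding jacobi_measure_weight
    by (subst nn_integral_density[OF w F], subst nn_integral_restrict_space) simp_all
qed

lemma sin_cos_half_pos:
  assumes "0 < \<theta>" "\<theta> < pi"
  shows "0 < sin (\<theta> / 2)" "0 < cos (\<theta> / 2)" "sin (\<theta> / 2) \<le> 1" "cos (\<theta> / 2) \<le> 1"
  using assms by (auto intro!: sin_gt_zero cos_gt_zero)

lemma jacobi_weight_pos: "0 < \<theta> \<Longrightarrow> \<theta> < pi \<Longrightarrow> jacobi_weight \<alpha> \<beta> \<theta> > 0"
  using sin_cos_half_pos[of \<theta>] by (simp add: jacobi_weight_def)

lemma jacobi_weight_le_1:
  assumes "\<alpha> \<ge> -1/2" "\<beta> \<ge> -1/2" "0 < \<theta>" "\<theta> < pi"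
  shows "jacobi_weight \<alpha> \<beta> \<theta> \<le> 1"
proof -
  note sc = sin_cos_half_pos[OF assms(3,4)]
  have "sin (\<theta> / 2) powr (2 * \<alpha> + 1) \<le> 1" "cos (\<theta> / 2) powr (2 * \<beta> + 1) \<le> 1"
    using sc assms by (auto intro!: powr_le1)
  then show ?thesis unfolding jacobi_weight_def by (intro mult_le_one) auto
qed

lemma finite_jacobi_measure:
  assumes "\<alpha> \<ge> -1/2" "\<beta> \<ge> -1/2"
  shows "finite_measure (jacobi_measure \<alpha> \<beta>)"
proof (rule finite_measureI)
  have "emeasure (jacobi_measure \<alpha> \<beta>) (space (jacobi_measure \<alpha> \<beta>)) = (\<integral>\<^sup>+\<phi>. 1 \<partial>jacobi_measure \<alpha> \<beta>)" by simp
  also have "\<dots> = (\<integral>\<^sup>+\<phi>. (ennreal (jacobi_weight \<alpha> \<beta> \<phi>) * 1) * indicator {0<..<pi} \<phi> \<partial>lborel)"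
    by (rule nn_integral_jacobi_measure[where a = \<alpha> and b = \<beta>]) simp
  also have "\<dots> \<le> (\<integral>\<^sup>+\<phi>. indicator {0<..<pi} \<phi> \<partial>lborel)"
    by (intro nn_integral_mono) (auto simp: indicator_def jacobi_weight_le_1[OF assms])
  also have "\<dots> < \<infinity>" by simp
  finally show "emeasure (jacobi_measure \<alpha> \<beta>) (space (jacobi_measure \<alpha> \<beta>)) \<noteq> \<infinity>" by simp
qed

text \<open>A positive lower bound of \<open>frac_kernel\<close> off the diagonal, from |\<theta> -
  \<phi>| < 4 and from sums of sines and cosines at most 2. It permits raising the kernel to a
  larger power.\<close>

definition kernel_floor :: "real \<Rightarrow> real \<Rightarrow> real" where
  "kernel_floor \<alpha> \<beta> = 1/4 * (2 powr (-(2 * \<alpha> + 1)) * 2 powr (-(2 * \<beta> + 1)))"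

lemma kernel_floor:
  assumes "\<alpha> \<ge> -1/2" "\<beta> \<ge> -1/2"
  shows "kernel_floor \<alpha> \<beta> > 0" "kernel_floor \<alpha> \<beta> \<le> 1"
proof -
  have "2 powr (-(2 * \<alpha> + 1)) \<le> (2::real) powr 0" "2 powr (-(2 * \<beta> + 1)) \<le> (2::real) powr 0"
    by (rule powr_mono; use assms in simp)+
  then have "2 powr (-(2 * \<alpha> + 1)) * 2 powr (-(2 * \<beta> + 1)) \<le> (1::real)"
    by (intro mult_le_one) auto
  then show "kernel_floor \<alpha> \<beta> \<le> 1" by (simp add: kernel_floor_def)
qed (simp add: kernel_floor_def)

lemma frac_kernel_ge:
  assumes s: "0 < \<sigma>" "\<sigma> < 1" and "\<alpha> \<ge> -1/2" "\<beta> \<ge> -1/2"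
    and th: "0 < \<theta>" "\<theta> < pi" and ph: "0 < \<phi>" "\<phi> < pi" and ne: "\<theta> \<noteq> \<phi>"
  shows "frac_kernel \<sigma> \<alpha> \<beta> \<theta> \<phi> \<ge> kernel_floor \<alpha> \<beta>"
proof -
  note sc = sin_cos_half_pos[OF th] sin_cos_half_pos[OF ph]
  have two: "sin (\<theta> / 2) + sin (\<phi> / 2) \<le> 2" "cos (\<theta> / 2) + cos (\<phi> / 2) \<le> 2"
    using add_mono[OF sc(3,7)] add_mono[OF sc(4,8)] by simp_all
  have "1/4 \<le> \<bar>\<theta> - \<phi>\<bar> powr (\<sigma> - 1)"
  proof -
    have "4 powr (-1) \<le> (4::real) powr (\<sigma> - 1)" using s by (intro powr_mono) auto
    also have "\<dots> \<le> \<bar>\<theta> - \<phi>\<bar> powr (\<sigma> - 1)" using s th ph ne pi_less_4 by (intro powr_mono2') auto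
    finally show ?thesis by (simp add: powr_minus)
  qed
  moreover have "2 powr (-(2 * \<alpha> + 1)) \<le> (sin (\<theta> / 2) + sin (\<phi> / 2)) powr (-(2 * \<alpha> + 1))"
    using sc two assms by (intro powr_mono2') auto
  moreover have "2 powr (-(2 * \<beta> + 1)) \<le> (cos (\<theta> / 2) + cos (\<phi> / 2)) powr (-(2 * \<beta> + 1))"
    using sc two assms by (intro powr_mono2') auto
  ultimately show ?thesis unfolding kernel_floor_def frac_kernel_def endpoint_factor_def
    by (intro mult_mono) auto
qed

lemma powr_exponent_weaken:
  fixes z d e :: real
  assumes "0 < z" "z \<le> 2" "0 \<le> d" "d \<le> e" "e \<le> 1"
  shows "z powr (- d) \<le> 2 * z powr (- e)"
proof -
  have "z powr (- d) = z powr (- e) * z powr (e - d)" by (simp add: powr_add[symmetric])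
  also have "\<dots> \<le> z powr (- e) * 2"
  proof (intro mult_left_mono)
    have "z powr (e - d) \<le> 2 powr (e - d)" using assms by (intro powr_mono2) auto
    also have "2 powr (e - d) \<le> (2::real) powr 1" using assms by (intro powr_mono) auto
    finally show "z powr (e - d) \<le> 2" by simp
  qed simp
  finally show ?thesis by (simp add: mult.commute)
qed

text \<open>D/(D - \<sigma>) is the value of r at the critical relation between p and q. The choice
  of c makes 1 - c equal to (D/(D - \<sigma>) - 1) (D - 1), so that the weighted kernel has degree
  -1 at the end point of dimension D, while c < 1 keeps the diagonal integrable. At an end point of
  smaller dimension the singularity is only weaker.\<close>

lemma weighted_frac_kernel_le:
  assumes s: "0 < \<sigma>" "\<sigma> < 1" and al: "\<alpha> \<ge> -1/2" and be: "\<beta> \<ge> -1/2"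
    and D: "D > 1" "2 * \<alpha> + 2 \<le> D" "2 * \<beta> + 2 \<le> D"
    and r: "1 \<le> r" "r \<le> D / (D - \<sigma>)"
    and th: "0 < \<theta>" "\<theta> < pi" and ph: "0 < \<phi>" "\<phi> < pi"
  defines "c \<equiv> D / (D - \<sigma>) * (1 - \<sigma>)"
  shows "jacobi_weight \<alpha> \<beta> \<phi> * frac_kernel \<sigma> \<alpha> \<beta> \<theta> \<phi> powr r \<le>
    4 * kernel_floor \<alpha> \<beta> powr (- (D / (D - \<sigma>))) *
    (\<bar>\<theta> - \<phi>\<bar> powr (- c) * ((sin (\<theta> / 2) + sin (\<phi> / 2)) powr (- (1 - c)) * (cos (\<theta> / 2) + cos (\<phi> / 2)) powr (- (1 - c))))"
proof (cases "\<theta> = \<phi>")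
  case True
  then show ?thesis using r by (simp add: frac_kernel_def)
next
  case ne: False
  define R where "R = D / (D - \<sigma>)"
  have Ds: "D - \<sigma> > 0" using D s by simp
  have R1: "R - 1 = \<sigma> / (D - \<sigma>)" using Ds by (simp add: R_def field_simps)
  have "\<sigma> / (D - \<sigma>) > 0" using s Ds by simp
  then have R: "R \<ge> 1" using R1 by linarith
  have c1: "1 - c = (R - 1) * (D - 1)" unfolding c_def R_def using Ds by (simp add: field_simps)
  have c: "c \<ge> 0" unfolding c_def using s D Ds by simp
  have cR: "c = R * (1 - \<sigma>)" by (simp add: c_def R_def)
  have c0: "1 - c \<le> 1" using c by simp
  define H h0 where "H = frac_kernel \<sigma> \<alpha> \<beta> \<theta> \<phi>" and "h0 = kernel_floor \<alpha> \<beta>"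
  have h0: "h0 > 0" "h0 \<le> 1" "h0 \<le> H"
    using kernel_floor[OF al be] frac_kernel_ge[OF s al be th ph ne] by (auto simp: h0_def H_def)
  define S1 S2 C1 C2 where "S1 = sin (\<theta> / 2)" and "S2 = sin (\<phi> / 2)" and "C1 = cos (\<theta> / 2)" and "C2 = cos (\<phi> / 2)"
  note sc = sin_cos_half_pos[OF th, folded S1_def C1_def] sin_cos_half_pos[OF ph, folded S2_def C2_def]
  define d where "d = \<bar>\<theta> - \<phi>\<bar>"
  \<comment> \<open>All r are reduced to the critical exponent R. As H may be less than 1, the lower
    bound h0 pays for the difference.\<close>
  have "H powr r = H powr R * H powr (- (R - r))" by (simp add: powr_add[symmetric])
  also have "\<dots> \<le> H powr R * h0 powr (- R)"
  proof (intro mult_left_mono)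
    have "H powr (- (R - r)) \<le> h0 powr (- (R - r))" using h0 r by (intro powr_mono2') (auto simp: R_def)
    also have "\<dots> \<le> h0 powr (- R)" using h0 r by (intro powr_mono') auto
    finally show "H powr (- (R - r)) \<le> h0 powr (- R)" .
  qed simp
  finally have 1: "H powr r \<le> H powr R * h0 powr (- R)" .
  have HR: "H powr R = d powr (- c) * ((S1 + S2) powr (-(2 * \<alpha> + 1) * R) * (C1 + C2) powr (-(2 * \<beta> + 1) * R))"
  proof -
    have e: "(\<sigma> - 1) * R = - c" by (simp add: cR algebra_simps)
    show ?thesis unfolding H_def frac_kernel_def endpoint_factor_def S1_def[symmetric] S2_def[symmetric] C1_def[symmetric] C2_def[symmetric]
       d_def[symmetric] powr_mult powr_powr e ..
  qed
  \<comment> \<open>The density y^a is absorbed by (x + y)^a, leaving the exponent (R - 1) a, which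
    a <= D - 1 bounds by 1 - c.\<close>
  have key: "y powr a * (x + y) powr (- a * R) \<le> 2 * (x + y) powr (- (1 - c))"
    if "0 < x" "0 < y" "x \<le> 1" "y \<le> 1" "0 \<le> a" "a \<le> D - 1" for x y a :: real
  proof -
    have "y powr a * (x + y) powr (- a * R) \<le> (x + y) powr a * (x + y) powr (- a * R)"
      using that by (intro mult_right_mono powr_mono2) auto
    also have "\<dots> = (x + y) powr (- ((R - 1) * a))" unfolding powr_add[symmetric] by (simp add: algebra_simps)
    also have "\<dots> \<le> 2 * (x + y) powr (- (1 - c))"
    proof (rule powr_exponent_weaken)
      show "(R - 1) * a \<le> 1 - c" unfolding c1 using R that by (intro mult_left_mono) auto
    qed (use that R c0 in auto)
    finally show ?thesis .
  qed
  have k1: "S2 powr (2 * \<alpha> + 1) * (S1 + S2) powr (- (2 * \<alpha> + 1) * R) \<le> 2 * (S1 + S2) powr (- (1 - c))"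
    by (rule key) (use sc al D in auto)
  have k2: "C2 powr (2 * \<beta> + 1) * (C1 + C2) powr (- (2 * \<beta> + 1) * R) \<le> 2 * (C1 + C2) powr (- (1 - c))"
    by (rule key) (use sc be D in auto)
  have "jacobi_weight \<alpha> \<beta> \<phi> * H powr r \<le> jacobi_weight \<alpha> \<beta> \<phi> * (H powr R * h0 powr (- R))"
    using jacobi_weight_pos[OF ph, of \<alpha> \<beta>] by (intro mult_left_mono 1) auto
  also have "\<dots> = h0 powr (- R) * d powr (- c) * ((S2 powr (2 * \<alpha> + 1) * (S1 + S2) powr (- (2 * \<alpha> + 1) * R)) *
      (C2 powr (2 * \<beta> + 1) * (C1 + C2) powr (- (2 * \<beta> + 1) * R)))"
    unfolding HR jacobi_weight_def S2_def[symmetric] C2_def[symmetric] by (simp only: mult_ac)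
  also have "\<dots> \<le> h0 powr (- R) * d powr (- c) * ((2 * (S1 + S2) powr (- (1 - c))) * (2 * (C1 + C2) powr (- (1 - c))))"
    by (intro mult_left_mono mult_mono k1 k2) auto
  also have "\<dots> = 4 * h0 powr (- R) * (d powr (- c) * ((S1 + S2) powr (- (1 - c)) * (C1 + C2) powr (- (1 - c))))"
    by simp
  finally show ?thesis unfolding H_def h0_def R_def d_def S1_def S2_def C1_def C2_def .
qed

lemma singular_weight_ge:
  assumes th: "0 < \<theta>" "\<theta> < pi" and g: "0 \<le> g"
  shows "\<theta> powr (- g) \<le> singular_weight g \<theta>" "(pi - \<theta>) powr (- g) \<le> singular_weight g \<theta>"
proof -
  note sc = sin_cos_half_pos[OF th]
  have "sin (\<theta> / 2) * cos (\<theta> / 2) \<le> sin (\<theta> / 2) * 1" using sc by (intro mult_left_mono) auto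
  also have "\<dots> \<le> \<theta>" using sin_x_le_x[of "\<theta> / 2"] th by simp
  finally show "\<theta> powr (- g) \<le> singular_weight g \<theta>" unfolding singular_weight_def
    using sc g by (intro powr_mono2') auto
  have "sin (\<theta> / 2) * cos (\<theta> / 2) \<le> 1 * cos (\<theta> / 2)" using sc by (intro mult_right_mono) auto
  also have "\<dots> \<le> pi - \<theta>" using sin_x_le_x[of "(pi - \<theta>) / 2"] th by (simp add: cos_half_eq)
  finally show "(pi - \<theta>) powr (- g) \<le> singular_weight g \<theta>" unfolding singular_weight_def
    using sc g by (intro powr_mono2') auto
qed

text \<open>20480 = 2 * 4 * 2560, from the two end points, \<open>weighted_frac_kernel_le\<close>
  and \<open>singular_product_le\<close>.\<close>

definition schur_const :: "real \<Rightarrow> real \<Rightarrow> real \<Rightarrow> real \<Rightarrow> real \<Rightarrow> real" where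
  "schur_const \<sigma> \<alpha> \<beta> D g0 = 20480 * kernel_floor \<alpha> \<beta> powr (- (D / (D - \<sigma>))) *
     (4 + 4 / (1 - D / (D - \<sigma>) * (1 - \<sigma>)) + 2 / g0)"

lemma frac_kernel_measurable [measurable]:
  "(\<lambda>\<phi>. frac_kernel \<sigma> \<alpha> \<beta> \<theta> \<phi>) \<in> borel_measurable borel"
  unfolding frac_kernel_def endpoint_factor_def by measurable

lemma frac_kernel_measurable_pair:
  "(\<lambda>(x, y). frac_kernel \<sigma> \<alpha> \<beta> x y) \<in> borel_measurable (jacobi_measure \<alpha> \<beta> \<Otimes>\<^sub>M jacobi_measure \<alpha> \<beta>)"
proof -
  let ?M = "jacobi_measure \<alpha> \<beta>"
  have idm: "(\<lambda>x. x) \<in> borel_measurable ?M" by (rule measurable_jacobi_measure) simp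
  have [measurable]: "fst \<in> borel_measurable (?M \<Otimes>\<^sub>M ?M)" "snd \<in> borel_measurable (?M \<Otimes>\<^sub>M ?M)"
    using measurable_compose[OF measurable_fst idm] measurable_compose[OF measurable_snd idm] by auto
  show ?thesis unfolding frac_kernel_def endpoint_factor_def split_beta by measurable
qed

lemma singular_weight_measurable [measurable]: "singular_weight g \<in> borel_measurable borel"
  unfolding singular_weight_def[abs_def] by measurable

lemma hom_kernel_measurable [measurable]: "hom_kernel c g x \<in> borel_measurable borel"
  unfolding hom_kernel_def[abs_def] by measurable

text \<open>The two homogeneous kernels reproduce \<theta>^(-g) and (pi - \<theta>)^(-g), both
  dominated by \<open>singular_weight g \<theta>\<close>. The reflection at pi/2 brings the second
  integral to the half-line.\<close>

lemma schur_bound: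
  assumes s: "0 < \<sigma>" "\<sigma> < 1" and al: "\<alpha> \<ge> -1/2" and be: "\<beta> \<ge> -1/2"
    and D: "D > 1" "2 * \<alpha> + 2 \<le> D" "2 * \<beta> + 2 \<le> D"
    and r: "1 \<le> r" "r \<le> D / (D - \<sigma>)" and g: "0 < g0" "g0 \<le> g" "g \<le> 1/2"
    and th: "0 < \<theta>" "\<theta> < pi"
  shows "(\<integral>\<^sup>+\<phi>. ennreal (frac_kernel \<sigma> \<alpha> \<beta> \<theta> \<phi> powr r * singular_weight g \<phi>) \<partial>jacobi_measure \<alpha> \<beta>) \<le>
    ennreal (schur_const \<sigma> \<alpha> \<beta> D g0 * singular_weight g \<theta>)"
proof -
  define c where "c = D / (D - \<sigma>) * (1 - \<sigma>)"
  define K where "K = 4 * kernel_floor \<alpha> \<beta> powr (- (D / (D - \<sigma>))) * 2560"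
  define J where "J = 4 + 4 / (1 - c) + 2 / g0"
  have Ds: "D - \<sigma> > 0" using D s by simp
  have c: "0 \<le> c" "c < 1"
  proof -
    show "0 \<le> c" unfolding c_def using s D Ds by simp
    have "D * (1 - \<sigma>) < D - \<sigma>" using D s by (simp add: algebra_simps)
    then show "c < 1" unfolding c_def using Ds by (simp add: divide_less_eq)
  qed
  have K: "K \<ge> 0" by (simp add: K_def)
  have J: "J \<ge> 0" using c g by (simp add: J_def)
  have th': "0 < pi - \<theta>" "pi - \<theta> < pi" using th by auto
  let ?f1 = "\<lambda>\<phi>. ennreal (hom_kernel c g \<theta> \<phi>) * indicator {0<..} \<phi>"
  let ?f2 = "\<lambda>\<phi>. ennreal (hom_kernel c g (pi - \<theta>) \<phi>) * indicator {0<..} \<phi>"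
  have "(\<integral>\<^sup>+\<phi>. ennreal (frac_kernel \<sigma> \<alpha> \<beta> \<theta> \<phi> powr r * singular_weight g \<phi>) \<partial>jacobi_measure \<alpha> \<beta>) =
    (\<integral>\<^sup>+\<phi>. (ennreal (jacobi_weight \<alpha> \<beta> \<phi>) * ennreal (frac_kernel \<sigma> \<alpha> \<beta> \<theta> \<phi> powr r * singular_weight g \<phi>)) * indicator {0<..<pi} \<phi> \<partial>lborel)"
    by (rule nn_integral_jacobi_measure[where a = \<alpha> and b = \<beta>], rule measurable_jacobi_measure) measurable
  also have "\<dots> \<le> (\<integral>\<^sup>+\<phi>. ennreal K * (?f1 \<phi> + ?f2 (pi + (-1) * \<phi>)) \<partial>lborel)"
  proof (rule nn_integral_mono)
    fix \<phi> :: real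
    show "(ennreal (jacobi_weight \<alpha> \<beta> \<phi>) * ennreal (frac_kernel \<sigma> \<alpha> \<beta> \<theta> \<phi> powr r * singular_weight g \<phi>)) * indicator {0<..<pi} \<phi>
      \<le> ennreal K * (?f1 \<phi> + ?f2 (pi + (-1) * \<phi>))"
    proof (cases "\<phi> \<in> {0<..<pi}")
      case True
      then have ph: "0 < \<phi>" "\<phi> < pi" by auto
      have sw: "singular_weight g \<phi> \<ge> 0" by (simp add: singular_weight_def)
      have "jacobi_weight \<alpha> \<beta> \<phi> * frac_kernel \<sigma> \<alpha> \<beta> \<theta> \<phi> powr r * singular_weight g \<phi> \<le>
        4 * kernel_floor \<alpha> \<beta> powr (- (D / (D - \<sigma>))) *
        (\<bar>\<theta> - \<phi>\<bar> powr (- c) * ((sin (\<theta> / 2) + sin (\<phi> / 2)) powr (- (1 - c)) * (cos (\<theta> / 2) + cos (\<phi> / 2)) powr (- (1 - c)))) * singular_weight g \<phi>"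
        unfolding c_def by (intro mult_right_mono weighted_frac_kernel_le s al be D r th ph sw)
      also have "\<dots> = 4 * kernel_floor \<alpha> \<beta> powr (- (D / (D - \<sigma>))) *
        (\<bar>\<theta> - \<phi>\<bar> powr (- c) * ((sin (\<theta> / 2) + sin (\<phi> / 2)) powr (- (1 - c)) * (cos (\<theta> / 2) + cos (\<phi> / 2)) powr (- (1 - c))) * singular_weight g \<phi>)"
        by (simp only: mult.assoc)
      also have "\<dots> \<le> 4 * kernel_floor \<alpha> \<beta> powr (- (D / (D - \<sigma>))) * (2560 * (hom_kernel c g \<theta> \<phi> + hom_kernel c g (pi - \<theta>) (pi - \<phi>)))"
        by (intro mult_left_mono singular_product_le th ph c) (use g in auto)
      also have "\<dots> = K * (hom_kernel c g \<theta> \<phi> + hom_kernel c g (pi - \<theta>) (pi - \<phi>))" by (simp add: K_def)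
      finally have "ennreal (jacobi_weight \<alpha> \<beta> \<phi> * frac_kernel \<sigma> \<alpha> \<beta> \<theta> \<phi> powr r * singular_weight g \<phi>) \<le>
         ennreal (K * (hom_kernel c g \<theta> \<phi> + hom_kernel c g (pi - \<theta>) (pi - \<phi>)))" by (rule ennreal_leI)
      also have "\<dots> = ennreal K * (ennreal (hom_kernel c g \<theta> \<phi>) + ennreal (hom_kernel c g (pi - \<theta>) (pi - \<phi>)))"
        using K by (simp add: ennreal_mult ennreal_plus hom_kernel_nonneg)
      finally show ?thesis using True jacobi_weight_pos[OF ph, of \<alpha> \<beta>] sw
        by (simp add: ennreal_mult[symmetric] mult.assoc)
    qed simp
  qed
  also have "\<dots> = ennreal K * ((\<integral>\<^sup>+\<phi>. ?f1 \<phi> \<partial>lborel) + (\<integral>\<^sup>+\<phi>. ?f2 (pi + (-1) * \<phi>) \<partial>lborel))"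
    by (simp add: nn_integral_cmult nn_integral_add)
  also have "(\<integral>\<^sup>+\<phi>. ?f2 (pi + (-1) * \<phi>) \<partial>lborel) = (\<integral>\<^sup>+\<phi>. ?f2 \<phi> \<partial>lborel)"
    using nn_integral_real_affine[of ?f2 "-1" pi] by simp
  also have "ennreal K * ((\<integral>\<^sup>+\<phi>. ?f1 \<phi> \<partial>lborel) + (\<integral>\<^sup>+\<phi>. ?f2 \<phi> \<partial>lborel)) \<le>
     ennreal K * (ennreal (J * \<theta> powr (- g)) + ennreal (J * (pi - \<theta>) powr (- g)))"
    unfolding J_def by (intro mult_left_mono add_mono nn_integral_hom_kernel c g th th') simp
  also have "\<dots> \<le> ennreal K * (ennreal (J * singular_weight g \<theta>) + ennreal (J * singular_weight g \<theta>))"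
    by (intro mult_left_mono add_mono ennreal_leI singular_weight_ge th J) (use g in auto)
  also have "\<dots> = ennreal (K * (J * singular_weight g \<theta> + J * singular_weight g \<theta>))"
    using K J by (simp add: ennreal_mult[symmetric] ennreal_plus[symmetric] singular_weight_def del: ennreal_plus)
  also have "K * (J * singular_weight g \<theta> + J * singular_weight g \<theta>) = schur_const \<sigma> \<alpha> \<beta> D g0 * singular_weight g \<theta>"
    by (simp add: schur_const_def K_def J_def c_def algebra_simps)
  finally show ?thesis .
qed

lemma conjugate_exponent_facts:
  fixes p p0 :: real
  assumes "1 < p0" "p0 < p"
  shows "1 < p / (p - 1)" "p / (p - 1) \<le> p0 / (p0 - 1)"
proof -
  have p: "1 < p" using assms by simp
  then show "1 < p / (p - 1)" by (simp add: field_simps)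
  have "p / (p - 1) = 1 + 1 / (p - 1)" "p0 / (p0 - 1) = 1 + 1 / (p0 - 1)" using assms by (simp_all add: field_simps)
  moreover have "1 / (p - 1) \<le> 1 / (p0 - 1)" using assms by (intro divide_left_mono) auto
  ultimately show "p / (p - 1) \<le> p0 / (p0 - 1)" by simp
qed

text \<open>The Schur test uses the kernel to the power r with 1/r = 1 - 1/p + 1/q, and the relation
  between p and q says exactly r <= D/(D - \<sigma>). The weight occurs with the powers q and p/(p -
  1), both between 1 and m.\<close>

lemma frac_operator_bounded:
  assumes s: "0 < \<sigma>" "\<sigma> < 1" and al: "\<alpha> \<ge> -1/2" and be: "\<beta> > -1/2"
  shows "\<exists>C\<ge>1. \<forall>p q F. max ((2*\<alpha>+2) / (\<alpha>+3/2)) ((2*\<beta>+2) / (\<beta>+3/2)) < p \<longrightarrow> p \<le> q \<longrightarrow>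
       ereal q < min (upper_exponent \<alpha>) (upper_exponent \<beta>) \<longrightarrow>
       1 / q \<ge> 1 / p - min (\<sigma> / (2*\<alpha>+2)) (\<sigma> / (2*\<beta>+2)) \<longrightarrow>
       F \<in> borel_measurable (jacobi_measure \<alpha> \<beta>) \<longrightarrow>
       eLp_norm q (jacobi_measure \<alpha> \<beta>) (\<lambda>\<theta>. \<integral>\<^sup>+\<phi>. ennreal (frac_kernel \<sigma> \<alpha> \<beta> \<theta> \<phi>) * F \<phi> \<partial>jacobi_measure \<alpha> \<beta>)
       \<le> ennreal C * eLp_norm p (jacobi_measure \<alpha> \<beta>) F"
proof -
  define D where "D = max (2*\<alpha>+2) (2*\<beta>+2)"
  \<comment> \<open>p0 and Q involve \<beta> alone: for \<alpha> = -1/2 the corresponding limits are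
    1 and infinity and would bound neither p/(p - 1) nor q.\<close>
  define p0 where "p0 = (2*\<beta>+2) / (\<beta>+3/2)"
  define Q where "Q = (2*\<beta>+2) / (\<beta>+1/2)"
  define m where "m = max (p0 / (p0 - 1)) Q"
  \<comment> \<open>Chosen so that g0 * z lies between g0 and 1/2 for all z between 1 and m.\<close>
  define g0 where "g0 = 1 / (2 * m)"
  define C where "C = max 1 (schur_const \<sigma> \<alpha> \<beta> D g0)"
  have D: "D > 1" "2 * \<alpha> + 2 \<le> D" "2 * \<beta> + 2 \<le> D" using be by (auto simp: D_def)
  have Ds: "D - \<sigma> > 0" using D s by simp
  have p0: "p0 > 1" using be by (simp add: p0_def field_simps)
  have m: "m > 1" using p0 by (simp add: m_def less_max_iff_disj field_simps)
  have g0: "g0 > 0" using m by (simp add: g0_def)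
  have gm: "g0 * m = 1/2" using m by (simp add: g0_def)
  interpret finite_measure "jacobi_measure \<alpha> \<beta>" using finite_jacobi_measure al be by simp
  let ?M = "jacobi_measure \<alpha> \<beta>"
  have sf: "sigma_finite_measure ?M" ..
  note Km = frac_kernel_measurable_pair[of \<sigma> \<alpha> \<beta>]
  have "eLp_norm q ?M (\<lambda>\<theta>. \<integral>\<^sup>+\<phi>. ennreal (frac_kernel \<sigma> \<alpha> \<beta> \<theta> \<phi>) * F \<phi> \<partial>?M) \<le> ennreal C * eLp_norm p ?M F"
    if p: "max ((2*\<alpha>+2) / (\<alpha>+3/2)) ((2*\<beta>+2) / (\<beta>+3/2)) < p" and q: "p \<le> q"
      and uq: "ereal q < min (upper_exponent \<alpha>) (upper_exponent \<beta>)"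
      and pq: "1 / q \<ge> 1 / p - min (\<sigma> / (2*\<alpha>+2)) (\<sigma> / (2*\<beta>+2))" and F: "F \<in> borel_measurable ?M" for p q F
  proof -
    have pp: "p0 < p" using p by (simp add: p0_def)
    have p1: "1 < p" using pp p0 by simp
    have q1: "1 < q" using p1 q by simp
    have qQ: "q < Q" using uq be by (simp add: upper_exponent_def Q_def)
    have "min (\<sigma> / (2*\<alpha>+2)) (\<sigma> / (2*\<beta>+2)) \<le> \<sigma> / D" by (auto simp: D_def max_def min_def)
    then have pqD: "1 / p - 1 / q \<le> \<sigma> / D" using pq by linarith
    define t where "t = 1 - 1 / p + 1 / q"
    have t: "t \<ge> (D - \<sigma>) / D" "t \<le> 1"
    proof -
      have "(D - \<sigma>) / D = 1 - \<sigma> / D" using D by (simp add: diff_divide_distrib)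
      then show "t \<ge> (D - \<sigma>) / D" using pqD by (simp add: t_def)
      have "1 / q \<le> 1 / p" using p1 q by (intro divide_left_mono) auto
      then show "t \<le> 1" by (simp add: t_def)
    qed
    have DD: "(D - \<sigma>) / D > 0" using D Ds by simp
    have t0: "t > 0" using t DD by linarith
    define r where "r = 1 / t"
    have r: "1 \<le> r" "r \<le> D / (D - \<sigma>)"
    proof -
      show "1 \<le> r" using t t0 by (simp add: r_def)
      have "1 / t \<le> 1 / ((D - \<sigma>) / D)" using t DD by (intro frac_le) auto
      then show "r \<le> D / (D - \<sigma>)" by (simp add: r_def)
    qed
    have rt: "r * (1 - 1 / p + 1 / q) = 1" using t0 by (simp add: r_def t_def[symmetric])
    have gg: "g0 \<le> g0 * z" "g0 * z \<le> 1/2" if "1 \<le> z" "z \<le> m" for z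
    proof -
      show "g0 \<le> g0 * z" using that g0 by simp
      have "g0 * z \<le> g0 * m" using that g0 by (intro mult_left_mono) auto
      then show "g0 * z \<le> 1/2" by (simp add: gm)
    qed
    have v: "singular_weight g0 \<theta> powr z = singular_weight (g0 * z) \<theta>" for \<theta> z
      by (simp add: singular_weight_def powr_powr)
    have B: "(\<integral>\<^sup>+\<phi>. ennreal (frac_kernel \<sigma> \<alpha> \<beta> \<theta> \<phi> powr r * singular_weight g0 \<phi> powr z) \<partial>?M) \<le> ennreal (C * singular_weight g0 \<theta> powr z)"
      if z: "1 \<le> z" "z \<le> m" and th: "\<theta> \<in> space ?M" for z \<theta>
    proof -
      have "(\<integral>\<^sup>+\<phi>. ennreal (frac_kernel \<sigma> \<alpha> \<beta> \<theta> \<phi> powr r * singular_weight g0 \<phi> powr z) \<partial>?M) \<le>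
        ennreal (schur_const \<sigma> \<alpha> \<beta> D g0 * singular_weight (g0 * z) \<theta>)"
        unfolding v by (rule schur_bound[OF s al less_imp_le[OF be] D r g0 gg[OF z]]) (use th in auto)
      also have "\<dots> \<le> ennreal (C * singular_weight g0 \<theta> powr z)"
        unfolding v by (intro ennreal_leI mult_right_mono) (auto simp: C_def singular_weight_def)
      finally show ?thesis .
    qed
    have cp: "1 \<le> p / (p - 1)" "p / (p - 1) \<le> m"
      using conjugate_exponent_facts[OF p0 pp] by (auto simp: m_def)
    have qm: "1 \<le> q" "q \<le> m" using q1 qQ by (auto simp: m_def)
    show ?thesis
    proof (rule schur_test[OF sf p1 q rt Km F, where v = "singular_weight g0"])
      show "singular_weight g0 \<in> borel_measurable ?M" by (rule measurable_jacobi_measure) simp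
      show "frac_kernel \<sigma> \<alpha> \<beta> x y \<ge> 0" for x y by (rule frac_kernel_nonneg)
      show "frac_kernel \<sigma> \<alpha> \<beta> x y = frac_kernel \<sigma> \<alpha> \<beta> y x" for x y by (rule frac_kernel_sym)
      show "singular_weight g0 y > 0" if "y \<in> space ?M" for y
        using sin_cos_half_pos[of y] that by (simp add: singular_weight_def)
      show "C \<ge> 1" by (simp add: C_def)
    qed (use B[OF qm] B[OF cp] in auto)
  qed
  then show ?thesis by (intro exI[of _ C]) (auto simp: C_def)
qed

section \<open>The vector-valued inequality\<close>

lemma epowr_square_half: "epowr (R\<^sup>2) (1 / 2) = R"
proof (cases R)
  case (real r)
  then show ?thesis by (simp add: ennreal_power epowr_ennreal powr_half_sqrt)
qed (simp add: epowr_def)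

lemma epowr_half_cmult:
  assumes "c \<ge> 0"
  shows "epowr ((ennreal c)\<^sup>2 * S) (1 / 2) = ennreal c * epowr S (1 / 2)"
proof (cases "c = 0")
  case False
  then have "epowr (ennreal (c\<^sup>2) * S) (1 / 2) = ennreal (c\<^sup>2 powr (1 / 2)) * epowr S (1 / 2)"
    using assms by (intro epowr_cmult) auto
  then show ?thesis using assms by (simp add: ennreal_power powr_half_sqrt)
qed simp

text \<open>Cauchy-Schwarz for extended sequences: if the right-hand side is finite, so is every
  \<open>g j\<close>, and the real inequality applies.\<close>

lemma l2_pairing_le:
  fixes g :: "nat \<Rightarrow> ennreal" and e :: "nat \<Rightarrow> real"
  assumes e: "\<And>j. e j \<ge> 0" "(\<Sum>j<N. (e j)\<^sup>2) \<le> 1"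
  shows "(\<Sum>j<N. ennreal (e j) * g j) \<le> epowr (\<Sum>j. (g j)\<^sup>2) (1 / 2)"
proof (cases "(\<Sum>j. (g j)\<^sup>2)")
  case (real \<tau>)
  have le: "(g j)\<^sup>2 \<le> ennreal \<tau>" for j
  proof -
    have "(g j)\<^sup>2 = (\<Sum>i\<in>{j}. (g i)\<^sup>2)" by simp
    also have "\<dots> \<le> (\<Sum>i. (g i)\<^sup>2)" by (rule sum_le_suminf) auto
    finally show ?thesis by (simp add: real)
  qed
  define y where "y j = enn2real (g j)" for j
  have gy: "g j = ennreal (y j)" for j
  proof -
    have "g j \<noteq> \<infinity>" using le[of j] by (auto simp: power2_eq_square top_unique)
    then show ?thesis by (simp add: y_def top.not_eq_extremum)
  qed
  have y0: "y j \<ge> 0" for j by (simp add: y_def)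
  have "ennreal (\<Sum>j<N. (y j)\<^sup>2) = (\<Sum>j<N. (g j)\<^sup>2)"
    using y0 by (simp add: gy ennreal_power sum_ennreal)
  also have "\<dots> \<le> (\<Sum>j. (g j)\<^sup>2)" by (rule sum_le_suminf) auto
  finally have ys: "(\<Sum>j<N. (y j)\<^sup>2) \<le> \<tau>" using real by simp
  have "(\<Sum>j<N. e j * y j)\<^sup>2 \<le> (\<Sum>j<N. (e j)\<^sup>2) * (\<Sum>j<N. (y j)\<^sup>2)" by (rule Cauchy_Schwarz_ineq_sum)
  also have "\<dots> \<le> 1 * \<tau>" using e ys by (intro mult_mono) (auto intro: sum_nonneg)
  finally have "(\<Sum>j<N. e j * y j) \<le> sqrt \<tau>" by (intro real_le_rsqrt) simp
  moreover have "(\<Sum>j<N. ennreal (e j) * g j) = ennreal (\<Sum>j<N. e j * y j)"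
    using e y0 by (simp add: gy ennreal_mult[symmetric] sum_ennreal)
  moreover have "epowr (\<Sum>j. (g j)\<^sup>2) (1 / 2) = ennreal (sqrt \<tau>)"
    using real by (simp add: epowr_ennreal powr_half_sqrt)
  ultimately show ?thesis by (simp add: ennreal_leI)
qed (simp add: epowr_def)

text \<open>Duality: the norm of the first N integrals is their pairing with a unit vector e. The
  pairing moves inside the integral, where \<open>l2_pairing_le\<close> applies pointwise; the
  supremum over N gives the series.\<close>

lemma minkowski_l2:
  fixes G :: "nat \<Rightarrow> 'a \<Rightarrow> ennreal"
  assumes [measurable]: "\<And>j. G j \<in> borel_measurable M"
  shows "epowr (\<Sum>j. (\<integral>\<^sup>+x. G j x \<partial>M)\<^sup>2) (1 / 2) \<le> (\<integral>\<^sup>+x. epowr (\<Sum>j. (G j x)\<^sup>2) (1 / 2) \<partial>M)"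
proof -
  define I where "I j = (\<integral>\<^sup>+x. G j x \<partial>M)" for j
  define R where "R = (\<integral>\<^sup>+x. epowr (\<Sum>j. (G j x)\<^sup>2) (1 / 2) \<partial>M)"
  have "(\<Sum>j<N. (I j)\<^sup>2) \<le> R\<^sup>2" for N
  proof (cases "R = \<infinity>")
    case True
    then show ?thesis by simp
  next
    case False
    \<comment> \<open>Serves finiteness, so that the integrals may be treated as real
      numbers.\<close>
    have IR: "I j \<le> R" for j
      unfolding I_def R_def
    proof (rule nn_integral_mono)
      fix x
      have "(G j x)\<^sup>2 = (\<Sum>i\<in>{j}. (G i x)\<^sup>2)" by simp
      also have "\<dots> \<le> (\<Sum>i. (G i x)\<^sup>2)" by (rule sum_le_suminf) auto
      finally have "epowr ((G j x)\<^sup>2) (1 / 2) \<le> epowr (\<Sum>i. (G i x)\<^sup>2) (1 / 2)" by (rule epowr_mono) simp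
      then show "G j x \<le> epowr (\<Sum>i. (G i x)\<^sup>2) (1 / 2)" by (simp only: epowr_square_half)
    qed
    define i where "i j = enn2real (I j)" for j
    have Ii: "I j = ennreal (i j)" for j
    proof -
      have "I j < top" using IR[of j] False by (auto simp: top.not_eq_extremum intro: le_less_trans)
      then show ?thesis by (simp add: i_def)
    qed
    have i0: "i j \<ge> 0" for j by (simp add: i_def)
    define n where "n = sqrt (\<Sum>j<N. (i j)\<^sup>2)"
    have n2: "n\<^sup>2 = (\<Sum>j<N. (i j)\<^sup>2)" unfolding n_def by (simp add: sum_nonneg)
    have n0: "n \<ge> 0" by (simp add: n_def sum_nonneg)
    have "ennreal n \<le> R"
    proof (cases "n = 0")
      case False
      define e where "e j = i j / n" for j
      have e: "e j \<ge> 0" for j using i0 n0 by (simp add: e_def)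
      have "(\<Sum>j<N. (e j)\<^sup>2) = (\<Sum>j<N. (i j)\<^sup>2) / n\<^sup>2" by (simp add: e_def power_divide sum_divide_distrib)
      also have "\<dots> = 1" using False by (simp add: n2[symmetric])
      finally have e1: "(\<Sum>j<N. (e j)\<^sup>2) \<le> 1" by simp
      have "(\<Sum>j<N. e j * i j) = (\<Sum>j<N. (i j)\<^sup>2) / n" by (simp add: e_def power2_eq_square sum_divide_distrib)
      also have "\<dots> = n" unfolding n2[symmetric] using False by (simp add: power2_eq_square)
      finally have "ennreal n = ennreal (\<Sum>j<N. e j * i j)" by simp
      also have "\<dots> = (\<Sum>j<N. ennreal (e j) * I j)" using e i0 by (simp add: Ii ennreal_mult[symmetric] sum_ennreal)
      also have "\<dots> = (\<integral>\<^sup>+x. (\<Sum>j<N. ennreal (e j) * G j x) \<partial>M)"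
        unfolding I_def by (simp add: nn_integral_sum nn_integral_cmult)
      also have "\<dots> \<le> R" unfolding R_def by (intro nn_integral_mono l2_pairing_le e e1)
      finally show ?thesis .
    qed simp
    then have "(ennreal n)\<^sup>2 \<le> R\<^sup>2" by (rule power_mono) simp
    moreover have "(ennreal n)\<^sup>2 = (\<Sum>j<N. (I j)\<^sup>2)"
      using n0 i0 by (simp add: ennreal_power n2 Ii sum_ennreal)
    ultimately show ?thesis by simp
  qed
  then have "(\<Sum>j. (I j)\<^sup>2) \<le> R\<^sup>2" unfolding suminf_eq_SUP by (intro SUP_least)
  then have "epowr (\<Sum>j. (I j)\<^sup>2) (1 / 2) \<le> epowr (R\<^sup>2) (1 / 2)" by (rule epowr_mono) simp
  then show ?thesis unfolding epowr_square_half I_def R_def .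
qed

section \<open>Transplantation\<close>

text \<open>Iterated \<open>deriv\<close> gives no direct access to measurability. On the open
  interval the Jacobi functions are polynomials in the square of sin (\<phi>/2), and these are
  measurable on the whole line.\<close>

lemma jacobi_kernel_measurable:
  "(\<lambda>\<phi>. jacobi_kernel \<sigma> a b \<theta> \<phi>) \<in> borel_measurable (jacobi_measure \<alpha> \<beta>)"
proof -
  define J where "J n \<phi> = jacobi_d n a b * poly (jacobi_poly n a b) ((sin (\<phi> / 2))\<^sup>2)" for n and \<phi> :: real
  have [measurable]: "poly p \<in> borel_measurable borel" for p :: "real poly"
    by (intro borel_measurable_continuous_onI continuous_intros)
  have [measurable]: "J n \<in> borel_measurable borel" for n
    unfolding J_def[abs_def] by measurable
  define K where "K \<phi> = 1 / Gamma \<sigma> * (LINT t:{0<..}|lborel.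
        (\<Sum>n. exp (- t * \<bar>real n + (a + b + 1) / 2\<bar>) * jacobi_fun n a b \<theta> * J n \<phi>) / t powr (1 - \<sigma>))" for \<phi>
  have "K \<in> borel_measurable borel"
    unfolding K_def[abs_def] set_lebesgue_integral_def
    by (intro borel_measurable_times borel_measurable_const lborel.borel_measurable_lebesgue_integral) measurable
  then have "K \<in> borel_measurable (jacobi_measure \<alpha> \<beta>)" by (rule measurable_jacobi_measure)
  also have "K \<in> borel_measurable (jacobi_measure \<alpha> \<beta>) \<longleftrightarrow> ?thesis"
    by (rule measurable_cong) (simp add: K_def J_def jacobi_kernel_def jacobi_fun_eq)
  finally show ?thesis .
qed

lemma jacobi_u_pos: "0 < \<theta> \<Longrightarrow> \<theta> < pi \<Longrightarrow> jacobi_u a b j \<theta> > 0"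
  using sin_cos_half_pos[of \<theta>] by (simp add: jacobi_u_def)

lemma jacobi_u_measurable [measurable]: "jacobi_u a b j \<in> borel_measurable borel"
  unfolding jacobi_u_def[abs_def] by measurable

text \<open>Of the two factors \<open>jacobi_u\<close> gained from the density, one cancels the
  division by \<open>jacobi_u\<close> and the other makes the transplanted kernel symmetric.\<close>

lemma jacobi_weight_shift:
  "jacobi_weight (\<alpha> + a * real j) (\<beta> + b * real j) \<phi> = (jacobi_u a b j \<phi>)\<^sup>2 * jacobi_weight \<alpha> \<beta> \<phi>"
proof -
  have e: "2 * (\<alpha> + a * real j) + 1 = a * real j + a * real j + (2 * \<alpha> + 1)"
    "2 * (\<beta> + b * real j) + 1 = b * real j + b * real j + (2 * \<beta> + 1)" by simp_all
  show ?thesis unfolding jacobi_weight_def jacobi_u_def e powr_add power2_eq_square by (simp only: mult_ac)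
qed

lemma transplanted_kernel_le:
  assumes s: "0 < \<sigma>" "\<sigma> < 1" and al: "\<alpha> \<ge> -1/2" and be: "\<beta> > -1/2" and a: "a \<ge> 0" and b: "b \<ge> 0"
    and th: "0 < \<theta>" "\<theta> < pi" and ph: "0 < \<phi>" "\<phi> < pi" and ne: "\<theta> \<noteq> \<phi>"
  shows "jacobi_u a b j \<theta> * jacobi_u a b j \<phi> * \<bar>jacobi_kernel \<sigma> (\<alpha> + a * real j) (\<beta> + b * real j) \<theta> \<phi>\<bar> \<le>
    kernel_const \<sigma> \<alpha> \<beta> * frac_kernel \<sigma> \<alpha> \<beta> \<theta> \<phi>"
proof -
  let ?a = "\<alpha> + a * real j" and ?b = "\<beta> + b * real j"
  have ab: "?a \<ge> \<alpha>" "?b \<ge> \<beta>" using a b by auto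
  have "jacobi_u a b j \<theta> * jacobi_u a b j \<phi> =
    (sin (\<theta> / 2) * sin (\<phi> / 2)) powr (?a - \<alpha>) * (cos (\<theta> / 2) * cos (\<phi> / 2)) powr (?b - \<beta>)"
    by (simp add: jacobi_u_def powr_mult)
  then show ?thesis using jacobi_kernel_le[OF s al be ab th ph ne] by (simp add: frac_kernel_def)
qed

text \<open>The left-hand side of the estimate is the integral of the norm, so it serves both the
  existence of the fractional integral and the bound of its size.\<close>

lemma nn_integral_transplanted_le:
  fixes g :: "real \<Rightarrow> complex" and j :: nat
  assumes s: "0 < \<sigma>" "\<sigma> < 1" and al: "\<alpha> \<ge> -1/2" and be: "\<beta> > -1/2" and a: "a \<ge> 0" and b: "b \<ge> 0"
    and th: "0 < \<theta>" "\<theta> < pi" and g: "g \<in> borel_measurable (jacobi_measure \<alpha> \<beta>)"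
    and C: "C \<ge> kernel_const \<sigma> \<alpha> \<beta>" "C \<ge> 0"
  defines "a' \<equiv> \<alpha> + a * real j" and "b' \<equiv> \<beta> + b * real j"
  shows "(\<lambda>\<phi>. jacobi_kernel \<sigma> a' b' \<theta> \<phi> *\<^sub>R (g \<phi> / complex_of_real (jacobi_u a b j \<phi>))) \<in> borel_measurable (jacobi_measure a' b')"
    and "ennreal (jacobi_u a b j \<theta>) * (\<integral>\<^sup>+\<phi>. ennreal (norm (jacobi_kernel \<sigma> a' b' \<theta> \<phi> *\<^sub>R (g \<phi> / complex_of_real (jacobi_u a b j \<phi>)))) \<partial>jacobi_measure a' b')
      \<le> (\<integral>\<^sup>+\<phi>. ennreal (C * frac_kernel \<sigma> \<alpha> \<beta> \<theta> \<phi>) * ennreal (norm (g \<phi>)) \<partial>jacobi_measure \<alpha> \<beta>)"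
proof -
  let ?M = "jacobi_measure \<alpha> \<beta>"
  let ?u = "jacobi_u a b j" and ?K = "\<lambda>\<phi>. jacobi_kernel \<sigma> a' b' \<theta> \<phi>"
  note [measurable] = g
  have [measurable]: "?K \<in> borel_measurable ?M" by (rule jacobi_kernel_measurable)
  have [measurable]: "?u \<in> borel_measurable ?M" "frac_kernel \<sigma> \<alpha> \<beta> \<theta> \<in> borel_measurable ?M"
    by (rule measurable_jacobi_measure; simp)+
  have m: "(\<lambda>\<phi>. ?K \<phi> *\<^sub>R (g \<phi> / complex_of_real (?u \<phi>))) \<in> borel_measurable ?M"
    by measurable
  then show "(\<lambda>\<phi>. ?K \<phi> *\<^sub>R (g \<phi> / complex_of_real (?u \<phi>))) \<in> borel_measurable (jacobi_measure a' b')"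
    unfolding measurable_cong_sets[OF sets_jacobi_measure refl] .
  have u0: "?u \<theta> > 0" by (rule jacobi_u_pos[OF th])
  have "ennreal (?u \<theta>) * (\<integral>\<^sup>+\<phi>. ennreal (norm (?K \<phi> *\<^sub>R (g \<phi> / complex_of_real (?u \<phi>)))) \<partial>jacobi_measure a' b') =
    (\<integral>\<^sup>+\<phi>. ennreal (?u \<theta>) * ennreal (norm (?K \<phi> *\<^sub>R (g \<phi> / complex_of_real (?u \<phi>)))) \<partial>jacobi_measure a' b')"
  proof (rule nn_integral_cmult[symmetric])
    show "(\<lambda>\<phi>. ennreal (norm (?K \<phi> *\<^sub>R (g \<phi> / complex_of_real (?u \<phi>))))) \<in> borel_measurable (jacobi_measure a' b')"
      unfolding jacobi_measurable_iff[of a' b' \<alpha> \<beta>] using m by measurable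
  qed
  also have "\<dots> = (\<integral>\<^sup>+\<phi>. (ennreal (jacobi_weight a' b' \<phi>) *
      (ennreal (?u \<theta>) * ennreal (norm (?K \<phi> *\<^sub>R (g \<phi> / complex_of_real (?u \<phi>)))))) * indicator {0<..<pi} \<phi> \<partial>lborel)"
    by (rule nn_integral_jacobi_measure[where a = \<alpha> and b = \<beta>]) measurable
  also have "\<dots> \<le> (\<integral>\<^sup>+\<phi>. (ennreal (jacobi_weight \<alpha> \<beta> \<phi>) *
      (ennreal (C * frac_kernel \<sigma> \<alpha> \<beta> \<theta> \<phi>) * ennreal (norm (g \<phi>)))) * indicator {0<..<pi} \<phi> \<partial>lborel)"
  \<comment> \<open>The kernel bound is known off the diagonal only, where
    \<open>frac_kernel\<close> is not set to 0; the point \<phi> = \<theta> is a null set.\<close>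
  proof (rule nn_integral_mono_AE, rule AE_mp[OF AE_lborel_singleton[of \<theta>]], rule AE_I2, rule impI)
    fix \<phi> :: real assume ne: "\<phi> \<noteq> \<theta>"
    show "(ennreal (jacobi_weight a' b' \<phi>) *
      (ennreal (?u \<theta>) * ennreal (norm (?K \<phi> *\<^sub>R (g \<phi> / complex_of_real (?u \<phi>)))))) * indicator {0<..<pi} \<phi> \<le>
      (ennreal (jacobi_weight \<alpha> \<beta> \<phi>) *
      (ennreal (C * frac_kernel \<sigma> \<alpha> \<beta> \<theta> \<phi>) * ennreal (norm (g \<phi>)))) * indicator {0<..<pi} \<phi>"
    proof (cases "\<phi> \<in> {0<..<pi}")
      case True
      then have ph: "0 < \<phi>" "\<phi> < pi" by auto
      have u: "?u \<phi> > 0" by (rule jacobi_u_pos[OF ph])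
      have w: "jacobi_weight \<alpha> \<beta> \<phi> > 0" by (rule jacobi_weight_pos[OF ph])
      have F0: "C * frac_kernel \<sigma> \<alpha> \<beta> \<theta> \<phi> \<ge> 0" using C frac_kernel_nonneg by (intro mult_nonneg_nonneg) auto
      have "jacobi_weight a' b' \<phi> * (?u \<theta> * norm (?K \<phi> *\<^sub>R (g \<phi> / complex_of_real (?u \<phi>)))) =
        jacobi_weight \<alpha> \<beta> \<phi> * ((?u \<theta> * ?u \<phi> * \<bar>?K \<phi>\<bar>) * norm (g \<phi>))"
        unfolding a'_def b'_def jacobi_weight_shift using u
        by (simp add: norm_divide power2_eq_square)
      also have "\<dots> \<le> jacobi_weight \<alpha> \<beta> \<phi> * ((C * frac_kernel \<sigma> \<alpha> \<beta> \<theta> \<phi>) * norm (g \<phi>))"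
      proof (intro mult_left_mono mult_right_mono)
        have "?u \<theta> * ?u \<phi> * \<bar>?K \<phi>\<bar> \<le> kernel_const \<sigma> \<alpha> \<beta> * frac_kernel \<sigma> \<alpha> \<beta> \<theta> \<phi>"
          unfolding a'_def b'_def by (rule transplanted_kernel_le[OF s al be a b th ph]) (use ne in simp)
        also have "\<dots> \<le> C * frac_kernel \<sigma> \<alpha> \<beta> \<theta> \<phi>" by (intro mult_right_mono C frac_kernel_nonneg)
        finally show "?u \<theta> * ?u \<phi> * \<bar>?K \<phi>\<bar> \<le> C * frac_kernel \<sigma> \<alpha> \<beta> \<theta> \<phi>" .
      qed (use w in auto)
      finally have "ennreal (jacobi_weight a' b' \<phi> * (?u \<theta> * norm (?K \<phi> *\<^sub>R (g \<phi> / complex_of_real (?u \<phi>))))) \<le>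
         ennreal (jacobi_weight \<alpha> \<beta> \<phi> * ((C * frac_kernel \<sigma> \<alpha> \<beta> \<theta> \<phi>) * norm (g \<phi>)))" by (rule ennreal_leI)
      moreover have "ennreal (x * (y * norm z)) = ennreal x * (ennreal y * ennreal (norm z))" if "0 \<le> x" "0 \<le> y" for x y and z :: complex
        using that by (simp add: ennreal_mult)
      ultimately show ?thesis
        using True w u0 F0 jacobi_weight_pos[OF ph, of a' b'] by (simp only: less_imp_le indicator_simps mult_1_right)
    qed simp
  qed
  also have "\<dots> = (\<integral>\<^sup>+\<phi>. ennreal (C * frac_kernel \<sigma> \<alpha> \<beta> \<theta> \<phi>) * ennreal (norm (g \<phi>)) \<partial>?M)"
    by (rule nn_integral_jacobi_measure[where a = \<alpha> and b = \<beta>, symmetric]) measurable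
  finally show "ennreal (?u \<theta>) * (\<integral>\<^sup>+\<phi>. ennreal (norm (?K \<phi> *\<^sub>R (g \<phi> / complex_of_real (?u \<phi>)))) \<partial>jacobi_measure a' b')
      \<le> (\<integral>\<^sup>+\<phi>. ennreal (C * frac_kernel \<sigma> \<alpha> \<beta> \<theta> \<phi>) * ennreal (norm (g \<phi>)) \<partial>?M)" .
qed

lemma frac_operator_measurable:
  assumes al: "\<alpha> \<ge> -1/2" and be: "\<beta> \<ge> -1/2" and F [measurable]: "F \<in> borel_measurable (jacobi_measure \<alpha> \<beta>)"
  shows "(\<lambda>\<theta>. \<integral>\<^sup>+\<phi>. ennreal (frac_kernel \<sigma> \<alpha> \<beta> \<theta> \<phi>) * F \<phi> \<partial>jacobi_measure \<alpha> \<beta>) \<in> borel_measurable (jacobi_measure \<alpha> \<beta>)"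
proof -
  let ?M = "jacobi_measure \<alpha> \<beta>"
  interpret finite_measure ?M using finite_jacobi_measure al be by simp
  have "(\<lambda>z. frac_kernel \<sigma> \<alpha> \<beta> (fst z) (snd z)) \<in> borel_measurable (?M \<Otimes>\<^sub>M ?M)"
    using frac_kernel_measurable_pair[of \<sigma> \<alpha> \<beta>] by (simp add: split_beta)
  moreover have "(\<lambda>z. F (snd z)) \<in> borel_measurable (?M \<Otimes>\<^sub>M ?M)"
    by (rule measurable_compose[OF measurable_snd F])
  ultimately have "(\<lambda>(\<theta>, \<phi>). ennreal (frac_kernel \<sigma> \<alpha> \<beta> \<theta> \<phi>) * F \<phi>) \<in> borel_measurable (?M \<Otimes>\<^sub>M ?M)"
    unfolding split_beta by measurable
  then show ?thesis by (rule borel_measurable_nn_integral)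
qed

theorem theorem1p4:
  fixes \<sigma> \<alpha> \<beta> :: real
  assumes "0 < \<sigma>" and "\<sigma> < 1" and "\<alpha> \<ge> -1/2" and "\<beta> > -1/2"
  shows "\<exists>C::real. C > 0 \<and>
    (\<forall>(a::real) (b::real) (p::real) (q::real) (f :: nat \<Rightarrow> real \<Rightarrow> complex).
       0 \<le> a \<longrightarrow> 0 \<le> b \<longrightarrow>
       1 \<le> max ((2*\<alpha>+2) / (\<alpha>+3/2)) ((2*\<beta>+2) / (\<beta>+3/2)) \<longrightarrow>
       max ((2*\<alpha>+2) / (\<alpha>+3/2)) ((2*\<beta>+2) / (\<beta>+3/2)) < p \<longrightarrow>
       p \<le> q \<longrightarrow>
       ereal q < min (upper_exponent \<alpha>) (upper_exponent \<beta>) \<longrightarrow>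
       1 / q \<ge> 1 / p - min (\<sigma> / (2*\<alpha>+2)) (\<sigma> / (2*\<beta>+2)) \<longrightarrow>
       (\<forall>j. in_Lp p (jacobi_measure \<alpha> \<beta>) (f j)) \<longrightarrow>
       (\<forall>j. AE \<theta> in jacobi_measure \<alpha> \<beta>.
          jacobi_frac_defined \<sigma> (\<alpha> + a * real j) (\<beta> + b * real j)
            (\<lambda>\<phi>. f j \<phi> / complex_of_real (jacobi_u a b j \<phi>)) \<theta>) \<and>
       eLp_norm q (jacobi_measure \<alpha> \<beta>)
         (\<lambda>\<theta>. l2_seq_norm (\<lambda>j. complex_of_real (jacobi_u a b j \<theta>) *
            jacobi_frac \<sigma> (\<alpha> + a * real j) (\<beta> + b * real j)
              (\<lambda>\<phi>. f j \<phi> / complex_of_real (jacobi_u a b j \<phi>)) \<theta>))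
       \<le> ennreal C * eLp_norm p (jacobi_measure \<alpha> \<beta>) (\<lambda>\<theta>. l2_seq_norm (\<lambda>j. f j \<theta>)))"
proof -
  note s = assms(1,2) and al = assms(3) and be = assms(4)
  let ?M = "jacobi_measure \<alpha> \<beta>"
  let ?T = "\<lambda>F \<theta>. \<integral>\<^sup>+\<phi>. ennreal (frac_kernel \<sigma> \<alpha> \<beta> \<theta> \<phi>) * F \<phi> \<partial>?M"
  \<comment> \<open>At least 1, because \<open>eLp_norm_cmult\<close> asks for a positive
    constant.\<close>
  define Ck where "Ck = max 1 (kernel_const \<sigma> \<alpha> \<beta>)"
  have Ck: "Ck \<ge> kernel_const \<sigma> \<alpha> \<beta>" "Ck \<ge> 0" "Ck > 0" by (auto simp: Ck_def)
  obtain C1 where C1: "C1 \<ge> 1" and bound: "\<And>p q F. max ((2*\<alpha>+2) / (\<alpha>+3/2)) ((2*\<beta>+2) / (\<beta>+3/2)) < p \<Longrightarrow> p \<le> q \<Longrightarrow>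
       ereal q < min (upper_exponent \<alpha>) (upper_exponent \<beta>) \<Longrightarrow>
       1 / q \<ge> 1 / p - min (\<sigma> / (2*\<alpha>+2)) (\<sigma> / (2*\<beta>+2)) \<Longrightarrow>
       F \<in> borel_measurable ?M \<Longrightarrow> eLp_norm q ?M (?T F) \<le> ennreal C1 * eLp_norm p ?M F"
    using frac_operator_bounded[OF s al be] by blast
  show ?thesis
  proof (intro exI[of _ "Ck * C1"] conjI allI impI)
    show "0 < Ck * C1" using Ck C1 by simp
  next
    fix a b p q :: real and f :: "nat \<Rightarrow> real \<Rightarrow> complex" and j :: nat
    assume ab: "0 \<le> a" "0 \<le> b"
      and p: "max ((2*\<alpha>+2) / (\<alpha>+3/2)) ((2*\<beta>+2) / (\<beta>+3/2)) < p" and q: "p \<le> q"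
       "ereal q < min (upper_exponent \<alpha>) (upper_exponent \<beta>)"
       "1 / q \<ge> 1 / p - min (\<sigma> / (2*\<alpha>+2)) (\<sigma> / (2*\<beta>+2))"
      and f: "\<forall>j. in_Lp p ?M (f j)"
    let ?F = "\<lambda>\<phi>. ennreal (norm (f j \<phi>))"
    have [measurable]: "f j \<in> borel_measurable ?M" and fL: "eLp_norm p ?M ?F < \<infinity>"
      using f by (auto simp: in_Lp_def)
    \<comment> \<open>The scalar bound for the single function \<open>f j\<close> makes the majorant
      finite almost everywhere, and this is absolute convergence of the transplanted
      integral.\<close>
    have "eLp_norm q ?M (?T ?F) \<le> ennreal C1 * eLp_norm p ?M ?F" by (rule bound[OF p q]) measurable
    also have "\<dots> < \<infinity>" using fL by (simp add: ennreal_mult_less_top)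
    finally have "epowr (\<integral>\<^sup>+ x. epowr (?T ?F x) q \<partial>?M) (1 / q) \<noteq> \<infinity>" by (simp add: eLp_norm_def)
    then have "(\<integral>\<^sup>+ x. epowr (?T ?F x) q \<partial>?M) \<noteq> \<infinity>" by (simp only: epowr_eq_infinity_iff not_False_eq_True)
    moreover have [measurable]: "?T ?F \<in> borel_measurable ?M"
      by (rule frac_operator_measurable) (use al be in auto)
    ultimately have "AE \<theta> in ?M. epowr (?T ?F \<theta>) q \<noteq> \<infinity>" by (intro nn_integral_noteq_infinite) auto
    then show "AE \<theta> in ?M. jacobi_frac_defined \<sigma> (\<alpha> + a * real j) (\<beta> + b * real j)
            (\<lambda>\<phi>. f j \<phi> / complex_of_real (jacobi_u a b j \<phi>)) \<theta>"
      using AE_space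
    proof eventually_elim
      case (elim \<theta>)
      have fin: "?T ?F \<theta> \<noteq> \<infinity>" using elim(1) by (simp only: epowr_eq_infinity_iff not_False_eq_True)
      have th: "0 < \<theta>" "\<theta> < pi" using elim(2) by auto
      note tl = nn_integral_transplanted_le[OF s al be ab th \<open>f j \<in> borel_measurable ?M\<close> Ck(1,2), where j = j]
      have "(\<integral>\<^sup>+\<phi>. ennreal (Ck * frac_kernel \<sigma> \<alpha> \<beta> \<theta> \<phi>) * ?F \<phi> \<partial>?M) = ennreal Ck * ?T ?F \<theta>"
      proof -
        have [measurable]: "frac_kernel \<sigma> \<alpha> \<beta> \<theta> \<in> borel_measurable ?M" by (rule measurable_jacobi_measure) simp
        have "(\<integral>\<^sup>+\<phi>. ennreal (Ck * frac_kernel \<sigma> \<alpha> \<beta> \<theta> \<phi>) * ?F \<phi> \<partial>?M) = (\<integral>\<^sup>+\<phi>. ennreal Ck * (ennreal (frac_kernel \<sigma> \<alpha> \<beta> \<theta> \<phi>) * ?F \<phi>) \<partial>?M)"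
          using Ck by (simp add: ennreal_mult frac_kernel_nonneg mult.assoc)
        then show ?thesis by (simp add: nn_integral_cmult)
      qed
      also have "\<dots> < \<infinity>" using fin by (simp add: ennreal_mult_less_top top.not_eq_extremum)
      finally have "ennreal (jacobi_u a b j \<theta>) * (\<integral>\<^sup>+\<phi>. ennreal (norm (jacobi_kernel \<sigma> (\<alpha> + a * real j) (\<beta> + b * real j) \<theta> \<phi> *\<^sub>R
          (f j \<phi> / complex_of_real (jacobi_u a b j \<phi>)))) \<partial>jacobi_measure (\<alpha> + a * real j) (\<beta> + b * real j)) < \<infinity>"
        using tl(2) by (rule le_less_trans[rotated])
      then have "(\<integral>\<^sup>+\<phi>. ennreal (norm (jacobi_kernel \<sigma> (\<alpha> + a * real j) (\<beta> + b * real j) \<theta> \<phi> *\<^sub>R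
          (f j \<phi> / complex_of_real (jacobi_u a b j \<phi>)))) \<partial>jacobi_measure (\<alpha> + a * real j) (\<beta> + b * real j)) < \<infinity>"
        using jacobi_u_pos[OF th, of a b j] by (auto simp: ennreal_mult_less_top)
      then show ?case unfolding jacobi_frac_defined_def by (intro integrableI_bounded tl(1))
    qed
  next
    fix a b p q :: real and f :: "nat \<Rightarrow> real \<Rightarrow> complex"
    assume ab: "0 \<le> a" "0 \<le> b"
      and p: "max ((2*\<alpha>+2) / (\<alpha>+3/2)) ((2*\<beta>+2) / (\<beta>+3/2)) < p" and q: "p \<le> q"
       "ereal q < min (upper_exponent \<alpha>) (upper_exponent \<beta>)"
       "1 / q \<ge> 1 / p - min (\<sigma> / (2*\<alpha>+2)) (\<sigma> / (2*\<beta>+2))"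
      and f: "\<forall>j. in_Lp p ?M (f j)"
    have fm [measurable]: "f j \<in> borel_measurable ?M" for j using f by (auto simp: in_Lp_def)
    have "(2*\<beta>+2) / (\<beta>+3/2) > 0" using be by (intro divide_pos_pos) auto
    then have q0: "q > 0" using p q by simp
    let ?F = "\<lambda>\<phi>. l2_seq_norm (\<lambda>j. f j \<phi>)"
    have Fm [measurable]: "?F \<in> borel_measurable ?M" unfolding l2_seq_norm_def by measurable
    \<comment> \<open>The majorant is one nonnegative kernel for all j. Minkowski's inequality
      therefore brings the l^2 norm under the integral, and only the scalar operator remains to be
      bounded.\<close>
    have pointwise: "l2_seq_norm (\<lambda>j. complex_of_real (jacobi_u a b j \<theta>) *
            jacobi_frac \<sigma> (\<alpha> + a * real j) (\<beta> + b * real j)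
              (\<lambda>\<phi>. f j \<phi> / complex_of_real (jacobi_u a b j \<phi>)) \<theta>) \<le> ennreal Ck * ?T ?F \<theta>" if "\<theta> \<in> space ?M" for \<theta>
    proof -
      have th: "0 < \<theta>" "\<theta> < pi" using that by auto
      let ?z = "\<lambda>j. complex_of_real (jacobi_u a b j \<theta>) *
            jacobi_frac \<sigma> (\<alpha> + a * real j) (\<beta> + b * real j)
              (\<lambda>\<phi>. f j \<phi> / complex_of_real (jacobi_u a b j \<phi>)) \<theta>"
      let ?G = "\<lambda>j \<phi>. ennreal (Ck * frac_kernel \<sigma> \<alpha> \<beta> \<theta> \<phi>) * ennreal (norm (f j \<phi>))"
      have c0: "0 \<le> Ck * frac_kernel \<sigma> \<alpha> \<beta> \<theta> \<phi>" for \<phi> using Ck frac_kernel_nonneg by (intro mult_nonneg_nonneg) auto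
      have [measurable]: "frac_kernel \<sigma> \<alpha> \<beta> \<theta> \<in> borel_measurable ?M" by (rule measurable_jacobi_measure) simp
      have z: "ennreal (norm (?z j)) \<le> (\<integral>\<^sup>+\<phi>. ?G j \<phi> \<partial>?M)" for j
      proof -
        have "ennreal (norm (?z j)) = ennreal (jacobi_u a b j \<theta>) * ennreal (norm (jacobi_frac \<sigma> (\<alpha> + a * real j) (\<beta> + b * real j)
              (\<lambda>\<phi>. f j \<phi> / complex_of_real (jacobi_u a b j \<phi>)) \<theta>))"
          using jacobi_u_pos[OF th, of a b j] by (simp add: norm_mult ennreal_mult)
        also have "\<dots> \<le> ennreal (jacobi_u a b j \<theta>) * (\<integral>\<^sup>+\<phi>. ennreal (norm (jacobi_kernel \<sigma> (\<alpha> + a * real j) (\<beta> + b * real j) \<theta> \<phi> *\<^sub>R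
          (f j \<phi> / complex_of_real (jacobi_u a b j \<phi>)))) \<partial>jacobi_measure (\<alpha> + a * real j) (\<beta> + b * real j))"
          unfolding jacobi_frac_def by (intro mult_left_mono norm_integral_le_nn_integral) simp
        also have "\<dots> \<le> (\<integral>\<^sup>+\<phi>. ?G j \<phi> \<partial>?M)"
          by (rule nn_integral_transplanted_le(2)[OF s al be ab th fm Ck(1,2)])
        finally show ?thesis .
      qed
      have "l2_seq_norm ?z = epowr (\<Sum>j. (ennreal (norm (?z j)))\<^sup>2) (1 / 2)"
        by (simp only: l2_seq_norm_def ennreal_power norm_ge_zero)
      also have "\<dots> \<le> epowr (\<Sum>j. (\<integral>\<^sup>+\<phi>. ?G j \<phi> \<partial>?M)\<^sup>2) (1 / 2)"
        by (intro epowr_mono suminf_le power_mono z) auto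
      also have "\<dots> \<le> (\<integral>\<^sup>+\<phi>. epowr (\<Sum>j. (?G j \<phi>)\<^sup>2) (1 / 2) \<partial>?M)"
        by (rule minkowski_l2) measurable
      also have "\<dots> = (\<integral>\<^sup>+\<phi>. ennreal Ck * (ennreal (frac_kernel \<sigma> \<alpha> \<beta> \<theta> \<phi>) * ?F \<phi>) \<partial>?M)"
      proof (rule nn_integral_cong)
        fix \<phi>
        have "(\<Sum>j. (?G j \<phi>)\<^sup>2) = (ennreal (Ck * frac_kernel \<sigma> \<alpha> \<beta> \<theta> \<phi>))\<^sup>2 * (\<Sum>j. (ennreal (norm (f j \<phi>)))\<^sup>2)"
          by (simp only: power_mult_distrib ennreal_suminf_cmult)
        then have "epowr (\<Sum>j. (?G j \<phi>)\<^sup>2) (1 / 2) = ennreal (Ck * frac_kernel \<sigma> \<alpha> \<beta> \<theta> \<phi>) * epowr (\<Sum>j. (ennreal (norm (f j \<phi>)))\<^sup>2) (1 / 2)"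
          by (simp only: epowr_half_cmult[OF c0])
        also have "epowr (\<Sum>j. (ennreal (norm (f j \<phi>)))\<^sup>2) (1 / 2) = ?F \<phi>"
          by (simp only: l2_seq_norm_def ennreal_power norm_ge_zero)
        finally have e1: "epowr (\<Sum>j. (?G j \<phi>)\<^sup>2) (1 / 2) = ennreal (Ck * frac_kernel \<sigma> \<alpha> \<beta> \<theta> \<phi>) * ?F \<phi>" .
        have "ennreal (Ck * frac_kernel \<sigma> \<alpha> \<beta> \<theta> \<phi>) = ennreal Ck * ennreal (frac_kernel \<sigma> \<alpha> \<beta> \<theta> \<phi>)"
          using Ck frac_kernel_nonneg by (intro ennreal_mult) auto
        with e1 show "epowr (\<Sum>j. (?G j \<phi>)\<^sup>2) (1 / 2) = ennreal Ck * (ennreal (frac_kernel \<sigma> \<alpha> \<beta> \<theta> \<phi>) * ?F \<phi>)"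
          by (simp only: mult.assoc)
      qed
      also have "\<dots> = ennreal Ck * ?T ?F \<theta>" by (rule nn_integral_cmult) measurable
      finally show ?thesis .
    qed
    have "eLp_norm q ?M (\<lambda>\<theta>. l2_seq_norm (\<lambda>j. complex_of_real (jacobi_u a b j \<theta>) *
            jacobi_frac \<sigma> (\<alpha> + a * real j) (\<beta> + b * real j)
              (\<lambda>\<phi>. f j \<phi> / complex_of_real (jacobi_u a b j \<phi>)) \<theta>)) \<le> eLp_norm q ?M (\<lambda>\<theta>. ennreal Ck * ?T ?F \<theta>)"
      by (rule eLp_norm_mono[OF pointwise q0])
    also have "\<dots> = ennreal Ck * eLp_norm q ?M (?T ?F)"
      by (rule eLp_norm_cmult[OF _ Ck(3) q0], rule frac_operator_measurable) (use al be in auto)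
    also have "\<dots> \<le> ennreal Ck * (ennreal C1 * eLp_norm p ?M ?F)"
      by (intro mult_left_mono bound[OF p q Fm]) simp
    also have "\<dots> = ennreal (Ck * C1) * eLp_norm p ?M ?F"
      using Ck C1 by (simp add: ennreal_mult mult.assoc)
    finally show "eLp_norm q ?M (\<lambda>\<theta>. l2_seq_norm (\<lambda>j. complex_of_real (jacobi_u a b j \<theta>) *
            jacobi_frac \<sigma> (\<alpha> + a * real j) (\<beta> + b * real j)
              (\<lambda>\<phi>. f j \<phi> / complex_of_real (jacobi_u a b j \<phi>)) \<theta>))
       \<le> ennreal (Ck * C1) * eLp_norm p ?M (\<lambda>\<theta>. l2_seq_norm (\<lambda>j. f j \<theta>))" .
  qed
qed

end
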